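(* Let $p$ be an odd prime and $a$ an integer with $v_p(a)=1$. Choose $\alpha_0=a$ and elements $\alpha_i$ ($i\ge1$) of an algebraic closure of $\mathbb{Q}_p$ with $\alpha_i^p=\alpha_{i-1}$, and set $K_0=\mathbb{Q}_p(\zeta_p)$, $K_i=\mathbb{Q}_p(\zeta_p,\alpha_i)$. Then for every $i\ge1$, $K_i/K_{i-1}$ is Galois with cyclic Galois group of order $p$, and the unique break number of its ramification groups (the integer $t$ with $G_t=\mathrm{Gal}(K_i/K_{i-1})$ and $G_{t+1}=1$ in lower numbering) is $b_i=p^i$.
   Context: $\zeta_p$ is a primitive $p$-th root of unity; lower numbering of ramification groups as in Serre, Local Fields, Ch. IV. *)

theory Defs
  imports "HOL-Algebra.Algebra" Complex_Main
begin

section \<open>The field of p-adic numbers\<close>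

text \<open>
  \<open>Qp p\<close> is the completion of \<open>\<rat>\<close> for the p-adic absolute value: the ring of p-adic
  Cauchy sequences of rationals modulo the ideal of p-adic null sequences.
\<close>

definition padic_val :: "nat \<Rightarrow> rat \<Rightarrow> int" where
  "padic_val p x =
     int (multiplicity (int p) (fst (quotient_of x))) -
     int (multiplicity (int p) (snd (quotient_of x)))"

definition padic_abs :: "nat \<Rightarrow> rat \<Rightarrow> real" where
  "padic_abs p x = (if x = 0 then 0 else real p powi (- padic_val p x))"

definition padic_cauchy :: "nat \<Rightarrow> (nat \<Rightarrow> rat) \<Rightarrow> bool" where
  "padic_cauchy p s \<longleftrightarrow> (\<forall>e>0. \<exists>N. \<forall>m\<ge>N. \<forall>n\<ge>N. padic_abs p (s m - s n) < e)"

definition padic_null :: "nat \<Rightarrow> (nat \<Rightarrow> rat) set" where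
  "padic_null p = {s. (\<lambda>n. padic_abs p (s n)) \<longlonglongrightarrow> 0}"

definition padic_cauchy_ring :: "nat \<Rightarrow> (nat \<Rightarrow> rat) ring" where
  "padic_cauchy_ring p =
     \<lparr>carrier = {s. padic_cauchy p s},
      monoid.mult = (\<lambda>s t n. s n * t n),
      monoid.one = (\<lambda>n. 1),
      ring.zero = (\<lambda>n. 0),
      ring.add = (\<lambda>s t n. s n + t n)\<rparr>"

definition Qp :: "nat \<Rightarrow> (nat \<Rightarrow> rat) set ring" where
  "Qp p = padic_cauchy_ring p Quot padic_null p"

text \<open>The limit below does not depend on the chosen representative of the class \<open>x\<close>.\<close>

definition Qp_abs :: "nat \<Rightarrow> (nat \<Rightarrow> rat) set \<Rightarrow> real" where
  "Qp_abs p x = lim (\<lambda>n. padic_abs p ((SOME s. s \<in> x) n))"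

definition Zp :: "nat \<Rightarrow> (nat \<Rightarrow> rat) set set" where
  "Zp p = {x \<in> carrier (Qp p). Qp_abs p x \<le> 1}"


section \<open>Galois extensions inside an ambient field\<close>

text \<open>
  Throughout, \<open>\<Omega>\<close> is an ambient field and \<open>K\<close>, \<open>L\<close> are (carriers of) subfields of it.
  As in \<open>BijGroup\<close>, automorphisms are taken to be extensional functions on \<open>L\<close>, so that
  each automorphism is represented by exactly one function.
\<close>

definition Gal_group :: "('a, 'b) ring_scheme \<Rightarrow> 'a set \<Rightarrow> 'a set \<Rightarrow> ('a \<Rightarrow> 'a) monoid" where
  "Gal_group \<Omega> L K = BijGroup L
     \<lparr>carrier := {\<sigma> \<in> Bij L. \<sigma> \<in> ring_hom (\<Omega>\<lparr>carrier := L\<rparr>) (\<Omega>\<lparr>carrier := L\<rparr>) \<and>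
                              (\<forall>x\<in>K. \<sigma> x = x)}\<rparr>"

text \<open>Definition of Artin and Bourbaki: \<open>L\<close> is algebraic over \<open>K\<close>, and \<open>K\<close> is the fixed
  field of the group of \<open>K\<close>-automorphisms of \<open>L\<close>.\<close>

definition galois_extension :: "('a, 'b) ring_scheme \<Rightarrow> 'a set \<Rightarrow> 'a set \<Rightarrow> bool" where
  "galois_extension \<Omega> L K \<longleftrightarrow>
     subfield L \<Omega> \<and> subfield K \<Omega> \<and> K \<subseteq> L \<and>
     (\<forall>x\<in>L. ring.algebraic \<Omega> K x) \<and>
     {x \<in> L. \<forall>\<sigma>\<in>carrier (Gal_group \<Omega> L K). \<sigma> x = x} = K"


section \<open>Ramification groups in lower numbering\<close>

text \<open>
  \<open>A\<close> is a complete discrete valuation ring with fraction field contained in \<open>K\<close> (below: the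
  image of \<open>Zp p\<close>), and \<open>L\<close> is finite over that fraction field. The valuation ring of \<open>L\<close> is
  then the integral closure of \<open>A\<close> in \<open>L\<close>, which is also the integral closure in \<open>L\<close> of the
  valuation ring of \<open>K\<close>.
\<close>

definition integral_over :: "('a, 'b) ring_scheme \<Rightarrow> 'a set \<Rightarrow> 'a \<Rightarrow> bool" where
  "integral_over \<Omega> A x \<longleftrightarrow>
     (\<exists>f \<in> carrier (univ_poly \<Omega> A). f \<noteq> [] \<and> lead_coeff f = \<one>\<^bsub>\<Omega>\<^esub> \<and> ring.eval \<Omega> f x = \<zero>\<^bsub>\<Omega>\<^esub>)"

definition integer_ring :: "('a, 'b) ring_scheme \<Rightarrow> 'a set \<Rightarrow> 'a set \<Rightarrow> ('a, 'b) ring_scheme" where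
  "integer_ring \<Omega> A L = \<Omega>\<lparr>carrier := {x \<in> L. integral_over \<Omega> A x}\<rparr>"

definition the_maximal_ideal :: "('a, 'b) ring_scheme \<Rightarrow> 'a set" where
  "the_maximal_ideal R = (THE P. maximalideal P R)"

fun ideal_power :: "('a, 'b) ring_scheme \<Rightarrow> 'a set \<Rightarrow> nat \<Rightarrow> 'a set" where
  "ideal_power R P 0 = carrier R"
| "ideal_power R P (Suc n) = ideal_prod R (ideal_power R P n) P"

text \<open>
  \<open>G\<^sub>t\<close> consists of the automorphisms acting trivially on \<open>B / P\<^bsup>t+1\<^esup>\<close>, where \<open>B\<close> is the
  valuation ring of \<open>L\<close> and \<open>P\<close> its maximal ideal. The index satisfies \<open>t \<ge> -1\<close>; the use of
  \<open>nat\<close> makes \<open>G\<^sub>t\<close> the whole group for smaller \<open>t\<close>.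
\<close>

definition ramification_group ::
    "('a, 'b) ring_scheme \<Rightarrow> 'a set \<Rightarrow> 'a set \<Rightarrow> 'a set \<Rightarrow> int \<Rightarrow> ('a \<Rightarrow> 'a) set" where
  "ramification_group \<Omega> A L K t =
     {\<sigma> \<in> carrier (Gal_group \<Omega> L K).
        \<forall>x \<in> carrier (integer_ring \<Omega> A L).
          \<sigma> x \<ominus>\<^bsub>\<Omega>\<^esub> x \<in>
            ideal_power (integer_ring \<Omega> A L) (the_maximal_ideal (integer_ring \<Omega> A L)) (nat (t + 1))}"

definition ramification_breaks ::
    "('a, 'b) ring_scheme \<Rightarrow> 'a set \<Rightarrow> 'a set \<Rightarrow> 'a set \<Rightarrow> int set" where
  "ramification_breaks \<Omega> A L K =
     {t. t \<ge> -1 \<and> ramification_group \<Omega> A L K t \<noteq> ramification_group \<Omega> A L K (t + 1)}"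


section \<open>The tower of fields\<close>

definition primitive_root_of_unity :: "('a, 'b) ring_scheme \<Rightarrow> nat \<Rightarrow> 'a \<Rightarrow> bool" where
  "primitive_root_of_unity \<Omega> n z \<longleftrightarrow>
     z \<in> carrier \<Omega> \<and> z [^]\<^bsub>\<Omega>\<^esub> n = \<one>\<^bsub>\<Omega>\<^esub> \<and> (\<forall>k. 0 < k \<and> k < n \<longrightarrow> z [^]\<^bsub>\<Omega>\<^esub> k \<noteq> \<one>\<^bsub>\<Omega>\<^esub>)"

definition radical_tower ::
    "('a, 'b) ring_scheme \<Rightarrow> 'a set \<Rightarrow> 'a \<Rightarrow> (nat \<Rightarrow> 'a) \<Rightarrow> nat \<Rightarrow> 'a set" where
  "radical_tower \<Omega> F \<zeta> \<alpha> i =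
     (if i = 0 then generate_field \<Omega> (F \<union> {\<zeta>}) else generate_field \<Omega> (F \<union> {\<zeta>, \<alpha> i}))"

end

theory Submission
  imports Defs
begin

text \<open>
  Chevalley's extension theorem gives valuation rings \<open>V\<close> of \<open>\<Omega>\<close> that dominate the p-adic
  integers \<open>A\<close>; let \<open>B\<close> be the intersection of all of them. Say that \<open>x\<close> has weight \<open>k\<close> if
  \<open>x\<^sup>n\<close> is \<open>p\<^sup>k\<close> up to a unit of \<open>B\<close>, where \<open>n = (p - 1) p\<^sup>i\<close>. Nonzero p-adic numbers have
  weights divisible by \<open>n\<close>, while \<open>\<zeta> - 1\<close> has weight \<open>p\<^sup>i\<close> and \<open>\<alpha>\<^sub>j\<close> has weight
  \<open>(p - 1) p\<^bsup>i-j\<^esup>\<close>. Terms of distinct weights cannot cancel, so every nonzero element of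
  \<open>K\<^sub>i\<close> has a weight, and weights on \<open>K\<^bsub>i-1\<^esub>\<close> are divisible by \<open>p\<close>. Since \<open>\<alpha>\<^sub>i\<close> and its
  conjugates \<open>\<zeta>\<^sup>c \<alpha>\<^sub>i\<close> have weight \<open>p - 1\<close>, which is prime to \<open>p\<close>, they have degree \<open>p\<close> over
  \<open>K\<^bsub>i-1\<^esub>\<close>. The weight is the normalized valuation of \<open>K\<^sub>i\<close>, and
  \<open>\<sigma> (\<Sum> d\<^sub>k \<alpha>\<^sub>i\<^sup>k) - \<Sum> d\<^sub>k \<alpha>\<^sub>i\<^sup>k = \<Sum> (\<zeta>\<^bsup>ck\<^esup> - 1) d\<^sub>k \<alpha>\<^sub>i\<^sup>k\<close> raises the weight by the weight
  \<open>p\<^sup>i\<close> of \<open>\<zeta> - 1\<close>; the term \<open>k = 0\<close>, the only one that can have weight \<open>0\<close>, disappears.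

  Working with \<open>B\<close> instead of a single \<open>V\<close> makes the uniqueness of the extended valuation,
  hence completeness, unnecessary: an element is integral over \<open>A\<close> iff it lies in every
  valuation ring containing \<open>A\<close>, and those in which \<open>p\<close> is invertible contain every element
  that is algebraic over the p-adic numbers.
\<close>

section \<open>Polynomial expressions and valuation rings\<close>

text \<open>The exponent n = (p - 1) p^i is the ramification index of K_i over the p-adic numbers.
  Taking n-th powers replaces values in (1/n)Z by integral powers of p, so no value group has to be
  constructed. The price is that \<open>wt\<close> is a partial predicate: an element need not have
  a weight, and that all nonzero elements of K_i have one is a result about coefficient lists.

  There is no induction along the tower. For one fixed i all weights are measured by the same n, and
  K_{i-1} is reached from the field of \<zeta> in a single extension. No irreducibility criterion is
  invoked: a polynomial that is too short cannot vanish, because its terms have weights in distinct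
  residue classes.

  The break is e = p^i for two reasons. In an integral element the terms that survive have weight
  prime to p, hence at least 1, so every automorphism moves the element by weight at least e + 1. On
  the other hand (\<zeta> - 1) / \<alpha>_i^m with m = (p^i - 1) / (p - 1) has weight 1 and is moved
  by exactly e + 1 unless the automorphism is trivial.\<close>

fun (in ring) pspan :: "'a set \<Rightarrow> 'a \<Rightarrow> nat \<Rightarrow> 'a set" where
  "pspan M x 0 = {\<zero>}"
| "pspan M x (Suc N) = {l \<oplus> m \<otimes> x [^] N | l m. l \<in> pspan M x N \<and> m \<in> M}"

lemma (in ring) pspan_SucI:
  "l \<in> pspan M x N \<Longrightarrow> m \<in> M \<Longrightarrow> l' = l \<oplus> m \<otimes> x [^] N \<Longrightarrow> l' \<in> pspan M x (Suc N)"
  by auto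

lemma (in ring) pspan_SucE:
  assumes "l \<in> pspan M x (Suc N)"
  obtains a m where "l = a \<oplus> m \<otimes> x [^] N" "a \<in> pspan M x N" "m \<in> M"
  using assms by auto

locale span_coeffs = cring +
  fixes M :: "'a set"
  assumes M_carrier: "M \<subseteq> carrier R" and M_zero: "\<zero> \<in> M"
    and M_add: "\<lbrakk>a \<in> M; b \<in> M\<rbrakk> \<Longrightarrow> a \<oplus> b \<in> M"
begin

lemma pspan_carrier: "x \<in> carrier R \<Longrightarrow> l \<in> pspan M x N \<Longrightarrow> l \<in> carrier R"
  using M_carrier by (induction N arbitrary: l) auto

lemma pspan_add:
  assumes x: "x \<in> carrier R" and "l \<in> pspan M x N" and "l' \<in> pspan M x N"
  shows "l \<oplus> l' \<in> pspan M x N"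
  using assms(2,3)
proof (induction N arbitrary: l l')
  case (Suc N)
  then obtain a m a' m' where *: "l = a \<oplus> m \<otimes> x [^] N" "l' = a' \<oplus> m' \<otimes> x [^] N"
    "a \<in> pspan M x N" "a' \<in> pspan M x N" "m \<in> M" "m' \<in> M" by (metis pspan_SucE)
  have c: "a \<in> carrier R" "a' \<in> carrier R" "m \<in> carrier R" "m' \<in> carrier R" "x [^] N \<in> carrier R"
    using * pspan_carrier x M_carrier by auto
  have "l \<oplus> l' = (a \<oplus> a') \<oplus> (m \<oplus> m') \<otimes> x [^] N"
    using c unfolding * by algebra
  then show ?case by (rule pspan_SucI[OF Suc.IH[OF *(3,4)] M_add[OF *(5,6)]])
qed auto

lemma pspan_zero: "x \<in> carrier R \<Longrightarrow> \<zero> \<in> pspan M x N"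
proof (induction N)
  case (Suc N)
  have "\<zero> = \<zero> \<oplus> \<zero> \<otimes> x [^] N" using Suc.prems by simp
  then show ?case by (rule pspan_SucI[OF Suc.IH[OF Suc.prems] M_zero])
qed auto

lemma pspan_mono: 
  assumes "x \<in> carrier R" and "N \<le> N'" and "l \<in> pspan M x N"
  shows "l \<in> pspan M x N'"
  using assms(2,1,3)
proof (induction N' rule: dec_induct)
  case (step n)
  then have "l \<in> pspan M x n" "l = l \<oplus> \<zero> \<otimes> x [^] n"
    using pspan_carrier by auto
  then show ?case by (intro pspan_SucI[OF _ M_zero])
qed auto

lemma pspan_const: "x \<in> carrier R \<Longrightarrow> m \<in> M \<Longrightarrow> m \<in> pspan M x (Suc N)"
  by (rule pspan_mono[of x "Suc 0"], simp, simp, rule pspan_SucI[of \<zero> M x 0 m]) (use M_carrier in auto)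

lemma pspan_shift:
  assumes x: "x \<in> carrier R" and "l \<in> pspan M x N"
  shows "x \<otimes> l \<in> pspan M x (Suc N)"
  using assms(2)
proof (induction N arbitrary: l)
  case 0
  then show ?case using pspan_zero[of x "Suc 0"] x by auto
next
  case (Suc N)
  then obtain a m where *: "l = a \<oplus> m \<otimes> x [^] N" "a \<in> pspan M x N" "m \<in> M"
    by (metis pspan_SucE)
  have c: "a \<in> carrier R" "m \<in> carrier R" "x [^] N \<in> carrier R"
    using * pspan_carrier x M_carrier by auto
  have "x \<otimes> l = x \<otimes> a \<oplus> m \<otimes> (x [^] N \<otimes> x)"
    using c x unfolding * by algebra
  then show ?case by (intro pspan_SucI[OF Suc.IH[OF *(2)] *(3)]) simp
qed

lemma pspan_shift_pow:
  assumes x: "x \<in> carrier R" and "l \<in> pspan M x N"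
  shows "x [^] k \<otimes> l \<in> pspan M x (N + k)"
proof (induction k)
  case 0
  then show ?case using assms pspan_carrier by auto
next
  case (Suc k)
  have "x [^] Suc k \<otimes> l = x \<otimes> (x [^] k \<otimes> l)"
    using x pspan_carrier[OF x assms(2)] by (simp add: m_ac)
  then show ?case using pspan_shift[OF x Suc.IH] by simp
qed

lemma pspan_scale:
  assumes x: "x \<in> carrier R" and v: "v \<in> carrier R" and "\<And>m. m \<in> M \<Longrightarrow> v \<otimes> m \<in> M'"
    and "l \<in> pspan M x N"
  shows "v \<otimes> l \<in> pspan M' x N"
  using assms(4)
proof (induction N arbitrary: l)
  case (Suc N)
  then obtain a m where *: "l = a \<oplus> m \<otimes> x [^] N" "a \<in> pspan M x N" "m \<in> M"
    by (metis pspan_SucE)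
  have c: "a \<in> carrier R" "m \<in> carrier R" "x [^] N \<in> carrier R"
    using * pspan_carrier x M_carrier by auto
  have "v \<otimes> l = v \<otimes> a \<oplus> (v \<otimes> m) \<otimes> x [^] N"
    using c v unfolding * by algebra
  then show ?case by (rule pspan_SucI[OF Suc.IH[OF *(2)] assms(3)[OF *(3)]])
qed (use v in auto)

text \<open>Since x^N w^k = x^(N-k), multiplication by x^N reads the coefficients backwards: the
  constant coefficient b moves to the top and the rest is an expression in x of length N. The
  passages between x and 1/x below rely on this.\<close>

lemma pspan_reverse:
  assumes x: "x \<in> carrier R" and w: "w \<in> carrier R" and xw: "x \<otimes> w = \<one>"
    and "l \<in> pspan M w (Suc N)"
  shows "\<exists>b\<in>M. \<exists>r\<in>pspan M x N. x [^] N \<otimes> l = b \<otimes> x [^] N \<oplus> r"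
  using assms(4)
proof (induction N arbitrary: l)
  case 0
  then have "l \<in> M" using M_carrier by (auto simp: subset_iff)
  then show ?case using M_carrier by (intro bexI[of _ l] bexI[of _ \<zero>]) auto
next
  case (Suc N)
  then obtain a m where *: "l = a \<oplus> m \<otimes> w [^] Suc N" "a \<in> pspan M w (Suc N)" "m \<in> M"
    by (metis pspan_SucE)
  from Suc.IH[OF *(2)] obtain b r where br: "b \<in> M" "r \<in> pspan M x N"
    "x [^] N \<otimes> a = b \<otimes> x [^] N \<oplus> r" by auto
  have c: "a \<in> carrier R" "m \<in> carrier R" "x [^] N \<in> carrier R" "b \<in> carrier R" "r \<in> carrier R"
    "x [^] Suc N \<in> carrier R" "w [^] Suc N \<in> carrier R"
    using * br pspan_carrier[OF w *(2)] pspan_carrier[OF x br(2)] x w M_carrier by auto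
  have one: "x [^] Suc N \<otimes> w [^] Suc N = \<one>"
    using nat_pow_distrib[OF x w, of "Suc N"] xw by simp
  have "x [^] Suc N \<otimes> l = x \<otimes> (x [^] N \<otimes> a) \<oplus> m \<otimes> (x [^] Suc N \<otimes> w [^] Suc N)"
  proof -
    have "x [^] Suc N \<otimes> l = x [^] Suc N \<otimes> a \<oplus> m \<otimes> (x [^] Suc N \<otimes> w [^] Suc N)"
      using c unfolding * by algebra
    moreover have "x [^] Suc N \<otimes> a = x \<otimes> (x [^] N \<otimes> a)" using c x by (simp add: m_ac)
    ultimately show ?thesis by simp
  qed
  also have "\<dots> = x \<otimes> (b \<otimes> x [^] N \<oplus> r) \<oplus> m" using one br c by simp
  also have "\<dots> = b \<otimes> (x [^] N \<otimes> x) \<oplus> (x \<otimes> r \<oplus> m)" using c x by algebra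
  finally have "x [^] Suc N \<otimes> l = b \<otimes> x [^] Suc N \<oplus> (x \<otimes> r \<oplus> m)" by simp
  moreover have "x \<otimes> r \<oplus> m \<in> pspan M x (Suc N)"
    using pspan_add[OF x pspan_shift[OF x br(2)] pspan_const[OF x *(3)]] .
  ultimately show ?case using br(1) by blast
qed

end

section \<open>Adjoining an element to a subring\<close>

context cring
begin

lemma span_coeffs_subring: "subring S R \<Longrightarrow> span_coeffs R S"
  by unfold_locales (use subringE[of S R] in auto)

definition adjoin :: "'a set \<Rightarrow> 'a \<Rightarrow> 'a set" where
  "adjoin S x = (\<Union>N. pspan S x N)"

lemma pspan_subring:
  assumes S: "subring S R" and x: "x \<in> S" and l: "l \<in> pspan S x N"
  shows "l \<in> S"
proof -
  have "x [^] k \<in> S" for k :: nat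
    using subringE[OF S] x by (induction k) auto
  then show ?thesis
    using l
  proof (induction N arbitrary: l)
    case (Suc N)
    then show ?case using subringE(6,7)[OF S] by (elim pspan_SucE) simp
  qed (use subringE[OF S] in auto)
qed

lemma adjoin_subring:
  assumes S: "subring S R" and x: "x \<in> carrier R"
  shows "subring (adjoin S x) R" "S \<subseteq> adjoin S x" "x \<in> adjoin S x"
proof -
  interpret S: span_coeffs R S by (rule span_coeffs_subring[OF S])
  note SE = subringE[OF S]
  have up: "l \<in> pspan S x N \<Longrightarrow> l \<in> pspan S x (N + N')" "l \<in> pspan S x N \<Longrightarrow> l \<in> pspan S x (N' + N)"
    for l N N' by (auto intro: S.pspan_mono[OF x, of N])
  have mult: "l \<otimes> l' \<in> pspan S x (N + N')"
    if "l \<in> pspan S x N" and l': "l' \<in> pspan S x N'" for l l' N N'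
    using that(1)
  proof (induction N arbitrary: l)
    case 0
    then show ?case using S.pspan_zero[OF x] S.pspan_carrier[OF x l'] by simp
  next
    case (Suc N)
    then obtain a m where *: "l = a \<oplus> m \<otimes> x [^] N" "a \<in> pspan S x N" "m \<in> S"
      by (metis pspan_SucE)
    have c: "a \<in> carrier R" "m \<in> carrier R" "x [^] N \<in> carrier R" "l' \<in> carrier R"
      using * S.pspan_carrier[OF x] l' x SE(1) by auto
    have "l \<otimes> l' = a \<otimes> l' \<oplus> m \<otimes> (x [^] N \<otimes> l')"
      using c unfolding * by algebra
    moreover have "m \<otimes> (x [^] N \<otimes> l') \<in> pspan S x (N' + N)"
      by (rule S.pspan_scale[OF x c(2) _ S.pspan_shift_pow[OF x l']]) (use * SE in auto)
    ultimately have "l \<otimes> l' \<in> pspan S x (N + N')"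
      using S.pspan_add[OF x Suc.IH[OF *(2)]] by (simp add: add.commute)
    then show ?case using up(2)[of _ _ 1] by simp
  qed
  show "S \<subseteq> adjoin S x" unfolding adjoin_def using S.pspan_const[OF x] by blast
  then have one: "\<one> \<in> adjoin S x" using SE by auto
  have "x \<otimes> \<one> \<in> pspan S x (Suc (Suc 0))"
    by (rule S.pspan_shift[OF x S.pspan_const[OF x]]) (use SE in auto)
  then show "x \<in> adjoin S x" unfolding adjoin_def using x by (metis UN_I UNIV_I r_one)
  show "subring (adjoin S x) R"
  proof (rule subringI)
    show "adjoin S x \<subseteq> carrier R" unfolding adjoin_def using S.pspan_carrier[OF x] by auto
    show "\<ominus> h \<in> adjoin S x" if h: "h \<in> adjoin S x" for h
    proof -
      obtain N where N: "h \<in> pspan S x N" using h by (auto simp: adjoin_def)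
      have "\<ominus> \<one> \<otimes> h \<in> pspan S x N"
        by (rule S.pspan_scale[OF x _ _ N]) (use SE in auto)
      moreover have "\<ominus> \<one> \<otimes> h = \<ominus> h" using S.pspan_carrier[OF x N] by algebra
      ultimately show ?thesis by (auto simp: adjoin_def)
    qed
    show "h1 \<oplus> h2 \<in> adjoin S x" "h1 \<otimes> h2 \<in> adjoin S x"
      if h: "h1 \<in> adjoin S x" "h2 \<in> adjoin S x" for h1 h2
    proof -
      obtain N1 N2 where N: "h1 \<in> pspan S x N1" "h2 \<in> pspan S x N2"
        using h by (auto simp: adjoin_def)
      show "h1 \<oplus> h2 \<in> adjoin S x"
        using S.pspan_add[OF x up(1)[OF N(1), of N2] up(2)[OF N(2), of N1]]
        by (auto simp: adjoin_def)
      show "h1 \<otimes> h2 \<in> adjoin S x"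
        using mult[OF N] by (auto simp: adjoin_def)
    qed
  qed (rule one)
qed

end

section \<open>Existence of valuation rings of a field\<close>

context field
begin

lemma inv_carrier: "x \<in> carrier R \<Longrightarrow> x \<noteq> \<zero> \<Longrightarrow> inv x \<in> carrier R"
  "x \<in> carrier R \<Longrightarrow> x \<noteq> \<zero> \<Longrightarrow> x \<otimes> inv x = \<one>"
  "x \<in> carrier R \<Longrightarrow> x \<noteq> \<zero> \<Longrightarrow> inv x \<otimes> x = \<one>"
  using field_Units Units_inv_closed Units_r_inv Units_l_inv by auto

definition valuation_ring :: "'a set \<Rightarrow> bool" where
  "valuation_ring V \<longleftrightarrow> subring V R \<and> (\<forall>x\<in>carrier R. x \<noteq> \<zero> \<longrightarrow> x \<in> V \<or> inv x \<in> V)"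

lemma subring_pow: "subring V R \<Longrightarrow> x \<in> V \<Longrightarrow> x [^] (k::nat) \<in> V"
  using subringE[of V R] by (induction k) auto

text \<open>
  If neither \<open>x\<close> nor \<open>1/x\<close> lies in \<open>V\<close>, maximality expresses \<open>1\<close> as a polynomial in each of
  them with coefficients in \<open>y V\<close>. As \<open>1 - y b\<close> is a unit of \<open>V\<close> for \<open>b\<close> in \<open>V\<close>, the shorter of
  two shortest such expressions can be used to shorten the longer one.
\<close>

lemma maximal_imp_valuation_ring:
  assumes V: "subring V R" and y: "y \<in> V" and w: "w \<in> carrier R" "w \<notin> V" and yw: "y \<otimes> w = \<one>"
    and max: "\<And>S. subring S R \<Longrightarrow> V \<subseteq> S \<Longrightarrow> w \<notin> S \<Longrightarrow> S = V"
  shows "valuation_ring V"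
proof -
  interpret V: span_coeffs R V by (rule span_coeffs_subring[OF V])
  note VE = subringE[OF V]
  have yc: "y \<in> carrier R" using VE y by auto
  \<comment> \<open>Otherwise \<open>adjoin V x\<close> would avoid w and hence equal V by
    maximality, although it contains x.\<close>
  have adj: "\<exists>N. w \<in> pspan V x N" if x: "x \<in> carrier R" "x \<notin> V" for x
    using max[OF adjoin_subring(1,2)[OF V x(1)]] adjoin_subring(3)[OF V x(1)] x(2)
    by (auto simp: adjoin_def)
  have unit: "\<one> \<ominus> y \<otimes> b \<noteq> \<zero> \<and> inv (\<one> \<ominus> y \<otimes> b) \<in> V" if b: "b \<in> V" for b
  proof -
    define u where "u = \<one> \<ominus> y \<otimes> b"
    have bc: "b \<in> carrier R" using b VE by auto
    have uc: "u \<in> carrier R" and uV: "u \<in> V"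
      using yc bc y b VE by (auto simp: u_def a_minus_def)
    have u0: "u \<noteq> \<zero>"
    proof
      assume "u = \<zero>"
      then have "y \<otimes> b = \<one>" using bc yc unfolding u_def by (metis m_closed one_closed r_right_minus_eq)
      then have "w = b" using yw bc w yc by (metis m_assoc m_comm l_one)
      with b w show False by simp
    qed
    note iu = inv_carrier[OF uc u0]
    have "inv u \<in> V"
    proof (rule ccontr)
      assume "inv u \<notin> V"
      then obtain N where "w \<in> pspan V (inv u) N" using adj iu by blast
      then have "w \<in> pspan V (inv u) (Suc N)" using V.pspan_mono[OF iu(1), of N "Suc N"] by simp
      from V.pspan_reverse[OF uc iu(1,2) this] obtain c r where
        cr: "c \<in> V" "r \<in> pspan V u N" "u [^] N \<otimes> w = c \<otimes> u [^] N \<oplus> r" by auto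
      have "r \<in> V" using pspan_subring[OF V uV cr(2)] .
      then have uw: "u [^] N \<otimes> w \<in> V" using cr subring_pow[OF V uV] VE by simp
      \<comment> \<open>Powers of u stay in 1 + y V. As y w = 1, multiplying w by such a power
        changes it only by an element d of V, so \<open>uw\<close> would put w itself into
        V.\<close>
      have "\<exists>d\<in>V. u [^] k = \<one> \<ominus> y \<otimes> d" for k :: nat
      proof (induction k)
        case 0
        have "u [^] (0::nat) = \<one> \<ominus> y \<otimes> \<zero>" using yc by (simp add: a_minus_def)
        then show ?case using VE by blast
      next
        case (Suc k)
        then obtain d where d: "d \<in> V" "u [^] k = \<one> \<ominus> y \<otimes> d" by auto
        have dc: "d \<in> carrier R" using d VE by auto
        have "u [^] Suc k = (\<one> \<ominus> y \<otimes> d) \<otimes> (\<one> \<ominus> y \<otimes> b)" using d by (simp add: u_def)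
        also have "\<dots> = \<one> \<ominus> y \<otimes> (d \<oplus> (b \<ominus> y \<otimes> d \<otimes> b))" using yc bc dc by algebra
        finally show ?case using d b y VE by (metis (no_types, lifting) a_minus_def)
      qed
      then obtain d where d: "d \<in> V" "u [^] N = \<one> \<ominus> y \<otimes> d" by blast
      have dc: "d \<in> carrier R" using d VE by auto
      have "u [^] N \<otimes> w = w \<ominus> d \<otimes> (y \<otimes> w)" using d dc yc w by algebra
      then have "w = u [^] N \<otimes> w \<oplus> d" using yw dc w by (simp, algebra)
      then show False using uw d w VE by metis
    qed
    then show ?thesis using u0 by (simp add: u_def)
  qed
  define M where "M = {y \<otimes> v | v. v \<in> V}"
  have MM: "y \<otimes> v \<in> M" if "v \<in> V" for v using that by (auto simp: M_def)
  interpret M: span_coeffs R M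
  proof unfold_locales
    show "M \<subseteq> carrier R" using VE yc by (auto simp: M_def)
    show "\<zero> \<in> M" using VE(2) yc MM[OF VE(2)] by simp
    fix a b assume "a \<in> M" "b \<in> M"
    then obtain v v' where v: "v \<in> V" "v' \<in> V" "a = y \<otimes> v" "b = y \<otimes> v'" by (auto simp: M_def)
    then have "a \<oplus> b = y \<otimes> (v \<oplus> v')" using VE(1) yc by (simp add: r_distr subset_iff)
    then show "a \<oplus> b \<in> M" using MM VE v by auto
  qed
  have MV: "v \<otimes> m \<in> M" if vm: "v \<in> V" "m \<in> M" for v m
  proof -
    obtain v' where v': "v' \<in> V" "m = y \<otimes> v'" using vm by (auto simp: M_def)
    have "v \<otimes> m = y \<otimes> (v \<otimes> v')" using v' vm yc VE(1) by (simp add: m_lcomm subset_iff)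
    then show ?thesis using MM VE vm v' by auto
  qed
  have "m \<otimes> z \<in> pspan M x N" if "x \<in> carrier R" "m \<in> M" "z \<in> pspan M x N" for m z x N
  proof (rule M.pspan_scale[OF that(1) _ _ that(3)])
    have "M \<subseteq> V" using VE(6) y by (auto simp: M_def)
    then show "m \<in> carrier R" "\<And>m'. m' \<in> M \<Longrightarrow> m \<otimes> m' \<in> M"
      using that(2) MV VE(1) by blast+
  qed
  note Mscale = this
  \<comment> \<open>Multiplying an expression for w by y turns its coefficients into elements of y V
    and its value into 1.\<close>
  have one: "\<exists>N. \<one> \<in> pspan M x N" if x: "x \<in> carrier R" "x \<notin> V" for x
  proof -
    obtain N where N: "w \<in> pspan V x N" using adj[OF x] by auto
    have "y \<otimes> w \<in> pspan M x N" by (rule V.pspan_scale[OF x(1) yc MM N])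
    then show ?thesis using yw by auto
  qed
  have no: False if x: "x \<in> carrier R" and x': "x' \<in> carrier R" and xx': "x \<otimes> x' = \<one>"
    and n: "\<one> \<in> pspan M x n" and min: "\<And>k. k < n \<Longrightarrow> \<one> \<notin> pspan M x k"
    and m: "\<one> \<in> pspan M x' m" and mn: "m \<le> n" for x x' n m
  proof -
    have "n \<noteq> 0" "m \<noteq> 0" using n m one_not_zero by (auto intro: ccontr)
    then obtain n' m' where nm: "n = Suc n'" "m = Suc m'" by (metis not0_implies_Suc)
    obtain b r where br: "b \<in> M" "r \<in> pspan M x m'" "x [^] m' \<otimes> \<one> = b \<otimes> x [^] m' \<oplus> r"
      using M.pspan_reverse[OF x x' xx' m[unfolded nm]] by auto
    obtain b' where b': "b' \<in> V" "b = y \<otimes> b'" using br by (auto simp: M_def)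
    define u where "u = \<one> \<ominus> b"
    have u: "u \<noteq> \<zero>" "inv u \<in> V" "u \<in> carrier R" and bc: "b \<in> carrier R"
      using unit[OF b'(1)] b' yc VE(1) by (auto simp: u_def subset_iff)
    have rc: "r \<in> carrier R" using M.pspan_carrier[OF x br(2)] .
    have pc: "x [^] m' \<in> carrier R" using x by simp
    have pe: "x [^] m' = b \<otimes> x [^] m' \<oplus> r" using br pc by simp
    \<comment> \<open>Dividing the reversed expression by the unit u writes x^m' through lower
      powers. Shifted by n' - m', this does the same for x^n', the top power in the shortest
      expression of 1 in x, which thereby becomes shorter.\<close>
    have "u \<otimes> x [^] m' = x [^] m' \<ominus> b \<otimes> x [^] m'" unfolding u_def using bc pc by algebra
    also have "\<dots> = (b \<otimes> x [^] m' \<oplus> r) \<ominus> b \<otimes> x [^] m'" using pe by simp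
    also have "\<dots> = r" using bc pc rc by algebra
    finally have "x [^] m' = inv u \<otimes> r" using u pc inv_carrier[OF u(3,1)]
      by (metis l_one m_assoc)
    moreover have "inv u \<otimes> r \<in> pspan M x m'"
      by (rule M.pspan_scale[OF x _ _ br(2)]) (use u VE MV in auto)
    ultimately have "x [^] m' \<in> pspan M x m'" by simp
    then have "x [^] (n' - m') \<otimes> x [^] m' \<in> pspan M x (m' + (n' - m'))"
      by (rule M.pspan_shift_pow[OF x])
    then have xn: "x [^] n' \<in> pspan M x n'" using x nm mn by (simp add: nat_pow_mult)
    obtain l c where lc: "\<one> = l \<oplus> c \<otimes> x [^] n'" "l \<in> pspan M x n'" "c \<in> M"
      using n nm by (metis pspan_SucE)
    have "l \<oplus> c \<otimes> x [^] n' \<in> pspan M x n'"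
      by (rule M.pspan_add[OF x lc(2) Mscale[OF x lc(3) xn]])
    then show False using min[of n'] lc(1) nm by simp
  qed
  show ?thesis unfolding valuation_ring_def
  proof (intro conjI V ballI impI, rule ccontr)
    fix x assume x: "x \<in> carrier R" "x \<noteq> \<zero>" and "\<not> (x \<in> V \<or> inv x \<in> V)"
    then have nV: "x \<notin> V" "inv x \<notin> V" by auto
    note ix = inv_carrier[OF x]
    define n where "n = (LEAST n. \<one> \<in> pspan M x n)"
    define m where "m = (LEAST n. \<one> \<in> pspan M (inv x) n)"
    have n: "\<one> \<in> pspan M x n" "\<And>k. k < n \<Longrightarrow> \<one> \<notin> pspan M x k"
      using LeastI_ex[OF one[OF x(1) nV(1)]] not_less_Least by (auto simp: n_def)
    have m: "\<one> \<in> pspan M (inv x) m" "\<And>k. k < m \<Longrightarrow> \<one> \<notin> pspan M (inv x) k"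
      using LeastI_ex[OF one[OF ix(1) nV(2)]] not_less_Least by (auto simp: m_def)
    show False
    proof (cases "m \<le> n")
      case True
      from no[OF x(1) ix(1,2) n m(1) True] show False .
    next
      case False
      then have "n \<le> m" by simp
      from no[OF ix(1) x(1) ix(3) m n(1) this] show False .
    qed
  qed
qed

text \<open>Domination is encoded by avoiding the single element w = 1/y, which makes y a nonunit of
  V. Subrings that contain S and avoid w are stable under unions of chains, so Zorn's lemma supplies
  a maximal one.\<close>

lemma valuation_ring_extension:
  assumes S: "subring S R" and y: "y \<in> S" and w: "w \<in> carrier R" "w \<notin> S" and yw: "y \<otimes> w = \<one>"
  shows "\<exists>V. valuation_ring V \<and> S \<subseteq> V \<and> w \<notin> V"
proof -
  let ?C = "{T. subring T R \<and> S \<subseteq> T \<and> w \<notin> T}"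
  have "\<exists>V\<in>?C. \<forall>T\<in>?C. V \<subseteq> T \<longrightarrow> T = V"
  proof (rule subset_Zorn_nonempty)
    show "?C \<noteq> {}" using S w by auto
    fix C assume C: "C \<noteq> {}" "subset.chain ?C C"
    have sub: "\<And>T. T \<in> C \<Longrightarrow> subring T R \<and> S \<subseteq> T \<and> w \<notin> T" using C by (auto simp: subset.chain_def)
    have tot: "\<And>T U. T \<in> C \<Longrightarrow> U \<in> C \<Longrightarrow> T \<subseteq> U \<or> U \<subseteq> T" using C by (auto simp: subset.chain_def)
    have "subring (\<Union>C) R"
    proof (rule subringI)
      show "\<Union>C \<subseteq> carrier R" using sub subringE(1) by blast
      show "\<one> \<in> \<Union>C" using C(1) sub subringE(3) by blast
      show "\<ominus> h \<in> \<Union>C" if h: "h \<in> \<Union>C" for h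
      proof -
        obtain T where T: "T \<in> C" "h \<in> T" using h by blast
        show ?thesis using subringE(5)[of T R h] sub[OF T(1)] T by blast
      qed
      fix a b assume "a \<in> \<Union>C" "b \<in> \<Union>C"
      then obtain T U where "T \<in> C" "U \<in> C" "a \<in> T" "b \<in> U" by auto
      then obtain W where W: "W \<in> C" "a \<in> W" "b \<in> W" using tot by blast
      show "a \<otimes> b \<in> \<Union>C" "a \<oplus> b \<in> \<Union>C"
        using subringE(6,7)[of W R a b] sub[OF W(1)] W by blast+
    qed
    then show "\<Union>C \<in> ?C" using C(1) sub by blast
  qed
  then obtain V where V': "V \<in> ?C" and max: "\<forall>T\<in>?C. V \<subseteq> T \<longrightarrow> T = V" by (rule bexE)
  then have V: "subring V R" "S \<subseteq> V" "w \<notin> V" by auto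
  have "valuation_ring V"
  proof (rule maximal_imp_valuation_ring[OF V(1) _ w(1) V(3) yw])
    show "T = V" if "subring T R" "V \<subseteq> T" "w \<notin> T" for T
      using max[rule_format, of T] that V(2) by simp
  qed (use y V in auto)
  then show ?thesis using V by auto
qed

end

section \<open>Integral elements\<close>

lemma (in ring) pspan_eval:
  "l \<in> pspan M x N \<longleftrightarrow> (\<exists>f. length f = N \<and> set f \<subseteq> M \<and> eval f x = l)" 
  if "M \<subseteq> carrier R" "x \<in> carrier R"
proof (induction N arbitrary: l)
  case (Suc N)
  show ?case
  proof
    assume "l \<in> pspan M x (Suc N)"
    then obtain a m where *: "l = a \<oplus> m \<otimes> x [^] N" "a \<in> pspan M x N" "m \<in> M"
      by (metis pspan_SucE)
    then obtain f where f: "length f = N" "set f \<subseteq> M" "eval f x = a" using Suc.IH by auto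
    have "eval f x \<in> carrier R" "m \<otimes> x [^] N \<in> carrier R"
      using f * that eval_in_carrier[of f x] by auto
    then have "eval (m # f) x = l" using f * by (simp add: add.m_comm)
    then show "\<exists>f. length f = Suc N \<and> set f \<subseteq> M \<and> eval f x = l"
      using f * by (intro exI[of _ "m # f"]) auto
  next
    assume "\<exists>f. length f = Suc N \<and> set f \<subseteq> M \<and> eval f x = l"
    then obtain m f where f: "length f = N" "set f \<subseteq> M" "m \<in> M" "eval (m # f) x = l"
      by (auto simp: length_Suc_conv)
    have "eval f x \<in> carrier R" "m \<otimes> x [^] N \<in> carrier R"
      using f that eval_in_carrier[of f x] by auto
    moreover have "eval f x \<in> pspan M x N" using Suc.IH f by auto
    ultimately show "l \<in> pspan M x (Suc N)" 
      using f by (intro pspan_SucI[of "eval f x" M x N m]) (auto simp: add.m_comm)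
  qed
qed auto

context field
begin

lemma eval_map_minus:
  assumes "set f \<subseteq> carrier R" "x \<in> carrier R"
  shows "eval (map (\<lambda>c. \<ominus> c) f) x = \<ominus> eval f x"
  using assms
proof (induction f)
  case (Cons a f)
  have "eval f x \<in> carrier R" "a \<in> carrier R" "x [^] length f \<in> carrier R"
    using Cons eval_in_carrier[of f x] by auto
  then show ?case using Cons by (simp add: l_minus minus_add)
qed simp

text \<open>A monic equation solved for its top power; in this form it can be reversed by
  \<open>pspan_reverse\<close>.\<close>

lemma integral_over_iff_pspan:
  assumes A: "subring A R" and x: "x \<in> carrier R"
  shows "integral_over R A x \<longleftrightarrow> (\<exists>N. x [^] N \<in> pspan A x N)"
proof -
  interpret A: span_coeffs R A by (rule span_coeffs_subring[OF A])
  note AE = subringE[OF A]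
  show ?thesis
  proof
    assume "integral_over R A x"
    then obtain f where f: "polynomial\<^bsub>R\<^esub> A f" "f \<noteq> []" "lead_coeff f = \<one>" "eval f x = \<zero>"
      unfolding integral_over_def Bex_def univ_poly_carrier[symmetric] by blast
    then obtain g where g: "f = \<one> # g" "set g \<subseteq> A" by (cases f) (auto simp: polynomial_def)
    have gc: "set g \<subseteq> carrier R" "eval g x \<in> carrier R"
      using g AE(1) x eval_in_carrier[of g x] by auto
    have "x [^] length g \<oplus> eval g x = \<zero>" using f g x by simp
    then have "x [^] length g = \<ominus> eval g x"
      using gc(2) x minus_equality[of "x [^] length g" "eval g x"] by simp
    also have "\<dots> = eval (map (\<lambda>c. \<ominus> c) g) x" using eval_map_minus[OF gc(1) x] by simp
    also have "\<dots> \<in> pspan A x (length g)"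
      unfolding pspan_eval[OF AE(1) x] using g AE(5)
      by (intro exI[of _ "map (\<lambda>c. \<ominus> c) g"]) (auto simp: subset_iff)
    finally show "\<exists>N. x [^] N \<in> pspan A x N" by auto
  next
    assume "\<exists>N. x [^] N \<in> pspan A x N"
    then obtain N g where g: "length g = N" "set g \<subseteq> A" "eval g x = x [^] N"
      unfolding pspan_eval[OF AE(1) x] by blast
    define f where "f = \<one> # map (\<lambda>c. \<ominus> c) g"
    have gc: "set g \<subseteq> carrier R" using g AE(1) by auto
    have "eval f x = x [^] N \<oplus> \<ominus> (x [^] N)"
      using g x eval_map_minus[OF gc x] by (simp add: f_def)
    then have "eval f x = \<zero>" using x by (simp add: r_neg)
    moreover have "f \<in> carrier (A[X])"
      unfolding univ_poly_carrier[symmetric] polynomial_def f_def using g AE by auto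
    ultimately show "integral_over R A x"
      unfolding integral_over_def by (intro bexI[of _ f]) (auto simp: f_def)
  qed
qed

text \<open>If x is not in V then w = 1/x is, and dividing the equation of degree N by x^(N-1)
  writes x as a polynomial in w with coefficients in V.\<close>

lemma valuation_ring_integral:
  assumes V: "valuation_ring V" and A: "A \<subseteq> V" "subring A R"
    and x: "x \<in> carrier R" and int: "integral_over R A x"
  shows "x \<in> V"
proof (rule ccontr)
  assume nx: "x \<notin> V"
  have Vs: "subring V R" using V by (simp add: valuation_ring_def)
  interpret V: span_coeffs R V by (rule span_coeffs_subring[OF Vs])
  note VE = subringE[OF Vs]
  obtain N where "x [^] N \<in> pspan A x N"
    using int integral_over_iff_pspan[OF A(2) x] by auto
  then have N: "x [^] N \<in> pspan V x N"
    using pspan_eval[OF VE(1) x] pspan_eval[OF subringE(1)[OF A(2)] x] A(1) by blast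
  have x0: "x \<noteq> \<zero>" using nx VE by auto
  define w where "w = inv x"
  have w: "w \<in> carrier R" "w \<otimes> x = \<one>" "x \<otimes> w = \<one>"
    using inv_carrier[OF x x0] by (auto simp: w_def)
  have wV: "w \<in> V" using V nx x x0 by (auto simp: valuation_ring_def w_def)
  have "N \<noteq> 0" using N by (cases N) auto
  then obtain n where n: "N = Suc n" by (metis not0_implies_Suc)
  obtain b r where br: "b \<in> V" "r \<in> pspan V w n" "w [^] n \<otimes> x [^] N = b \<otimes> w [^] n \<oplus> r"
    using V.pspan_reverse[OF w(1) x w(2)] N n by blast
  have "w [^] n \<otimes> x [^] N = (w [^] n \<otimes> x [^] n) \<otimes> x" using w x n by (simp add: m_assoc)
  also have "\<dots> = x" using nat_pow_distrib[OF w(1) x, of n, symmetric] w(2) x by simp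
  finally have "x = b \<otimes> w [^] n \<oplus> r" using br by simp
  then show False
    using nx VE(6,7) br(1) subring_pow[OF Vs wV, of n] pspan_subring[OF Vs wV br(2)] by simp
qed

text \<open>For the converse: x in A[1/x] would become, after multiplication by a power of x, a
  monic equation for x. So if x is not integral, 1/x is not invertible in A[1/x], and some valuation
  ring contains A[1/x] but not x.\<close>

lemma integral_over_iff_valuation_rings:
  assumes A: "subring A R" and x: "x \<in> carrier R"
  shows "integral_over R A x \<longleftrightarrow> (\<forall>V. valuation_ring V \<longrightarrow> A \<subseteq> V \<longrightarrow> x \<in> V)"
proof
  assume "integral_over R A x"
  then show "\<forall>V. valuation_ring V \<longrightarrow> A \<subseteq> V \<longrightarrow> x \<in> V"
    using valuation_ring_integral[OF _ _ A x] by auto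
next
  assume all: "\<forall>V. valuation_ring V \<longrightarrow> A \<subseteq> V \<longrightarrow> x \<in> V"
  interpret A: span_coeffs R A by (rule span_coeffs_subring[OF A])
  note AE = subringE[OF A]
  show "integral_over R A x"
  proof (rule ccontr)
    assume nint: "\<not> integral_over R A x"
    then have no: "x [^] N \<notin> pspan A x N" for N using integral_over_iff_pspan[OF A x] by auto
    have x0: "x \<noteq> \<zero>"
      using no[of "Suc 0"] A.pspan_zero[OF zero_closed, of "Suc 0"] x
      by (cases "x = \<zero>") (simp_all del: pspan.simps)
    define w where "w = inv x"
    have w: "w \<in> carrier R" "w \<otimes> x = \<one>" "x \<otimes> w = \<one>"
      using inv_carrier[OF x x0] by (auto simp: w_def)
    have "x \<notin> adjoin A w"
    proof
      assume "x \<in> adjoin A w"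
      then obtain N where "x \<in> pspan A w N" by (auto simp: adjoin_def)
      then have "x \<in> pspan A w (Suc N)" using A.pspan_mono[OF w(1), of N "Suc N"] by simp
      from A.pspan_reverse[OF x w(1,3) this] obtain b r where
        br: "b \<in> A" "r \<in> pspan A x N" "x [^] N \<otimes> x = b \<otimes> x [^] N \<oplus> r" by auto
      have "b \<in> carrier R" "r \<in> carrier R" "x [^] N \<in> carrier R"
        using br A.pspan_carrier[OF x br(2)] AE(1) x by auto
      then have "x [^] Suc N = r \<oplus> b \<otimes> x [^] N" using br(3) by (simp add: add.m_comm)
      then have "x [^] Suc N \<in> pspan A x (Suc N)" by (rule pspan_SucI[OF br(2,1)])
      then show False using no by blast
    qed
    then obtain V where "valuation_ring V" "adjoin A w \<subseteq> V" "x \<notin> V"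
      using valuation_ring_extension[OF adjoin_subring(1,3)[OF A w(1)] x _ w(2)] by blast
    then show False using all adjoin_subring(2)[OF A w(1)] by blast
  qed
qed

end

section \<open>Weights\<close>

text \<open>
  The valuation normalized by the value \<open>n\<close> of \<open>q\<close>, defined on those elements whose \<open>n\<close>-th
  power is a power of \<open>q\<close> up to a unit of \<open>B\<close>.
\<close>

locale weights = field R for R (structure) +
  fixes B :: "'a set" and q :: 'a and n :: nat
  assumes B_subring: "subring B R" and q_B: "q \<in> B" and q_nonzero: "q \<noteq> \<zero>"
    and inv_q: "inv q \<notin> B" and n_pos: "n > 0"
    and B_root: "\<And>m::nat. \<lbrakk>x \<in> carrier R; x [^] m \<in> B; m > 0\<rbrakk> \<Longrightarrow> x \<in> B"
    and B_local: "\<And>m::nat. \<lbrakk>z \<in> carrier R; z [^] m = q \<otimes> b; b \<in> B; m > 0\<rbrakk> \<Longrightarrow> 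
       \<one> \<oplus> z \<noteq> \<zero> \<and> inv (\<one> \<oplus> z) \<in> B"
begin

abbreviation G :: "'a monoid" where "G \<equiv> Multiplicative_Group.mult_of R"

lemmas BE = subringE[OF B_subring]

lemma q_carrier: "q \<in> carrier R" using q_B BE by auto

text \<open>The multiplicative group supplies the powers q^k with negative k; the rewrites let its
  product, unit and natural powers appear as those of the field.\<close>

sublocale G: comm_group G
  rewrites "monoid.mult G = monoid.mult R" and "one G = one R" and "carrier G = carrier R - {\<zero>}"
    and "(([^]\<^bsub>G\<^esub>) :: 'a \<Rightarrow> nat \<Rightarrow> 'a) = ([^])"
proof -
  interpret group G by (rule field_mult_group)
  show "comm_group G" by unfold_locales (auto simp: m_comm)
qed (auto simp: Multiplicative_Group.nat_pow_mult_of)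

lemma inv_G: "x \<in> carrier R - {\<zero>} \<Longrightarrow> inv\<^bsub>G\<^esub> x = inv x"
  using m_inv_mult_of by simp

definition U where "U = {u \<in> carrier R - {\<zero>}. u \<in> B \<and> inv u \<in> B}"

lemma U_carrier: "u \<in> U \<Longrightarrow> u \<in> carrier R - {\<zero>}" and U_B: "u \<in> U \<Longrightarrow> u \<in> B"
  by (auto simp: U_def)

lemma U_one: "\<one> \<in> U"
  using BE by (auto simp: U_def)

lemma U_mult: 
  assumes "u \<in> U" "v \<in> U"
  shows "u \<otimes> v \<in> U"
proof -
  note uv = U_carrier[OF assms(1)] U_carrier[OF assms(2)]
  have "inv (u \<otimes> v) = inv u \<otimes> inv v"
    using G.inv_mult[OF uv] inv_G[OF uv(1)] inv_G[OF uv(2)] inv_G[OF G.m_closed[OF uv]] by simp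
  then show ?thesis using G.m_closed[OF uv] assms BE(6) by (auto simp: U_def)
qed

lemma U_inv: "u \<in> U \<Longrightarrow> inv u \<in> U"
  using inv_G[of u] inv_G[of "inv u"] G.inv_closed[of u] G.inv_inv[of u] by (auto simp: U_def)

lemma U_pow: "u \<in> U \<Longrightarrow> u [^] (k::nat) \<in> U"
  by (induction k) (auto simp: U_one U_mult)

definition wt :: "int \<Rightarrow> 'a \<Rightarrow> bool" where
  "wt k x \<longleftrightarrow> x \<in> carrier R - {\<zero>} \<and> (\<exists>u\<in>U. x [^] n = u \<otimes> q [^]\<^bsub>G\<^esub> k)"

lemma wtI: "x \<in> carrier R \<Longrightarrow> x \<noteq> \<zero> \<Longrightarrow> u \<in> U \<Longrightarrow> x [^] n = u \<otimes> q [^]\<^bsub>G\<^esub> k \<Longrightarrow> wt k x"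
  by (auto simp: wt_def)

lemma wt_carrier: "wt k x \<Longrightarrow> x \<in> carrier R - {\<zero>}" "wt k x \<Longrightarrow> x \<in> carrier R" "wt k x \<Longrightarrow> x \<noteq> \<zero>"
  by (auto simp: wt_def)

lemma q_G: "q \<in> carrier R - {\<zero>}" using q_carrier q_nonzero by auto

lemma qpow: "q [^]\<^bsub>G\<^esub> (k::int) \<in> carrier R - {\<zero>}"
  by (rule G.int_pow_closed) (use q_G in auto)

lemma qpow_add: "q [^]\<^bsub>G\<^esub> (k + l::int) = q [^]\<^bsub>G\<^esub> k \<otimes> q [^]\<^bsub>G\<^esub> l"
  by (rule G.int_pow_mult[OF q_G])

lemma qpow_nat: "k \<ge> 0 \<Longrightarrow> q [^]\<^bsub>G\<^esub> (k::int) = q [^] nat k"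
  using int_pow_int[of G q "nat k"] by (simp only: nat_0_le Multiplicative_Group.nat_pow_mult_of)

lemma wt_mult:
  assumes "wt k x" "wt l y"
  shows "wt (k + l) (x \<otimes> y)"
proof -
  obtain u v where uv: "u \<in> U" "v \<in> U" "x [^] n = u \<otimes> q [^]\<^bsub>G\<^esub> k" "y [^] n = v \<otimes> q [^]\<^bsub>G\<^esub> l"
    using assms by (auto simp: wt_def)
  have c: "x \<in> carrier R" "y \<in> carrier R" "u \<in> carrier R" "v \<in> carrier R"
    "q [^]\<^bsub>G\<^esub> k \<in> carrier R" "q [^]\<^bsub>G\<^esub> l \<in> carrier R"
    using wt_carrier[OF assms(1)] wt_carrier[OF assms(2)] U_carrier[OF uv(1)] U_carrier[OF uv(2)]
      qpow[of k] qpow[of l] by auto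
  have "(x \<otimes> y) [^] n = (u \<otimes> q [^]\<^bsub>G\<^esub> k) \<otimes> (v \<otimes> q [^]\<^bsub>G\<^esub> l)"
    using c uv by (simp add: nat_pow_distrib)
  also have "\<dots> = (u \<otimes> v) \<otimes> q [^]\<^bsub>G\<^esub> (k + l)"
    unfolding qpow_add using c by (simp add: m_ac)
  finally show ?thesis
    using U_mult[OF uv(1,2)] c wt_carrier(3)[OF assms(1)] wt_carrier(3)[OF assms(2)] integral[of x y]
    by (intro wtI[of _ "u \<otimes> v"]) auto
qed

lemma wt_inv:
  assumes "wt k x"
  shows "wt (- k) (inv x)"
proof -
  obtain u where u: "u \<in> U" "x [^] n = u \<otimes> q [^]\<^bsub>G\<^esub> k"
    using assms by (auto simp: wt_def)
  note x = wt_carrier(1)[OF assms]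
  have "(inv\<^bsub>G\<^esub> x) [^] n = inv\<^bsub>G\<^esub> (x [^] n)" by (rule G.nat_pow_inv[OF x])
  also have "\<dots> = inv\<^bsub>G\<^esub> u \<otimes> q [^]\<^bsub>G\<^esub> (- k)"
    unfolding u(2) using G.inv_mult[OF U_carrier[OF u(1)] qpow[of k]] G.int_pow_neg[OF q_G, of k]
    by simp
  finally show ?thesis
    using U_inv[OF u(1)] inv_G[OF x] inv_G[OF U_carrier[OF u(1)]] G.inv_closed[OF x]
    by (intro wtI[of _ "inv u"]) auto
qed

lemma wt_U: "u \<in> U \<Longrightarrow> wt 0 u"
  using U_carrier[of u] U_carrier[OF U_pow[of u n]] by (intro wtI[of _ "u [^] n"]) (auto simp: U_pow)

lemma wt_one: "wt 0 \<one>" by (rule wt_U[OF U_one])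

lemma wt_q: "wt (int n) q"
  using q_G q_carrier nat_pow_closed[OF q_carrier, of n]
  by (intro wtI[OF _ _ U_one]) (simp_all only: qpow_nat[of "int n"] of_nat_0_le_iff nat_int l_one q_nonzero not_False_eq_True)

lemma wt_pow: "wt k x \<Longrightarrow> wt (k * int m) (x [^] m)"
proof (induction m)
  case (Suc m)
  then show ?case using wt_mult[of "k * int m" "x [^] m" k x] by (simp add: algebra_simps)
qed (simp add: wt_one)

lemma wt_nonneg:
  assumes "wt k x" "k \<ge> 0"
  shows "x \<in> B"
proof -
  obtain u where u: "u \<in> U" "x [^] n = u \<otimes> q [^]\<^bsub>G\<^esub> k"
    using assms by (auto simp: wt_def)
  have "q [^]\<^bsub>G\<^esub> k = q [^] nat k" using assms by (intro qpow_nat)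
  then have "x [^] n \<in> B" using u U_B BE(6) subring_pow[OF B_subring q_B] by auto
  then show ?thesis using B_root n_pos wt_carrier(2)[OF assms(1)] by blast
qed

text \<open>If x were in B, so would be x^n / u = q^k. Multiplying by q^(-k-1), a natural power as k
  < 0, would give 1/q, which B excludes.\<close>

lemma wt_neg:
  assumes "wt k x" "k < 0"
  shows "x \<notin> B"
proof
  assume xB: "x \<in> B"
  obtain u where u: "u \<in> U" "x [^] n = u \<otimes> q [^]\<^bsub>G\<^esub> k"
    using assms by (auto simp: wt_def)
  define m where "m = nat (- k - 1)"
  have uc: "u \<in> carrier R - {\<zero>}" "inv u \<in> B" using u by (auto simp: U_def)
  have "inv u \<otimes> x [^] n = q [^]\<^bsub>G\<^esub> k"
    using u uc inv_carrier[of u] qpow[of k] by (simp add: m_assoc[symmetric])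
  moreover have "q [^]\<^bsub>G\<^esub> (- (k + 1)) = q [^] m"
    using assms qpow_nat[of "- (k + 1)"] by (simp only: m_def) simp
  moreover have "q [^]\<^bsub>G\<^esub> k \<otimes> q [^]\<^bsub>G\<^esub> (- (k + 1)) = q [^]\<^bsub>G\<^esub> (- 1 :: int)"
    unfolding qpow_add[symmetric] by simp
  moreover have "q [^]\<^bsub>G\<^esub> (- 1 :: int) = inv q"
    unfolding G.int_pow_neg[OF q_G] G.int_pow_1[OF q_G] by (rule inv_G[OF q_G])
  ultimately have "inv q = inv u \<otimes> x [^] n \<otimes> q [^] m" by metis
  then have "inv q \<in> B"
    using uc(2) BE(6) subring_pow[OF B_subring xB] subring_pow[OF B_subring q_B] by simp
  then show False using inv_q by simp
qed

lemma wt_iff: "wt k x \<Longrightarrow> x \<in> B \<longleftrightarrow> k \<ge> 0"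
  using wt_nonneg[of k x] wt_neg[of k x] by (cases "k \<ge> 0") auto

text \<open>Otherwise 1 = x / x would have the weights k - l and l - k, one of them negative,
  although 1 lies in B.\<close>

lemma wt_unique: 
  assumes "wt k x" "wt l x"
  shows "k = l"
proof -
  have "x \<otimes> inv x = \<one>" using inv_carrier(2)[OF wt_carrier(2,3)[OF assms(1)]] .
  then have "wt (k + - l) \<one>" "wt (l + - k) \<one>"
    using wt_mult[OF assms(1) wt_inv[OF assms(2)]] wt_mult[OF assms(2) wt_inv[OF assms(1)]] by simp_all
  then show ?thesis using wt_neg[of "k + - l" \<one>] wt_neg[of "l + - k" \<one>] BE(3) by linarith
qed

text \<open>With k positive, z^n is q times an element of B, which is the hypothesis of
  \<open>B_local\<close>.\<close>

lemma one_plus_U: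
  assumes "wt k z" "k > 0"
  shows "\<one> \<oplus> z \<in> U"
proof -
  obtain u where u: "u \<in> U" "z [^] n = u \<otimes> q [^]\<^bsub>G\<^esub> k"
    using assms by (auto simp: wt_def)
  note z = wt_carrier(2)[OF assms(1)]
  have zB: "z \<in> B" using wt_nonneg[OF assms(1)] assms(2) by simp
  have k: "q [^]\<^bsub>G\<^esub> k = q \<otimes> q [^] nat (k - 1)"
    using qpow_add[of 1 "k - 1"] qpow_nat[of "k - 1"] G.int_pow_1[OF q_G] assms(2) by simp
  have "z [^] n = q \<otimes> (u \<otimes> q [^] nat (k - 1))"
    using u k q_carrier U_carrier[OF u(1)] by (simp add: m_lcomm)
  moreover have "u \<otimes> q [^] nat (k - 1) \<in> B"
    using U_B[OF u(1)] BE(6) subring_pow[OF B_subring q_B] by auto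
  ultimately have "\<one> \<oplus> z \<noteq> \<zero> \<and> inv (\<one> \<oplus> z) \<in> B" using B_local[OF z _ _ n_pos] by blast
  then show ?thesis using z zB BE(3,7) by (auto simp: U_def)
qed

text \<open>Factor out the summand of least weight: x + y = x (1 + y/x), where y/x has positive
  weight, so the second factor is a unit.\<close>

lemma wt_add:
  assumes "wt k x" "wt l y" "k < l"
  shows "wt k (x \<oplus> y)"
proof -
  have c: "x \<in> carrier R" "y \<in> carrier R" "x \<noteq> \<zero>"
    using wt_carrier[OF assms(1)] wt_carrier[OF assms(2)] by auto
  note ix = inv_carrier[OF c(1,3)]
  have z: "wt (l + - k) (y \<otimes> inv x)" by (rule wt_mult[OF assms(2) wt_inv[OF assms(1)]])
  have "wt 0 (\<one> \<oplus> y \<otimes> inv x)" using one_plus_U[OF z] assms(3) wt_U by simp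
  then have "wt (k + 0) (x \<otimes> (\<one> \<oplus> y \<otimes> inv x))" by (rule wt_mult[OF assms(1)])
  moreover have "x \<otimes> (\<one> \<oplus> y \<otimes> inv x) = x \<oplus> y \<otimes> (x \<otimes> inv x)"
    using c ix(1) by algebra
  ultimately show ?thesis using ix c by simp
qed

text \<open>The weight of the sum is a hypothesis, since a sum of elements with weights need not
  have one. After division by the summand of lower weight the claim is closure of B under
  addition.\<close>

lemma wt_add_ge:
  assumes "wt k x" "wt l y" "wt m (x \<oplus> y)"
  shows "m \<ge> min k l"
proof -
  have main: "m \<ge> k" if *: "wt k x" "wt l y" "wt m (x \<oplus> y)" "k \<le> l" for k l x y
  proof -
    have c: "x \<in> carrier R" "y \<in> carrier R" "x \<noteq> \<zero>" using wt_carrier[OF *(1)] wt_carrier[OF *(2)] by auto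
    note ix = inv_carrier[OF c(1,3)]
    have "y \<otimes> inv x \<in> B" using wt_mult[OF *(2) wt_inv[OF *(1)]] wt_nonneg[of "l + - k" "y \<otimes> inv x"] *(4) by simp
    then have "\<one> \<oplus> y \<otimes> inv x \<in> B" using BE(3,7) by auto
    moreover have "(x \<oplus> y) \<otimes> inv x = x \<otimes> inv x \<oplus> y \<otimes> inv x" using c ix(1) by algebra
    moreover have "wt (m + - k) ((x \<oplus> y) \<otimes> inv x)" by (rule wt_mult[OF *(3) wt_inv[OF *(1)]])
    ultimately show ?thesis using wt_iff[of "m + - k" "(x \<oplus> y) \<otimes> inv x"] ix(2) by simp
  qed
  show ?thesis
  proof (cases "k \<le> l")
    case False
    have "x \<oplus> y = y \<oplus> x" using wt_carrier[OF assms(1)] wt_carrier[OF assms(2)] by (simp add: add.m_comm)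
    then show ?thesis using main[OF assms(2,1)] assms(3) False by simp
  qed (use main[OF assms] in simp)
qed

end

section \<open>Weights in simple extensions\<close>

lemma (in ring) univ_poly_coeffs: "f \<in> carrier (E[X]) \<Longrightarrow> set f \<subseteq> E"
  using polynomial_incl[of E f] by (simp add: univ_poly_carrier)

text \<open>Quotient and remainder are fixed before the point z, so that a single division serves
  all conjugates of a root.\<close>

lemma (in domain) long_division_eval:
  assumes E: "subfield E R" and f: "f \<in> carrier (E[X])"
    and b: "b \<in> carrier (E[X])" "b \<noteq> []"
  shows "\<exists>q\<in>carrier (E[X]). \<exists>r\<in>carrier (E[X]). length r < length b \<and>
    (\<forall>z\<in>carrier R. eval f z = eval b z \<otimes> eval q z \<oplus> eval r z)"
proof -
  have sub: "subring E R" by (rule subfieldE(1)[OF E])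
  obtain q r where qr: "q \<in> carrier (E[X])" "r \<in> carrier (E[X])"
    "f = (b \<otimes>\<^bsub>E[X]\<^esub> q) \<oplus>\<^bsub>E[X]\<^esub> r" "r = [] \<or> degree r < degree b"
    using field_long_division_theorem_shell[OF E f b(1)] b(2) by (auto simp: univ_poly_zero)
  have "eval f z = eval b z \<otimes> eval q z \<oplus> eval r z" if z: "z \<in> carrier R" for z
  proof -
    interpret h: ring_hom_cring "E[X]" R "\<lambda>p. eval p z" by (rule eval_cring_hom[OF sub z])
    show ?thesis using qr b by simp
  qed
  moreover have "length r < length b" using qr(4) b(2) by (cases b; cases r) auto
  ultimately show ?thesis using qr(1,2) by blast
qed

context weights
begin

text \<open>Lists start with the leading coefficient, hence the exponent \<open>length f\<close>.
  The predicate keeps what the weight of the value alone does not tell: as nothing cancels, each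
  single term is bounded below by that weight. The ramification estimate works term by term.\<close>

fun terms_ge :: "'a \<Rightarrow> int \<Rightarrow> 'a list \<Rightarrow> bool" where
  "terms_ge x k [] = True"
| "terms_ge x k (d # f) = ((d = \<zero> \<or> (\<exists>l\<ge>k. wt l (d \<otimes> x [^] length f))) \<and> terms_ge x k f)"

lemma terms_ge_mono: "terms_ge x k f \<Longrightarrow> k' \<le> k \<Longrightarrow> terms_ge x k' f"
  by (induction f) (auto intro: order_trans)

lemma terms_ge_zeros: "\<forall>d\<in>set f. d = \<zero> \<Longrightarrow> terms_ge x k f"
  by (induction f) auto

lemma eval_zeros: "\<forall>d\<in>set f. d = \<zero> \<Longrightarrow> x \<in> carrier R \<Longrightarrow> eval f x = \<zero>"
  by (induction f) auto

text \<open>Terms of distinct weights cannot cancel: a sum of such terms has the least of their weights.\<close>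

lemma eval_weight:
  assumes E: "E \<subseteq> carrier R" and Ew: "\<And>d. d \<in> E \<Longrightarrow> d \<noteq> \<zero> \<Longrightarrow> \<exists>k. int g dvd k \<and> wt k d"
    and x: "wt h x" and dist: "\<And>j j'. j < j' \<Longrightarrow> j' < N \<Longrightarrow> \<not> int g dvd h * (int j' - int j)"
    and f: "set f \<subseteq> E" "length f \<le> N"
  shows "(\<forall>d\<in>set f. d = \<zero>) \<or>
    (\<exists>k j. j < length f \<and> wt k (eval f x) \<and> int g dvd k - h * int j \<and> terms_ge x k f)"
  using f
proof (induction f)
  case (Cons d f)
  have xc: "x \<in> carrier R" using wt_carrier[OF x] by simp
  have dc: "d \<in> carrier R" and fc: "eval f x \<in> carrier R"
    using Cons.prems E xc eval_in_carrier[of f x] by auto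
  have IH: "(\<forall>d\<in>set f. d = \<zero>) \<or>
    (\<exists>k j. j < length f \<and> wt k (eval f x) \<and> int g dvd k - h * int j \<and> terms_ge x k f)"
    using Cons by simp
  show ?case
  proof (cases "d = \<zero>")
    case True
    then have "eval (d # f) x = eval f x" using xc fc by simp
    then show ?thesis using IH True less_SucI by (simp, blast)
  next
    case False
    then obtain k0 where k0: "int g dvd k0" "wt k0 d" using Ew Cons.prems by auto
    define k1 where "k1 = k0 + h * int (length f)"
    have t: "wt k1 (d \<otimes> x [^] length f)"
      unfolding k1_def by (rule wt_mult[OF k0(2) wt_pow[OF x]])
    have g1: "int g dvd k1 - h * int (length f)" using k0 by (simp add: k1_def)
    have ev: "eval (d # f) x = d \<otimes> x [^] length f \<oplus> eval f x" by simp
    show ?thesis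
    proof (cases "\<forall>d\<in>set f. d = \<zero>")
      case True
      then have "eval (d # f) x = d \<otimes> x [^] length f"
        unfolding ev using eval_zeros[OF True xc] wt_carrier[OF t] by simp
      then show ?thesis using t g1 terms_ge_zeros[OF True] 
        by (intro disjI2 exI[of _ k1] exI[of _ "length f"]) auto
    next
      case nz: False
      then obtain k j where kj: "j < length f" "wt k (eval f x)" "int g dvd k - h * int j" "terms_ge x k f"
        using IH by auto
      \<comment> \<open>Modulo g the two weights k and k1 are h j and h times
        \<open>length f\<close>; \<open>dist\<close> separates these classes, which excludes k =
        k1.\<close>
      have "\<not> int g dvd h * (int (length f) - int j)" using dist[of j "length f"] kj(1) Cons.prems by simp
      moreover have "(k - h * int j) - (k1 - h * int (length f)) = (k - k1) + h * (int (length f) - int j)"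
        by (simp add: algebra_simps)
      ultimately have "k \<noteq> k1" using dvd_diff[OF kj(3) g1] by auto
      then consider "k < k1" | "k1 < k" by linarith
      then show ?thesis
      proof cases
        case 1
        have "wt k (eval (d # f) x)"
          unfolding ev using wt_add[OF kj(2) t 1] fc wt_carrier[OF t] by (simp add: add.m_comm)
        moreover have "terms_ge x k (d # f)" using kj(4) t 1 by auto
        ultimately show ?thesis using kj
          by (intro disjI2 exI[of _ k] exI[of _ j]) (auto simp del: eval.simps)
      next
        case 2
        have "wt k1 (eval (d # f) x)"
          unfolding ev using wt_add[OF t kj(2) 2] .
        moreover have "terms_ge x k1 (d # f)" using terms_ge_mono[OF kj(4), of k1] t 2 by auto
        ultimately show ?thesis using g1
          by (intro disjI2 exI[of _ k1] exI[of _ "length f"]) (auto simp del: eval.simps)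
      qed
    qed
  qed
qed auto

text \<open>Zero has no weight, so only the other alternative remains: 1, x, ..., x^(N-1) are
  linearly independent over E.\<close>

lemma eval_weight_zero:
  assumes E: "E \<subseteq> carrier R" and Ew: "\<And>d. d \<in> E \<Longrightarrow> d \<noteq> \<zero> \<Longrightarrow> \<exists>k. int g dvd k \<and> wt k d"
    and x: "wt h x" and dist: "\<And>j j'. j < j' \<Longrightarrow> j' < N \<Longrightarrow> \<not> int g dvd h * (int j' - int j)"
    and f: "set f \<subseteq> E" "length f \<le> N" and zero: "eval f x = \<zero>"
  shows "\<forall>d\<in>set f. d = \<zero>"
  using eval_weight[OF E Ew x dist f] zero wt_carrier(3) by auto

text \<open>Reduction modulo b shortens every polynomial in x to length at most N, and a nonzero
  value then has the weight of one of its terms. Together with independence this makes N the degree,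
  without b being assumed irreducible.\<close>

lemma simple_extension_weights:
  assumes E: "subfield E R" and Ew: "\<And>d. d \<in> E \<Longrightarrow> d \<noteq> \<zero> \<Longrightarrow> \<exists>k. int g dvd k \<and> wt k d"
    and x: "wt h x" and dist: "\<And>j j'. j < j' \<Longrightarrow> j' < N \<Longrightarrow> \<not> int g dvd h * (int j' - int j)"
    and b: "b \<in> carrier (E[X])" "length b = Suc N" "eval b x = \<zero>"
  shows "subfield (simple_extension E x) R"
    and "y \<in> simple_extension E x \<Longrightarrow> \<exists>f\<in>carrier (E[X]). length f \<le> N \<and> y = eval f x"
    and "y \<in> simple_extension E x \<Longrightarrow> y \<noteq> \<zero> \<Longrightarrow> \<exists>k j. j < N \<and> wt k y \<and> int g dvd k - h * int j"
proof -
  have xc: "x \<in> carrier R" using wt_carrier[OF x] by simp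
  have Ec: "E \<subseteq> carrier R" using subfieldE(3)[OF E] .
  have b0: "b \<noteq> []" using b by auto
  have "(algebraic over E) x" by (rule algebraicI[OF b(1) b0 b(3)])
  then show "subfield (simple_extension E x) R" using simple_extension_is_subfield[OF E xc] by simp
  show ex: "\<exists>f\<in>carrier (E[X]). length f \<le> N \<and> y = eval f x" if y: "y \<in> simple_extension E x" for y
  proof -
    obtain f where f: "f \<in> carrier (E[X])" "y = eval f x"
      using y simple_extension_as_eval_img[OF Ec xc] by auto
    obtain q r where qr: "q \<in> carrier (E[X])" "r \<in> carrier (E[X])" "length r < length b"
      "eval f x = eval b x \<otimes> eval q x \<oplus> eval r x"
      using long_division_eval[OF E f(1) b(1) b0] xc by blast
    have c: "set r \<subseteq> carrier R" "set q \<subseteq> carrier R"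
      using univ_poly_coeffs[OF qr(1)] univ_poly_coeffs[OF qr(2)] Ec by auto
    have "eval f x = eval r x"
      using qr(4) b(3) eval_in_carrier[OF c(1) xc] eval_in_carrier[OF c(2) xc] by simp
    then show ?thesis using qr(2,3) b(2) f(2) by (intro bexI[of _ r]) auto
  qed
  show "\<exists>k j. j < N \<and> wt k y \<and> int g dvd k - h * int j" 
    if y: "y \<in> simple_extension E x" "y \<noteq> \<zero>" for y
  proof -
    obtain f where f: "f \<in> carrier (E[X])" "length f \<le> N" "y = eval f x" using ex[OF y(1)] by auto
    from eval_weight[OF Ec Ew x dist univ_poly_coeffs[OF f(1)] f(2)] show ?thesis
      using f y(2) eval_zeros[OF _ xc, of f] by (metis order.strict_trans2)
  qed
qed

end

section \<open>Radical extensions of prime degree\<close>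

context domain
begin

definition X_pow_minus :: "nat \<Rightarrow> 'a \<Rightarrow> 'a list" where
  "X_pow_minus m c = \<one> # replicate (m - 1) \<zero> @ [\<ominus> c]"

lemma X_pow_minus:
  assumes E: "subring E R" and c: "c \<in> E" and m: "m > 0"
  shows "X_pow_minus m c \<in> carrier (E[X])" "length (X_pow_minus m c) = Suc m"
    "z \<in> carrier R \<Longrightarrow> eval (X_pow_minus m c) z = z [^] m \<ominus> c"
proof -
  note EE = subringE[OF E]
  have set: "set (X_pow_minus m c) \<subseteq> E"
    using EE c by (auto simp: X_pow_minus_def)
  show "X_pow_minus m c \<in> carrier (E[X])"
    using set unfolding univ_poly_carrier[symmetric] polynomial_def by (simp add: X_pow_minus_def)
  show "length (X_pow_minus m c) = Suc m" using m by (simp add: X_pow_minus_def)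
  show "eval (X_pow_minus m c) z = z [^] m \<ominus> c" if z: "z \<in> carrier R"
  proof -
    have cc: "c \<in> carrier R" using EE(1) c by auto
    have "eval (replicate (m - 1) \<zero> @ [\<ominus> c]) z = eval [\<ominus> c] z"
      by (rule eval_replicate) (use cc z in auto)
    then show ?thesis using m cc z by (simp add: X_pow_minus_def a_minus_def)
  qed
qed

end

lemma (in domain) nat_pow_nonzero: "y \<in> carrier R \<Longrightarrow> y \<noteq> \<zero> \<Longrightarrow> y [^] (k::nat) \<noteq> \<zero>"
  by (induction k) (auto simp: integral_iff)

text \<open>Otherwise u and the m distinct powers of \<zeta> would be m + 1 roots of X^m -
  1.\<close>

lemma (in field) roots_of_unity_powers:
  assumes zeta: "primitive_root_of_unity R m \<zeta>" and m: "m > 0"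
    and u: "u \<in> carrier R" "u [^] m = \<one>"
  shows "\<exists>c<m. u = \<zeta> [^] c"
proof (rule ccontr)
  assume nu: "\<not> (\<exists>c<m. u = \<zeta> [^] c)"
  have z: "\<zeta> \<in> carrier R" "\<zeta> [^] m = \<one>" "\<And>k. 0 < k \<Longrightarrow> k < m \<Longrightarrow> \<zeta> [^] k \<noteq> \<one>"
    using zeta by (auto simp: primitive_root_of_unity_def)
  have z0: "\<zeta> \<noteq> \<zero>" using z(2) m by (auto simp: nat_pow_zero)
  have lt: "\<zeta> [^] c \<noteq> \<zeta> [^] d" if cd: "c < d" "d < m" for c d
  proof
    assume eq: "\<zeta> [^] c = \<zeta> [^] d"
    have nz: "\<zeta> [^] c \<noteq> \<zero>" using nat_pow_nonzero[OF z(1) z0] .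
    have "\<zeta> [^] c \<otimes> \<zeta> [^] (d - c) = \<zeta> [^] d"
      using z(1) cd by (simp add: nat_pow_mult)
    then have "\<zeta> [^] c \<otimes> \<zeta> [^] (d - c) = \<zeta> [^] c \<otimes> \<one>"
      using eq z(1) by simp
    then have "\<zeta> [^] (d - c) = \<one>" 
      using m_lcancel[OF nz _ nat_pow_closed[OF z(1)] one_closed] z(1) by blast
    then show False using z(3)[of "d - c"] cd by simp
  qed
  have inj: "inj_on (\<lambda>c. \<zeta> [^] c) {..<m}"
  proof (rule inj_onI)
    fix c d assume cd: "c \<in> {..<m}" "d \<in> {..<m}" "\<zeta> [^] c = \<zeta> [^] d"
    then show "c = d" using lt[of c d] lt[of d c] by (metis lessThan_iff nat_neq_iff)
  qed
  define f where "f = X_pow_minus m \<one>"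
  have f: "f \<in> carrier (poly_ring R)" "length f = Suc m"
    "\<And>y. y \<in> carrier R \<Longrightarrow> eval f y = y [^] m \<ominus> \<one>"
    using X_pow_minus[OF carrier_is_subring one_closed m] by (auto simp: f_def)
  have root: "y \<in># roots f" if y: "y \<in> carrier R" "y [^] m = \<one>" for y
  proof -
    have "f \<noteq> []" "eval f y = \<zero>" using f y by (auto simp: a_minus_def r_neg)
    then show ?thesis using roots_mem_iff_is_root[OF f(1)] y(1) by (simp add: is_root_def)
  qed
  have "\<zeta> [^] c \<in># roots f" for c :: nat
  proof (rule root)
    have "(\<zeta> [^] c) [^] m = (\<zeta> [^] m) [^] c" using z(1) by (simp add: nat_pow_pow mult.commute)
    then show "(\<zeta> [^] c) [^] m = \<one>" using z(2) by simp
  qed (use z(1) in simp)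
  then have "insert u ((\<lambda>c. \<zeta> [^] c) ` {..<m}) \<subseteq> set_mset (roots f)"
    using root[OF u] by auto
  then have "card (insert u ((\<lambda>c. \<zeta> [^] c) ` {..<m})) \<le> card (set_mset (roots f))"
    by (intro card_mono) auto
  also have "\<dots> \<le> size (roots f)"
  proof -
    have "card (set_mset M) \<le> size M" for M :: "'a multiset"
      by (induction M) (auto simp: card_insert_if)
    then show ?thesis .
  qed
  also have "\<dots> \<le> m" using size_roots_le_degree[OF f(1)] f(2) by simp
  finally have "card (insert u ((\<lambda>c. \<zeta> [^] c) ` {..<m})) \<le> m" .
  moreover have "u \<notin> (\<lambda>c. \<zeta> [^] c) ` {..<m}" using nu by blast
  ultimately show False using card_image[OF inj] by simp
qed

text \<open>One Kummer layer in isolation, with base E and generator x. The number e is going to be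
  the break. The element \<open>d\<^sub>0 \<otimes> x [^] k\<^sub>0\<close> is a uniformizer in
  monomial form: an automorphism multiplies it by a root of unity, which differs from 1 for a
  nontrivial automorphism because p does not divide \<open>k\<^sub>0\<close>.\<close>

locale kummer_step = weights +
  fixes E :: "'a set" and p :: nat and \<zeta> x :: 'a and h e :: int and d\<^sub>0 :: 'a and k\<^sub>0 :: nat
  assumes E: "subfield E R" and p: "Factorial_Ring.prime p"
    and zeta: "primitive_root_of_unity R p \<zeta>" and zeta_E: "\<zeta> \<in> E"
    and x_pow: "x [^] p \<in> E"
    and E_wt: "\<And>d. d \<in> E \<Longrightarrow> d \<noteq> \<zero> \<Longrightarrow> \<exists>k. int p dvd k \<and> wt k d"
    and x_wt: "wt h x" and h: "\<not> int p dvd h"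
    and zeta_wt: "wt e (\<zeta> \<ominus> \<one>)" and e_pos: "e > 0"
    and d\<^sub>0: "d\<^sub>0 \<in> E" "wt 1 (d\<^sub>0 \<otimes> x [^] k\<^sub>0)" and k\<^sub>0: "\<not> p dvd k\<^sub>0"
begin

definition L where "L = simple_extension E x"

lemma E_sub: "subring E R" and E_carrier: "E \<subseteq> carrier R"
  using subfieldE[OF E] by auto

lemma p_pos: "p > 0" using p prime_gt_0_nat by simp

lemma x_carrier: "x \<in> carrier R" "x \<noteq> \<zero>" using wt_carrier[OF x_wt] by auto

lemma zeta_carrier: "\<zeta> \<in> carrier R" and zeta_pow: "\<zeta> [^] p = \<one>"
  using zeta by (auto simp: primitive_root_of_unity_def)

lemma zeta_nonzero: "\<zeta> \<noteq> \<zero>"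
  using zeta_pow p_pos by (auto simp: nat_pow_zero)

lemma zeta_pow_mod: "\<zeta> [^] (c mod p) = \<zeta> [^] c"
proof -
  have "\<zeta> [^] c = \<zeta> [^] (p * (c div p) + c mod p)" by simp
  also have "\<dots> = (\<zeta> [^] p) [^] (c div p) \<otimes> \<zeta> [^] (c mod p)"
    using zeta_carrier by (simp add: nat_pow_mult nat_pow_pow)
  finally show ?thesis using zeta_pow zeta_carrier by simp
qed

lemma zeta_U: "\<zeta> \<in> U"
proof -
  have B: "\<zeta> \<in> B" using B_root[OF zeta_carrier, of p] zeta_pow p_pos BE(3) by simp
  have "\<zeta> [^] (p - 1) \<otimes> \<zeta> = \<one>"
    using zeta_pow p_pos zeta_carrier by (metis Suc_pred' nat_pow_Suc)
  then have "inv \<zeta> = \<zeta> [^] (p - 1)"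
    using zeta_carrier inv_char[of "\<zeta>" "\<zeta> [^] (p - 1)"] m_comm[of \<zeta> "\<zeta> [^] (p - 1)"] by simp
  then show ?thesis
    using B subring_pow[OF B_subring B] zeta_carrier zeta_nonzero by (simp add: U_def)
qed

lemma distinct_terms: "j < j' \<Longrightarrow> j' < p \<Longrightarrow> \<not> int p dvd h * (int j' - int j)"
proof
  assume j: "j < j'" "j' < p" and "int p dvd h * (int j' - int j)"
  then have "int p dvd int j' - int j"
    using h p prime_dvd_mult_iff[of "int p" h "int j' - int j"] by simp
  then have "int p \<le> int j' - int j" using j zdvd_imp_le by simp
  then show False using j by simp
qed

lemmas X_p = X_pow_minus[OF E_sub x_pow p_pos]

lemma X_p_root: "z \<in> carrier R \<Longrightarrow> z [^] p = x [^] p \<Longrightarrow> eval (X_pow_minus p (x [^] p)) z = \<zero>"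
  using X_p(3) x_carrier by (simp add: a_minus_def r_neg)

lemmas L_ext = simple_extension_weights[OF E E_wt x_wt distinct_terms X_p(1,2) X_p_root[OF x_carrier(1) refl],
  folded L_def]

lemma L_field: "subfield L R" by (rule L_ext(1))

lemmas L_sub = subfieldE(1)[OF L_field]
lemmas LE = subringE[OF L_sub]

lemma L_eval: "y \<in> L \<Longrightarrow> \<exists>f\<in>carrier (E[X]). length f \<le> p \<and> y = eval f x"
  by (rule L_ext(2))

lemma eval_L: "f \<in> carrier (E[X]) \<Longrightarrow> eval f x \<in> L"
  unfolding L_def simple_extension_as_eval_img[OF E_carrier x_carrier(1)] by blast

lemma L_wt: "y \<in> L \<Longrightarrow> y \<noteq> \<zero> \<Longrightarrow> \<exists>k. wt k y"
  using L_ext(3) by blast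

lemma E_L: "E \<subseteq> L" and x_L: "x \<in> L"
  using simple_extension_incl[OF E_carrier x_carrier(1)] simple_extension_mem[OF E_sub x_carrier(1)]
  by (auto simp: L_def)

section \<open>Conjugates of the generator and the maps they define\<close>

definition conj :: "nat \<Rightarrow> 'a" where "conj c = \<zeta> [^] c \<otimes> x"

lemma conj_carrier: "conj c \<in> carrier R"
  using zeta_carrier x_carrier by (simp add: conj_def)

lemma conj_L: "conj c \<in> L"
  using LE(6) subring_pow[OF L_sub, of \<zeta>] E_L zeta_E x_L unfolding conj_def by blast

lemma conj_pow: "conj c [^] p = x [^] p"
proof -
  have "conj c [^] p = (\<zeta> [^] p) [^] c \<otimes> x [^] p"
    using zeta_carrier x_carrier by (simp add: conj_def nat_pow_distrib nat_pow_pow mult.commute)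
  then show ?thesis using zeta_pow x_carrier by simp
qed

lemma conj_wt: "wt h (conj c)"
  using wt_mult[OF wt_U[OF U_pow[OF zeta_U]] x_wt] by (simp add: conj_def)

lemma conj_all: 
  assumes z: "z \<in> carrier R" "z [^] p = x [^] p"
  shows "\<exists>c<p. z = conj c"
proof -
  note ix = inv_carrier[OF x_carrier]
  have "(z \<otimes> inv x) [^] p = x [^] p \<otimes> inv x [^] p"
    using z ix by (simp add: nat_pow_distrib)
  also have "\<dots> = (x \<otimes> inv x) [^] p"
    by (rule nat_pow_distrib[OF x_carrier(1) ix(1), symmetric])
  finally have "(z \<otimes> inv x) [^] p = \<one>" using ix by simp
  then obtain c where c: "c < p" "z \<otimes> inv x = \<zeta> [^] c"
    using roots_of_unity_powers[OF zeta p_pos, of "z \<otimes> inv x"] z ix by auto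
  have "z = (z \<otimes> inv x) \<otimes> x" using z ix x_carrier by (simp add: m_assoc)
  then show ?thesis using c by (auto simp: conj_def)
qed

text \<open>All conjugates of \<open>x\<close> have the weight of \<open>x\<close>, so none of them is a root of a nonzero
  polynomial of degree less than \<open>p\<close>.\<close>

lemma eval_zero_transfer:
  assumes f: "f \<in> carrier (E[X])" and zero: "eval f (conj c) = \<zero>"
  shows "eval f (conj d) = \<zero>"
proof -
  have b0: "X_pow_minus p (x [^] p) \<noteq> []" using X_p(2) by auto
  obtain q r where qr: "q \<in> carrier (E[X])" "r \<in> carrier (E[X])" 
    "length r < length (X_pow_minus p (x [^] p))"
    "\<And>z. z \<in> carrier R \<Longrightarrow> eval f z = eval (X_pow_minus p (x [^] p)) z \<otimes> eval q z \<oplus> eval r z"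
    using long_division_eval[OF E f X_p(1) b0] by blast
  have c: "set r \<subseteq> carrier R" "set q \<subseteq> carrier R"
    using univ_poly_coeffs[OF qr(1)] univ_poly_coeffs[OF qr(2)] E_carrier by auto
  have ev: "eval f (conj c') = eval r (conj c')" for c'
    using qr(4)[OF conj_carrier] X_p_root[OF conj_carrier conj_pow]
      eval_in_carrier[OF c(1) conj_carrier] eval_in_carrier[OF c(2) conj_carrier] by simp
  have len: "length r \<le> p" using qr(3) X_p(2) by simp
  have "\<forall>d\<in>set r. d = \<zero>"
    using eval_weight_zero[OF E_carrier E_wt conj_wt distinct_terms univ_poly_coeffs[OF qr(2)] len]
      ev[of c] zero by simp
  then show ?thesis using ev[of d] eval_zeros[OF _ conj_carrier] by simp
qed

lemma conj_0: "conj 0 = x" using x_carrier by (simp add: conj_def)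

text \<open>The choice of f is harmless by \<open>eval_zero_transfer\<close>: two polynomials with
  the same value at x agree at every conjugate. The restriction to L makes the map extensional, as
  \<open>Gal_group\<close> demands.\<close>

definition sig :: "nat \<Rightarrow> 'a \<Rightarrow> 'a" where
  "sig c = (\<lambda>y\<in>L. eval (SOME f. f \<in> carrier (E[X]) \<and> eval f x = y) (conj c))"

lemma sig_eval:
  assumes f: "f \<in> carrier (E[X])"
  shows "sig c (eval f x) = eval f (conj c)"
proof -
  define g where "g = (SOME g. g \<in> carrier (E[X]) \<and> eval g x = eval f x)"
  have g: "g \<in> carrier (E[X])" "eval g x = eval f x"
    using someI[of "\<lambda>g. g \<in> carrier (E[X]) \<and> eval g x = eval f x" f] f by (auto simp: g_def)
  interpret UP: domain "E[X]" by (rule univ_poly_is_domain[OF E_sub])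
  have diff: "eval (g \<oplus>\<^bsub>E[X]\<^esub> \<ominus>\<^bsub>E[X]\<^esub> f) z = eval g z \<oplus> \<ominus> eval f z" 
    and c: "eval g z \<in> carrier R" "eval f z \<in> carrier R" if z: "z \<in> carrier R" for z
  proof -
    interpret h: ring_hom_cring "E[X]" R "\<lambda>p. eval p z" by (rule eval_cring_hom[OF E_sub z])
    show "eval (g \<oplus>\<^bsub>E[X]\<^esub> \<ominus>\<^bsub>E[X]\<^esub> f) z = eval g z \<oplus> \<ominus> eval f z" 
      using f g by simp
    show "eval g z \<in> carrier R" "eval f z \<in> carrier R" using f g by auto
  qed
  have "eval (g \<oplus>\<^bsub>E[X]\<^esub> \<ominus>\<^bsub>E[X]\<^esub> f) (conj 0) = \<zero>"
    using diff[OF x_carrier(1)] c[OF x_carrier(1)] g by (simp add: conj_0 r_neg)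
  then have "eval (g \<oplus>\<^bsub>E[X]\<^esub> \<ominus>\<^bsub>E[X]\<^esub> f) (conj c) = \<zero>"
    by (rule eval_zero_transfer[rotated]) (use f g in auto)
  then have "eval g (conj c) = eval f (conj c)"
    using diff[OF conj_carrier] c[OF conj_carrier] minus_equality by (metis minus_minus a_inv_closed r_neg)
  then show ?thesis using eval_L[OF f] by (simp add: sig_def g_def[symmetric])
qed

lemma eval_conj_L: "f \<in> carrier (E[X]) \<Longrightarrow> eval f (conj c) \<in> L"
  using simple_extension_subring_incl[OF L_sub E_L conj_L, of c]
    simple_extension_as_eval_img[OF E_carrier conj_carrier] by blast

lemma sig_L: "y \<in> L \<Longrightarrow> sig c y \<in> L"
  using L_eval[of y] sig_eval eval_conj_L by auto

lemma sig_add: "y \<in> L \<Longrightarrow> z \<in> L \<Longrightarrow> sig c (y \<oplus> z) = sig c y \<oplus> sig c z"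
  and sig_mult: "y \<in> L \<Longrightarrow> z \<in> L \<Longrightarrow> sig c (y \<otimes> z) = sig c y \<otimes> sig c z"
proof -
  assume "y \<in> L" "z \<in> L"
  then obtain f g where fg: "f \<in> carrier (E[X])" "y = eval f x" "g \<in> carrier (E[X])" "z = eval g x"
    using L_eval by blast
  interpret UP: domain "E[X]" by (rule univ_poly_is_domain[OF E_sub])
  interpret h: ring_hom_cring "E[X]" R "\<lambda>p. eval p x" by (rule eval_cring_hom[OF E_sub x_carrier(1)])
  interpret h': ring_hom_cring "E[X]" R "\<lambda>p. eval p (conj c)" by (rule eval_cring_hom[OF E_sub conj_carrier])
  show "sig c (y \<oplus> z) = sig c y \<oplus> sig c z" "sig c (y \<otimes> z) = sig c y \<otimes> sig c z"
    using fg sig_eval[OF UP.a_closed[OF fg(1,3)], of c] sig_eval[OF UP.m_closed[OF fg(1,3)], of c]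
    by (auto simp: sig_eval)
qed

lemma sig_E: 
  assumes "d \<in> E" shows "sig c d = d"
proof (cases "d = \<zero>")
  case True
  have "[] \<in> carrier (E[X])" by (simp flip: univ_poly_carrier add: polynomial_def)
  then show ?thesis using sig_eval[of "[]" c] True by simp
next
  case False
  then have "[d] \<in> carrier (E[X])" using assms by (simp flip: univ_poly_carrier add: polynomial_def)
  moreover have "d \<in> carrier R" using assms E_carrier by auto
  ultimately show ?thesis using sig_eval[of "[d]" c] by simp
qed

lemma sig_x: "sig c x = conj c"
proof -
  have "[\<one>, \<zero>] \<in> carrier (E[X])"
    using subringE(2,3)[OF E_sub] by (simp flip: univ_poly_carrier add: polynomial_def)
  then show ?thesis using sig_eval[of "[\<one>, \<zero>]" c] x_carrier conj_carrier by simp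
qed

lemma sig_bij: "bij_betw (sig c) L L"
proof -
  have inj: "inj_on (sig c) L"
  proof (rule inj_onI)
    fix y z assume yz: "y \<in> L" "z \<in> L" "sig c y = sig c z"
    then have m: "\<ominus> z \<in> L" "y \<oplus> \<ominus> z \<in> L" using LE by auto
    have c: "y \<in> carrier R" "z \<in> carrier R" "sig c z \<in> carrier R" "sig c (\<ominus> z) \<in> carrier R"
      using LE(1) yz m sig_L by auto
    have "sig c (z \<oplus> \<ominus> z) = \<zero>" using sig_E[of \<zero> c] subringE(2)[OF E_sub] c by (simp add: r_neg)
    then have 0: "sig c (y \<oplus> \<ominus> z) = \<zero>"
      using sig_add[OF yz(1) m(1), of c] sig_add[OF yz(2) m(1), of c] yz(3) by simp
    obtain f where f: "f \<in> carrier (E[X])" "y \<oplus> \<ominus> z = eval f x" using L_eval[OF m(2)] by auto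
    have "eval f (conj c) = \<zero>" using 0 f sig_eval by simp
    \<comment> \<open>The transfer also runs backwards, from the conjugate to x itself, which is
      \<open>conj 0\<close>.\<close>
    then have "eval f (conj 0) = \<zero>" by (rule eval_zero_transfer[OF f(1)])
    then have "y \<oplus> \<ominus> z = \<zero>" using f conj_0 by simp
    then show "y = z" using c minus_equality[of y "\<ominus> z"] by simp
  qed
  have "L \<subseteq> sig c ` L"
  proof -
    define S where "S = simple_extension E (conj c)"
    have S: "subring S R" unfolding S_def by (rule simple_extension_is_subring[OF E_sub conj_carrier])
    have ES: "E \<subseteq> S" "conj c \<in> S"
      using simple_extension_incl[OF E_carrier conj_carrier] simple_extension_mem[OF E_sub conj_carrier]
      by (auto simp: S_def)
    \<comment> \<open>The exponent c (p - 1) is -c modulo p: a natural power of \<zeta> undoes the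
      factor in \<open>conj c\<close>, so x is recovered inside E(\<open>conj c\<close>).\<close>
    have "\<zeta> [^] (c * (p - 1)) \<otimes> conj c = (\<zeta> [^] p) [^] c \<otimes> x"
    proof -
      have "\<zeta> [^] (c * (p - 1)) \<otimes> conj c = \<zeta> [^] (c * (p - 1) + c) \<otimes> x"
        using zeta_carrier x_carrier by (simp add: conj_def nat_pow_mult[symmetric] m_assoc)
      moreover have "c * (p - 1) + c = p * c" using p_pos by (cases p) (auto simp: algebra_simps)
      ultimately show ?thesis using zeta_carrier by (simp add: nat_pow_pow)
    qed
    then have "x = \<zeta> [^] (c * (p - 1)) \<otimes> conj c" using zeta_pow x_carrier by simp
    moreover have "\<zeta> [^] (c * (p - 1)) \<in> S" using subring_pow[OF S] ES zeta_E by blast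
    ultimately have "x \<in> S" using subringE(6)[OF S] ES by metis
    then have "L \<subseteq> S" unfolding L_def by (rule simple_extension_subring_incl[OF S ES(1)])
    moreover have "S \<subseteq> sig c ` L"
    proof
      fix y assume "y \<in> S"
      then obtain f where f: "f \<in> carrier (E[X])" "y = eval f (conj c)"
        using simple_extension_as_eval_img[OF E_carrier conj_carrier] by (auto simp: S_def)
      then show "y \<in> sig c ` L" using sig_eval[OF f(1), of c] eval_L[OF f(1)] f(2) by (metis image_eqI)
    qed
    ultimately show ?thesis by blast
  qed
  then show ?thesis using inj sig_L by (auto simp: bij_betw_def)
qed

section \<open>The Galois group of L over E\<close>

abbreviation Gal where "Gal \<equiv> Gal_group R L E"

lemma Gal_carrier_iff: "\<tau> \<in> carrier Gal \<longleftrightarrow> \<tau> \<in> Bij L \<and> \<tau> \<in> ring_hom (R\<lparr>carrier := L\<rparr>) (R\<lparr>carrier := L\<rparr>) \<and> (\<forall>y\<in>E. \<tau> y = y)"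
  by (simp add: Gal_group_def)

lemma sig_Gal: "sig c \<in> carrier Gal"
proof -
  have "sig c \<in> extensional L" by (simp add: sig_def)
  moreover have "sig c \<in> ring_hom (R\<lparr>carrier := L\<rparr>) (R\<lparr>carrier := L\<rparr>)"
    using sig_L sig_add sig_mult sig_E subringE(3)[OF E_sub] by (intro ring_hom_memI) auto
  ultimately show ?thesis using sig_bij sig_E by (simp add: Gal_carrier_iff Bij_def)
qed

lemma Gal_hom:
  assumes "\<tau> \<in> carrier Gal"
  shows "y \<in> L \<Longrightarrow> \<tau> y \<in> L" "y \<in> L \<Longrightarrow> z \<in> L \<Longrightarrow> \<tau> (y \<otimes> z) = \<tau> y \<otimes> \<tau> z"
    "y \<in> L \<Longrightarrow> z \<in> L \<Longrightarrow> \<tau> (y \<oplus> z) = \<tau> y \<oplus> \<tau> z" "y \<in> E \<Longrightarrow> \<tau> y = y"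
  using assms by (auto simp: Gal_carrier_iff ring_hom_def)

lemma Gal_pow:
  assumes s: "\<tau> \<in> carrier Gal" and y: "y \<in> L"
  shows "\<tau> (y [^] (m::nat)) = \<tau> y [^] m"
  using Gal_hom(4)[OF s, of \<one>] subringE(3)[OF E_sub] Gal_hom(2)[OF s subring_pow[OF L_sub y] y]
  by (induction m) auto

lemma Gal_eval:
  assumes s: "\<tau> \<in> carrier Gal" and f: "set f \<subseteq> E"
  shows "eval f x \<in> L \<and> \<tau> (eval f x) = eval f (\<tau> x)"
  using f
proof (induction f)
  case Nil
  then show ?case using Gal_hom(4)[OF s, of \<zero>] subringE(2)[OF E_sub] LE by auto
next
  case (Cons d f)
  then have d: "d \<in> E" "d \<in> L" using E_L by auto
  have t: "d \<otimes> x [^] length f \<in> L" using LE(6) d subring_pow[OF L_sub x_L] by simp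
  have "\<tau> (d \<otimes> x [^] length f) = d \<otimes> \<tau> x [^] length f"
    using Gal_hom(2)[OF s d(2) subring_pow[OF L_sub x_L]] Gal_pow[OF s x_L] Gal_hom(4)[OF s d(1)] by simp
  then show ?case using Cons Gal_hom(3)[OF s t] LE(7)[OF t] by simp
qed

text \<open>The image of x is again a root of X^p - x^p, hence a conjugate of x, and it determines
  the automorphism.\<close>

lemma Gal_eq_sig:
  assumes s: "\<tau> \<in> carrier Gal"
  shows "\<exists>c<p. \<tau> = sig c"
proof -
  have "\<tau> x \<in> carrier R" using Gal_hom(1)[OF s x_L] LE(1) by auto
  moreover have "\<tau> x [^] p = x [^] p" using Gal_pow[OF s x_L, of p] Gal_hom(4)[OF s x_pow] by simp
  ultimately obtain c where c: "c < p" "\<tau> x = conj c" using conj_all by blast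
  have "\<tau> = sig c"
  proof (rule extensionalityI)
    show "\<tau> \<in> extensional L" using s by (simp add: Gal_carrier_iff Bij_def)
    show "sig c \<in> extensional L" by (simp add: sig_def)
    fix y assume "y \<in> L"
    then obtain f where f: "f \<in> carrier (E[X])" "y = eval f x" using L_eval by blast
    then show "\<tau> y = sig c y"
      using Gal_eval[OF s univ_poly_coeffs[OF f(1)]] sig_eval[OF f(1)] c by simp
  qed
  then show ?thesis using c by blast
qed

lemma group_Gal: "group Gal"
proof -
  have "subgroup (carrier Gal) (BijGroup L)"
  proof (rule group.subgroupI[OF group_BijGroup])
    show "carrier Gal \<subseteq> carrier (BijGroup L)" by (auto simp: Gal_carrier_iff BijGroup_def)
    show "carrier Gal \<noteq> {}" using sig_Gal by blast
    fix s assume s: "s \<in> carrier Gal"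
    then have sB: "s \<in> Bij L" by (simp add: Gal_carrier_iff)
    show "inv\<^bsub>BijGroup L\<^esub> s \<in> carrier Gal"
    proof -
      define t where "t = (\<lambda>y\<in>L. inv_into L s y)"
      have tB: "t \<in> Bij L" unfolding t_def by (rule restrict_inv_into_Bij[OF sB])
      have im: "s ` L = L" and inj: "inj_on s L" using sB by (auto simp: Bij_def bij_betw_def)
      have t_L: "y \<in> L \<Longrightarrow> t y \<in> L" and st: "y \<in> L \<Longrightarrow> s (t y) = y" for y
        using im inv_into_into[of y s L] f_inv_into_f[of y s L] by (simp_all add: t_def)
      have ts: "t y = z" if "z \<in> L" "s z = y" for y z
        using inv_into_f_f[OF inj that(1)] Gal_hom(1)[OF s that(1)] that(2) by (simp add: t_def)
      have t_mult: "t (y \<otimes> z) = t y \<otimes> t z" and t_add: "t (y \<oplus> z) = t y \<oplus> t z"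
        if yz: "y \<in> L" "z \<in> L" for y z
      proof -
        note yz' = t_L[OF yz(1)] t_L[OF yz(2)]
        show "t (y \<otimes> z) = t y \<otimes> t z"
          by (rule ts[OF LE(6)[OF yz']]) (simp only: Gal_hom(2)[OF s yz'] st yz)
        show "t (y \<oplus> z) = t y \<oplus> t z"
          by (rule ts[OF LE(7)[OF yz']]) (simp only: Gal_hom(3)[OF s yz'] st yz)
      qed
      have t_E: "t y = y" if "y \<in> E" for y
        using ts[of y y] that E_L Gal_hom(4)[OF s] by blast
      have "t \<in> ring_hom (R\<lparr>carrier := L\<rparr>) (R\<lparr>carrier := L\<rparr>)"
        using t_L t_mult t_add t_E[OF subringE(3)[OF E_sub]] by (intro ring_hom_memI) simp_all
      then show ?thesis using tB t_E unfolding inv_BijGroup[OF sB] Gal_carrier_iff t_def[symmetric] by blast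
    qed
    fix t assume t: "t \<in> carrier Gal"
    then have tB: "t \<in> Bij L" by (simp add: Gal_carrier_iff)
    have "compose L s t \<in> ring_hom (R\<lparr>carrier := L\<rparr>) (R\<lparr>carrier := L\<rparr>)"
      using Gal_hom(1-3)[OF s] Gal_hom(1-3)[OF t] Gal_hom(4)[OF s subringE(3)[OF E_sub]]
        Gal_hom(4)[OF t subringE(3)[OF E_sub]] LE(3,6,7)
      by (intro ring_hom_memI) (simp_all add: compose_def)
    then show "s \<otimes>\<^bsub>BijGroup L\<^esub> t \<in> carrier Gal"
      using sB tB compose_Bij[OF sB tB] Gal_hom(4)[OF s] Gal_hom(4)[OF t] subsetD[OF E_L]
      unfolding Gal_carrier_iff by (simp add: BijGroup_def compose_def[of L s t])
  qed
  from group.subgroup_imp_group[OF group_BijGroup this] show ?thesis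
    by (simp add: Gal_group_def)
qed

lemma Gal_mult: "s \<in> carrier Gal \<Longrightarrow> t \<in> carrier Gal \<Longrightarrow> s \<otimes>\<^bsub>Gal\<^esub> t = compose L s t"
  by (simp add: Gal_group_def BijGroup_def)

lemma sig_eqI:
  assumes s: "s \<in> carrier Gal" and "s x = conj c"
  shows "s = sig c"
proof (rule extensionalityI)
  show "s \<in> extensional L" using s by (simp add: Gal_carrier_iff Bij_def)
  show "sig c \<in> extensional L" by (simp add: sig_def)
  fix y assume "y \<in> L"
  then obtain f where f: "f \<in> carrier (E[X])" "y = eval f x" using L_eval by blast
  then show "s y = sig c y"
    using Gal_eval[OF s univ_poly_coeffs[OF f(1)]] sig_eval[OF f(1)] assms(2) by simp
qed

lemma Gal_one: "\<one>\<^bsub>Gal\<^esub> = sig 0"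
proof (rule sig_eqI)
  show "\<one>\<^bsub>Gal\<^esub> \<in> carrier Gal" using group_Gal by (rule group.is_monoid[THEN monoid.one_closed])
  show "\<one>\<^bsub>Gal\<^esub> x = conj 0" using x_L by (simp add: Gal_group_def BijGroup_def conj_0)
qed

lemma sig_compose: "sig c \<otimes>\<^bsub>Gal\<^esub> sig d = sig (c + d)"
proof (rule sig_eqI)
  show "sig c \<otimes>\<^bsub>Gal\<^esub> sig d \<in> carrier Gal"
    using group_Gal sig_Gal by (metis group.is_monoid monoid.m_closed)
  have z: "\<zeta> [^] d \<in> E" using subring_pow[OF E_sub zeta_E] .
  have "sig c (conj d) = \<zeta> [^] d \<otimes> conj c"
    using sig_mult[of "\<zeta> [^] d" x c] sig_E[OF z] sig_x z E_L x_L by (auto simp: conj_def)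
  also have "\<dots> = conj (c + d)"
    using zeta_carrier x_carrier by (simp add: conj_def nat_pow_mult[symmetric] m_ac)
  finally show "(sig c \<otimes>\<^bsub>Gal\<^esub> sig d) x = conj (c + d)"
    using sig_Gal x_L by (simp add: Gal_mult compose_def sig_x)
qed

lemma sig_pow: "sig 1 [^]\<^bsub>Gal\<^esub> c = sig c"
proof (induction c)
  case 0
  then show ?case by (simp add: Gal_one)
next
  case (Suc c)
  then show ?case by (simp add: sig_compose)
qed

lemma zeta_pow_one_iff: "\<zeta> [^] c = \<one> \<longleftrightarrow> p dvd c"
proof
  assume "\<zeta> [^] c = \<one>"
  then have "\<zeta> [^] (c mod p) = \<one>" using zeta_pow_mod by simp
  moreover have "\<zeta> [^] (c mod p) \<noteq> \<one>" if "0 < c mod p"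
    using zeta that mod_less_divisor[OF p_pos, of c] by (simp add: primitive_root_of_unity_def)
  ultimately show "p dvd c" by (metis gr0I mod_eq_0_iff_dvd)
next
  assume "p dvd c"
  then show "\<zeta> [^] c = \<one>" using zeta_pow_mod[of c] by simp
qed

lemma sig_eq_one_iff: "sig c = \<one>\<^bsub>Gal\<^esub> \<longleftrightarrow> p dvd c"
proof -
  have "sig c = sig 0 \<longleftrightarrow> conj c = conj 0"
    using sig_x[of c] sig_x[of 0] sig_eqI[OF sig_Gal[of c], of 0] by auto
  also have "\<dots> \<longleftrightarrow> \<zeta> [^] c = \<one>"
    using x_carrier zeta_carrier m_rcancel[of x "\<zeta> [^] c" \<one>] by (simp add: conj_def)
  finally show ?thesis by (simp add: Gal_one zeta_pow_one_iff)
qed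

lemma Gal_carrier: "carrier Gal = sig ` {..<p}"
proof
  show "carrier Gal \<subseteq> sig ` {..<p}"
  proof
    fix s assume "s \<in> carrier Gal"
    then obtain c where "c < p" "s = sig c" using Gal_eq_sig by blast
    then show "s \<in> sig ` {..<p}" by blast
  qed
qed (use sig_Gal in blast)

lemma cyclic_Gal: "cyclic_group Gal"
proof -
  interpret Gal: group Gal by (rule group_Gal)
  have "carrier Gal = range (\<lambda>n::int. sig 1 [^]\<^bsub>Gal\<^esub> n)"
  proof
    show "carrier Gal \<subseteq> range (\<lambda>n::int. sig 1 [^]\<^bsub>Gal\<^esub> n)"
    proof
      fix s assume "s \<in> carrier Gal"
      then obtain c where "s = sig c" using Gal_carrier by auto
      then have "s = sig 1 [^]\<^bsub>Gal\<^esub> int c" by (simp only: int_pow_int sig_pow)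
      then show "s \<in> range (\<lambda>n::int. sig 1 [^]\<^bsub>Gal\<^esub> n)" by blast
    qed
    show "range (\<lambda>n::int. sig 1 [^]\<^bsub>Gal\<^esub> n) \<subseteq> carrier Gal"
      using Gal.int_pow_closed[OF sig_Gal] by auto
  qed
  then show ?thesis using Gal.cyclic_group sig_Gal by blast
qed

lemma order_Gal: "order Gal = p"
proof -
  have "inj_on sig {..<p}"
  proof (rule inj_onI)
    fix c d assume cd: "c \<in> {..<p}" "d \<in> {..<p}" "sig c = sig d"
    \<comment> \<open>The shift p - d plays the role of -d: composing with
      \<open>sig (p - d)\<close> turns the equality of two automorphisms into the triviality of
      one.\<close>
    have "sig (c + (p - d)) = sig (d + (p - d))" using cd(3) sig_compose by metis
    moreover have "d + (p - d) = p" using cd by simp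
    moreover have "sig p = \<one>\<^bsub>Gal\<^esub>" using sig_eq_one_iff[of p] by (rule iffD2) simp
    ultimately have "p dvd c + (p - d)" using sig_eq_one_iff[of "c + (p - d)"] by metis
    then obtain m where m: "c + (p - d) = p * m" by (elim dvdE)
    have "0 < p * m" "p * m < p * 2" using cd unfolding m[symmetric] by auto
    then have "m = 1" by simp
    then have "c + (p - d) = p" using m by simp
    then show "c = d" using cd by auto
  qed
  then show ?thesis by (simp add: order_def Gal_carrier card_image)
qed

text \<open>The coefficients of \<sigma>(f(x)) - f(x), for \<sigma> = \<open>sig c\<close>, as a
  polynomial in x. Keeping the difference as a coefficient list over E makes the independence and
  weight results applicable to it.\<close>

fun twist :: "nat \<Rightarrow> 'a list \<Rightarrow> 'a list" where
  "twist c [] = []"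
| "twist c (d # f) = ((\<zeta> [^] (c * length f) \<ominus> \<one>) \<otimes> d) # twist c f"

lemma twist_length: "length (twist c f) = length f"
  by (induction f) auto

lemma zeta_diff_E: "\<zeta> [^] (m::nat) \<ominus> \<one> \<in> E"
  unfolding a_minus_def
  using subring_pow[OF E_sub zeta_E, of m] subringE(3,5,7)[OF E_sub] by blast

lemma twist_E: "set f \<subseteq> E \<Longrightarrow> set (twist c f) \<subseteq> E"
proof (induction f)
  case (Cons d f)
  then show ?case using subringE(6)[OF E_sub zeta_diff_E, of d "c * length f"] by simp
qed simp

lemma eval_twist:
  assumes "set f \<subseteq> E"
  shows "eval (twist c f) x = eval f (conj c) \<ominus> eval f x"
  using assms
proof (induction f)
  case (Cons d f)
  have c: "d \<in> carrier R" "set f \<subseteq> carrier R" using Cons.prems E_carrier by auto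
  define m where "m = length f"
  have xm: "x [^] m \<in> carrier R" "\<zeta> [^] (c * m) \<in> carrier R" "eval f x \<in> carrier R"
    "eval f (conj c) \<in> carrier R" using x_carrier zeta_carrier eval_in_carrier[OF c(2)] conj_carrier by auto
  have "conj c [^] m = \<zeta> [^] (c * m) \<otimes> x [^] m"
    using x_carrier zeta_carrier by (simp add: conj_def nat_pow_distrib nat_pow_pow)
  then have "eval (d # f) (conj c) \<ominus> eval (d # f) x = 
      (d \<otimes> (\<zeta> [^] (c * m) \<otimes> x [^] m) \<oplus> eval f (conj c)) \<ominus> (d \<otimes> x [^] m \<oplus> eval f x)"
    by (simp add: m_def)
  also have "\<dots> = (\<zeta> [^] (c * m) \<ominus> \<one>) \<otimes> d \<otimes> x [^] m \<oplus> (eval f (conj c) \<ominus> eval f x)"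
    using c xm by algebra
  finally show ?case using Cons by (simp add: m_def twist_length)
qed (simp add: a_minus_def)

text \<open>The factor s is the geometric sum 1 + v + ... + v^(l-1) for v = \<zeta>^m, an element of
  B because \<zeta> is one.\<close>

lemma zeta_diff_factor: 
  "\<exists>s\<in>B. \<zeta> [^] (m * l) \<ominus> \<one> = (\<zeta> [^] m \<ominus> \<one>) \<otimes> s" for m l :: nat
proof (induction l)
  case 0
  have "\<zeta> [^] (0::nat) \<ominus> \<one> = (\<zeta> [^] m \<ominus> \<one>) \<otimes> \<zero>"
    using zeta_carrier by (simp add: a_minus_def r_neg)
  then show ?case using BE(2) by auto
next
  case (Suc l)
  then obtain s where s: "s \<in> B" "\<zeta> [^] (m * l) \<ominus> \<one> = (\<zeta> [^] m \<ominus> \<one>) \<otimes> s" by auto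
  have sc: "s \<in> carrier R" using s BE(1) by auto
  define u v where "u = \<zeta> [^] (m * l)" and "v = \<zeta> [^] m"
  have uv: "u \<in> carrier R" "v \<in> carrier R" "u \<in> B"
    using zeta_carrier U_B[OF U_pow[OF zeta_U]] by (auto simp: u_def v_def)
  have "\<zeta> [^] (m * Suc l) \<ominus> \<one> = u \<otimes> v \<ominus> \<one>"
    using zeta_carrier by (simp add: u_def v_def nat_pow_mult add.commute)
  also have "\<dots> = (v \<ominus> \<one>) \<otimes> u \<oplus> (u \<ominus> \<one>)" using uv by algebra
  also have "\<dots> = (v \<ominus> \<one>) \<otimes> (u \<oplus> s)"
    using s(2) uv sc unfolding u_def[symmetric] v_def[symmetric] by (simp, algebra)
  finally show ?case using BE(7)[OF uv(3) s(1)] by (auto simp: v_def)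
qed

text \<open>Each of \<zeta> and \<zeta>^m is a power of the other, so \<zeta> - 1 and \<zeta>^m - 1
  divide each other in B.\<close>

lemma zeta_diff_wt:
  assumes "\<not> p dvd m"
  shows "wt e (\<zeta> [^] m \<ominus> \<one>)"
proof -
  have zm: "\<zeta> [^] m \<in> carrier R" using zeta_carrier by simp
  have nz: "\<zeta> [^] m \<ominus> \<one> \<noteq> \<zero>" using assms zeta_pow_one_iff zm by (metis one_closed r_right_minus_eq)
  then obtain k where k: "wt k (\<zeta> [^] m \<ominus> \<one>)" using E_wt[OF zeta_diff_E] by blast
  have le: "k' \<le> k''" if "wt k' (\<zeta> [^] i \<ominus> \<one>)" "wt k'' (\<zeta> [^] (i * l) \<ominus> \<one>)" for k' k'' and i l :: nat
  proof -
    obtain s where s: "s \<in> B" "\<zeta> [^] (i * l) \<ominus> \<one> = (\<zeta> [^] i \<ominus> \<one>) \<otimes> s" 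
      using zeta_diff_factor by blast
    have c: "\<zeta> [^] i \<ominus> \<one> \<in> carrier R" "\<zeta> [^] i \<ominus> \<one> \<noteq> \<zero>" "s \<in> carrier R"
      using wt_carrier[OF that(1)] BE(1) s by auto
    have "wt (k'' + - k') ((\<zeta> [^] (i * l) \<ominus> \<one>) \<otimes> inv (\<zeta> [^] i \<ominus> \<one>))"
      by (rule wt_mult[OF that(2) wt_inv[OF that(1)]])
    moreover have "(\<zeta> [^] (i * l) \<ominus> \<one>) \<otimes> inv (\<zeta> [^] i \<ominus> \<one>) = s"
      unfolding s(2) using c inv_carrier[OF c(1,2)] by (simp add: m_comm[of _ s] m_assoc)
    ultimately show ?thesis using wt_iff s(1) by fastforce
  qed
  have "gcd m p = 1" using prime_imp_coprime_nat[OF p assms] 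
    by (simp add: coprime_iff_gcd_eq_1 gcd.commute)
  moreover have "m \<noteq> 0" using assms by (auto intro: ccontr)
  \<comment> \<open>The number l inverts m modulo p, so that \<zeta> is the l-th power of
    \<zeta>^m.\<close>
  ultimately obtain l k' where "m * l = p * k' + 1" using bezout_nat[of m p] by auto
  then have "\<zeta> [^] (m * l) = \<zeta> [^] (1::nat)" using zeta_pow_mod[of "m * l"] zeta_pow_mod[of 1]
    by (metis mod_mult_self4)
  then have "wt e (\<zeta> [^] (m * l) \<ominus> \<one>)" using zeta_wt zeta_carrier by simp
  then have "k \<le> e" using le[OF k] by blast
  moreover have "e \<le> k"
    using le[of e 1 k m] zeta_wt k zeta_carrier by simp
  ultimately show ?thesis using k by simp
qed

text \<open>For the fixed field: if \<open>sig 1\<close> fixes f(x), then all (\<zeta>^k - 1) d_k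
  vanish by independence, so d_k = 0 for 0 < k < p and only the constant coefficient
  remains.\<close>

lemma galois: "galois_extension R L E"
  unfolding galois_extension_def
proof (intro conjI ballI L_field E E_L)
  have b0: "X_pow_minus p (x [^] p) \<noteq> []" using X_p(2) by auto
  have alg: "(algebraic over E) x"
    by (rule algebraicI[OF X_p(1) b0 X_p_root[OF x_carrier(1) refl]])
  show "algebraic E y" if "y \<in> L" for y
    using simple_extesion_mem_imp_algebraic[OF E x_carrier(1) alg] that by (simp add: L_def over_def)
  show "{y \<in> L. \<forall>s\<in>carrier Gal. s y = y} = E"
  proof
    show "E \<subseteq> {y \<in> L. \<forall>s\<in>carrier Gal. s y = y}" using E_L Gal_hom(4) by auto
    show "{y \<in> L. \<forall>s\<in>carrier Gal. s y = y} \<subseteq> E"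
    proof
      fix y assume "y \<in> {y \<in> L. \<forall>s\<in>carrier Gal. s y = y}"
      then have y: "y \<in> L" "sig 1 y = y" using sig_Gal by auto
      obtain f where f: "f \<in> carrier (E[X])" "length f \<le> p" "y = eval f x" using L_eval[OF y(1)] by blast
      note fE = univ_poly_coeffs[OF f(1)]
      have yc: "y \<in> carrier R" using y LE(1) by auto
      have "eval (twist 1 f) x = \<zero>"
        using eval_twist[OF fE, of 1] sig_eval[OF f(1), of 1] y(2) f(3) yc by (simp add: a_minus_def r_neg)
      then have "\<forall>d\<in>set (twist 1 f). d = \<zero>"
        using eval_weight_zero[OF E_carrier E_wt x_wt distinct_terms twist_E[OF fE]] f(2)
        by (simp add: twist_length)
      then have "eval f x \<in> E" using fE f(2)
      proof (induction f)
        case (Cons d f)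
        have dc: "d \<in> E" "d \<in> carrier R" using Cons.prems E_carrier by auto
        have IH: "eval f x \<in> E" using Cons by simp
        show ?case
        proof (cases "length f = 0")
          case True
          then show ?thesis using dc by simp
        next
          case False
          \<comment> \<open>\<open>length f\<close> is the exponent of the term of d; it lies
            strictly between 0 and p, as the whole list has length at most p.\<close>
          have "\<not> p dvd length f" using False Cons.prems(3) by (auto dest: dvd_imp_le)
          then have "\<zeta> [^] (1 * length f) \<ominus> \<one> \<noteq> \<zero>" using wt_carrier[OF zeta_diff_wt] by simp
          moreover have "(\<zeta> [^] (1 * length f) \<ominus> \<one>) \<otimes> d = \<zero>" using Cons.prems(1) by simp
          ultimately have "d = \<zero>" using integral[of "\<zeta> [^] (1 * length f) \<ominus> \<one>" d] dc zeta_diff_E E_carrier by blast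
          then show ?thesis using IH x_carrier E_carrier by auto
        qed
      qed (use subringE(2)[OF E_sub] in simp)
      then show "y \<in> E" using f by simp
    qed
  qed
qed

end

section \<open>Ramification groups\<close>

context kummer_step
begin

text \<open>For k at least 0 these are going to be the powers of the maximal ideal, for negative k
  fractional ideals, one of which holds the inverse of the uniformizer. Zero is added by hand
  because it has no weight.\<close>

definition pw :: "int \<Rightarrow> 'a set" where
  "pw k = {y \<in> L. y = \<zero> \<or> (\<exists>l\<ge>k. wt l y)}"

lemma pw_zero: "\<zero> \<in> pw k" using LE(2) by (simp add: pw_def)

lemma pw_iff: 
  assumes "y \<in> L" "wt l y"
  shows "y \<in> pw k \<longleftrightarrow> l \<ge> k"
proof
  assume "y \<in> pw k"
  then obtain l' where "l' \<ge> k" "wt l' y" using wt_carrier(3)[OF assms(2)] by (auto simp: pw_def)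
  then show "l \<ge> k" using wt_unique[OF assms(2)] by blast
next
  assume "l \<ge> k"
  then show "y \<in> pw k" using assms by (auto simp: pw_def)
qed

lemma pwE:
  assumes "y \<in> pw k" "y \<noteq> \<zero>"
  obtains l where "l \<ge> k" "wt l y"
  using assms by (auto simp: pw_def)

lemma pw_L: "y \<in> pw k \<Longrightarrow> y \<in> L" by (simp add: pw_def)

lemma pw_carrier: "y \<in> pw k \<Longrightarrow> y \<in> carrier R" using pw_L LE(1) by auto

lemma pw_mono: "k' \<le> k \<Longrightarrow> pw k \<subseteq> pw k'" by (force simp: pw_def)

lemma pw_0: "pw 0 = L \<inter> B"
proof
  show "pw 0 \<subseteq> L \<inter> B" using wt_nonneg BE(2) by (auto simp: pw_def)
  show "L \<inter> B \<subseteq> pw 0" using L_wt wt_iff by (auto simp: pw_def)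
qed

lemma pw_add:
  assumes "y \<in> pw k" "z \<in> pw k"
  shows "y \<oplus> z \<in> pw k"
proof (cases "y = \<zero> \<or> z = \<zero> \<or> y \<oplus> z = \<zero>")
  case True
  then show ?thesis using assms pw_carrier pw_zero by auto
next
  case False
  have L: "y \<oplus> z \<in> L" using LE(7) pw_L assms by simp
  then obtain m where m: "wt m (y \<oplus> z)" using L_wt False by blast
  obtain l l' where l: "l \<ge> k" "wt l y" "l' \<ge> k" "wt l' z" using assms False by (metis pwE)
  then show ?thesis using pw_iff[OF L m] wt_add_ge[OF l(2,4) m] by simp
qed

lemma pw_mult:
  assumes "y \<in> pw k" "z \<in> pw l"
  shows "y \<otimes> z \<in> pw (k + l)"
proof (cases "y = \<zero> \<or> z = \<zero>")
  case True
  then have "y \<otimes> z = \<zero>" using pw_carrier[OF assms(1)] pw_carrier[OF assms(2)] by auto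
  then show ?thesis using pw_zero by simp
next
  case False
  obtain m m' where "m \<ge> k" "wt m y" "m' \<ge> l" "wt m' z" using assms False by (metis pwE)
  then show ?thesis
    using pw_iff[OF LE(6)[OF pw_L[OF assms(1)] pw_L[OF assms(2)]] wt_mult[of m y m' z]] by simp
qed

lemma pw_minus:
  assumes "y \<in> pw k"
  shows "\<ominus> y \<in> pw k"
proof -
  have "\<ominus> \<one> \<in> pw 0" unfolding pw_0 using LE(3,5) BE(3,5) by auto
  from pw_mult[OF this assms] show ?thesis using pw_carrier[OF assms] by (simp add: l_minus)
qed

section \<open>Ideals of the valuation ring of L\<close>

abbreviation S where "S \<equiv> R\<lparr>carrier := pw 0\<rparr>"

lemma pw_0_subring: "subring (pw 0) R"
proof (rule subringI)
  show "pw 0 \<subseteq> carrier R" using pw_carrier by blast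
  show "\<one> \<in> pw 0" using LE(3) BE(3) by (simp add: pw_0)
qed (use pw_minus pw_add pw_mult[of _ 0 _ 0] in auto)

lemma S_ring: "ring S" by (rule subring_is_ring[OF pw_0_subring])

lemma pw_ideal:
  assumes "k \<ge> 0"
  shows "ideal (pw k) S"
proof (rule idealI[OF S_ring])
  have sub: "pw k \<subseteq> pw 0" using pw_mono assms by simp
  have "group (add_monoid S)" using ring.is_abelian_group[OF S_ring] abelian_group.a_group by blast
  then show "subgroup (pw k) (add_monoid S)"
  proof (rule group.subgroupI)
    show "pw k \<subseteq> carrier (add_monoid S)" using sub by simp
    show "pw k \<noteq> {}" using pw_zero by blast
    fix y assume y: "y \<in> pw k"
    then have "y \<in> pw 0" "\<ominus> y \<in> pw k" using sub pw_minus by auto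
    then have "\<ominus> y \<oplus>\<^bsub>S\<^esub> y = \<zero>\<^bsub>S\<^esub>" "\<ominus> y \<in> carrier S" "y \<in> carrier S"
      using pw_carrier sub by (auto simp: l_neg)
    then have "\<ominus>\<^bsub>S\<^esub> y = \<ominus> y" using abelian_group.minus_equality[OF ring.is_abelian_group[OF S_ring]] by blast
    then show "inv\<^bsub>add_monoid S\<^esub> y \<in> pw k" using \<open>\<ominus> y \<in> pw k\<close> by (simp add: a_inv_def)
    fix z assume "z \<in> pw k"
    then show "y \<otimes>\<^bsub>add_monoid S\<^esub> z \<in> pw k" using pw_add[OF y] by simp
  qed
  show "z \<otimes>\<^bsub>S\<^esub> y \<in> pw k" "y \<otimes>\<^bsub>S\<^esub> z \<in> pw k" if "y \<in> pw k" "z \<in> carrier S" for y z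
    using pw_mult[OF that(1), of z 0] pw_mult[of z 0, OF _ that(1)] that(2) by auto
qed

text \<open>An element of weight 0 has its inverse in \<open>pw 0\<close> too, so an ideal not
  contained in \<open>pw 1\<close> contains a unit.\<close>

lemma proper_ideal_pw:
  assumes J: "ideal J S" and ne: "J \<noteq> pw 0"
  shows "J \<subseteq> pw 1"
proof
  fix y assume y: "y \<in> J"
  interpret J: ideal J S by (rule J)
  have y0: "y \<in> pw 0" using J.Icarr[OF y] by simp
  show "y \<in> pw 1"
  proof (rule ccontr)
    assume ny: "y \<notin> pw 1"
    then have ynz: "y \<noteq> \<zero>" using pw_zero by auto
    then obtain l where l: "l \<ge> 0" "wt l y" using pwE[OF y0] by blast
    then have "wt 0 y" using ny pw_iff[OF pw_L[OF y0] l(2), of 1] by (cases "l = 0") auto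
    moreover have "inv y \<in> L" using subfield_m_inv(1)[OF L_field] pw_L[OF y0] ynz by blast
    ultimately have "inv y \<in> pw 0" using pw_iff[of "inv y" 0 0] wt_inv[of 0 y] by simp
    then have "inv y \<otimes> y \<in> J" using J.I_l_closed[OF y, of "inv y"] by simp
    then have "\<one> \<in> J" using inv_carrier(3)[OF pw_carrier[OF y0] ynz] by simp
    then have "J = pw 0" using J.one_imp_carrier by simp
    then show False using ne by simp
  qed
qed

lemma pw_1_neq: "pw 1 \<noteq> pw 0"
proof -
  have "\<one> \<in> pw 0" "\<one> \<notin> pw 1" by (simp_all add: pw_iff[OF LE(3) wt_one])
  then show ?thesis by blast
qed

text \<open>\<open>the_maximal_ideal\<close> is a definite description, so uniqueness is needed
  along with maximality.\<close>

lemma maximalideal_iff: "maximalideal P S \<longleftrightarrow> P = pw 1"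
proof
  assume P: "maximalideal P S"
  then interpret P: maximalideal P S .
  have "P \<noteq> pw 0" using P.I_notcarr by auto
  then have "P \<subseteq> pw 1" using proper_ideal_pw[OF P.is_ideal] by simp
  then show "P = pw 1"
    using P.I_maximal[OF pw_ideal[of 1]] pw_1_neq pw_mono[of 0 1] by auto
next
  assume P: "P = pw 1"
  show "maximalideal P S"
  proof (rule maximalidealI)
    show "ideal P S" using P pw_ideal by simp
    show "carrier S \<noteq> P" using P pw_1_neq by auto
    show "J = P \<or> J = carrier S" if "ideal J S" "P \<subseteq> J" "J \<subseteq> carrier S" for J
      using proper_ideal_pw[OF that(1)] that(2) P by auto
  qed
qed

lemma the_maximal_ideal_S: "the_maximal_ideal S = pw 1"
  by (simp add: the_maximal_ideal_def maximalideal_iff)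

definition y\<^sub>0 where "y\<^sub>0 = d\<^sub>0 \<otimes> x [^] k\<^sub>0"

lemma y\<^sub>0: "y\<^sub>0 \<in> L" "wt 1 y\<^sub>0"
  using LE(6) d\<^sub>0 E_L subring_pow[OF L_sub x_L] by (auto simp: y\<^sub>0_def)

text \<open>The uniformizer gives the nontrivial inclusion: an s of weight at least k + 1 is (s /
  \<open>y\<^sub>0\<close>) \<open>y\<^sub>0\<close>, with a first factor of weight at least
  k.\<close>

lemma ideal_power_pw: "ideal_power S (pw 1) k = pw (int k)"
proof (induction k)
  case (Suc k)
  have "ideal_prod S (pw (int k)) (pw 1) = pw (int (Suc k))"
  proof
    show "ideal_prod S (pw (int k)) (pw 1) \<subseteq> pw (int (Suc k))"
    proof
      fix s assume "s \<in> ideal_prod S (pw (int k)) (pw 1)"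
      then show "s \<in> pw (int (Suc k))"
        by (induction) (use pw_mult[of _ "int k" _ 1] pw_add in \<open>auto simp: add.commute\<close>)
    qed
    show "pw (int (Suc k)) \<subseteq> ideal_prod S (pw (int k)) (pw 1)"
    proof
      fix s assume s: "s \<in> pw (int (Suc k))"
      have y1: "y\<^sub>0 \<in> pw 1" using pw_iff[OF y\<^sub>0] by simp
      have nz: "y\<^sub>0 \<in> carrier R" "y\<^sub>0 \<noteq> \<zero>" using wt_carrier[OF y\<^sub>0(2)] by auto
      have "inv y\<^sub>0 \<in> L" using subfield_m_inv(1)[OF L_field] y\<^sub>0 nz by blast
      then have "inv y\<^sub>0 \<in> pw (- 1)" using pw_iff[OF _ wt_inv[OF y\<^sub>0(2)]] by simp
      then have "s \<otimes> inv y\<^sub>0 \<in> pw (int k)" using pw_mult[OF s] by fastforce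
      from ideal_prod.prod[OF this y1, of S]
      have "s \<otimes> inv y\<^sub>0 \<otimes> y\<^sub>0 \<in> ideal_prod S (pw (int k)) (pw 1)" by simp
      moreover have "s \<otimes> inv y\<^sub>0 \<otimes> y\<^sub>0 = s"
        using pw_carrier[OF s] inv_carrier[OF nz] nz by (simp add: m_assoc)
      ultimately show "s \<in> ideal_prod S (pw (int k)) (pw 1)" by simp
    qed
  qed
  then show ?case using Suc by simp
qed simp

text \<open>A term survives only if p does not divide c m. Its weight k + h m is then no multiple of
  p, in particular not 0, and being nonnegative it is at least 1. The factor \<zeta>^(c m) - 1 adds
  e.\<close>

lemma twist_pw:
  assumes "set f \<subseteq> E" "length f \<le> p" "terms_ge x 0 f"
  shows "eval (twist c f) x \<in> pw (e + 1)"
  using assms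
proof (induction f)
  case (Cons d f)
  define m z where "m = length f" and "z = \<zeta> [^] (c * m) \<ominus> \<one>"
  have IH: "eval (twist c f) x \<in> pw (e + 1)" using Cons by simp
  have dE: "d \<in> E" and dc: "d \<in> carrier R" using Cons.prems E_carrier by auto
  have zE: "z \<in> E" unfolding z_def by (rule zeta_diff_E)
  then have zc: "z \<in> carrier R" using E_carrier by auto
  have xm: "x [^] m \<in> carrier R" "x [^] m \<in> L" using x_carrier subring_pow[OF L_sub x_L] by auto
  have "z \<otimes> d \<otimes> x [^] m \<in> pw (e + 1)"
  proof (cases "z = \<zero> \<or> d = \<zero>")
    case True
    then have "z \<otimes> d \<otimes> x [^] m = \<zero>" using zc dc xm by auto
    then show ?thesis using pw_zero by simp
  next
    case False
    have ndvd: "\<not> p dvd c * m" using False zeta_pow_one_iff[of "c * m"] by (auto simp: z_def a_minus_def r_neg)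
    then have z: "wt e z" unfolding z_def by (rule zeta_diff_wt)
    obtain l where l: "l \<ge> 0" "wt l (d \<otimes> x [^] m)" using Cons.prems False by (auto simp: m_def)
    obtain k where k: "int p dvd k" "wt k d" using E_wt[OF dE] False by auto
    have "l = k + h * int m" using wt_unique[OF l(2) wt_mult[OF k(2) wt_pow[OF x_wt]]] .
    moreover have "\<not> int p dvd h * int m"
      using h p ndvd prime_dvd_mult_iff[of "int p" h "int m"] by auto
    ultimately have "l \<noteq> 0" using k(1) by (metis dvd_add_right_iff dvd_0_right)
    then have "e + 1 \<le> e + l" using l by simp
    moreover have "z \<otimes> (d \<otimes> x [^] m) \<in> L" using LE(6) subsetD[OF E_L zE] subsetD[OF E_L dE] xm(2) by blast
    ultimately have "z \<otimes> (d \<otimes> x [^] m) \<in> pw (e + 1)" using pw_iff[OF _ wt_mult[OF z l(2)]] by simp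
    then show ?thesis using zc dc xm by (simp add: m_assoc)
  qed
  then show ?case using pw_add[OF _ IH] by (simp add: m_def z_def twist_length)
qed (simp add: pw_zero)

lemma sig_diff_pw:
  assumes y: "y \<in> pw 0"
  shows "sig c y \<ominus> y \<in> pw (e + 1)"
proof -
  obtain f where f: "f \<in> carrier (E[X])" "length f \<le> p" "y = eval f x" using L_eval[OF pw_L[OF y]] by blast
  note fE = univ_poly_coeffs[OF f(1)]
  \<comment> \<open>The weight of y is at least 0; as nothing cancels, the same holds for every
    single term of f, which is what \<open>twist_pw\<close> needs.\<close>
  have "terms_ge x 0 f"
    using eval_weight[OF E_carrier E_wt x_wt distinct_terms fE f(2), simplified]
  proof (elim disjE exE conjE)
    assume "\<forall>d\<in>set f. d = \<zero>"
    then show ?thesis using terms_ge_zeros by blast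
  next
    fix k j assume k: "wt k (eval f x)" "terms_ge x k f"
    then have "k \<ge> 0" using pw_iff[OF pw_L[OF y], of k 0] y f(3) by simp
    then show ?thesis using terms_ge_mono[OF k(2)] by simp
  qed
  from twist_pw[OF fE f(2) this, of c] show ?thesis
    using eval_twist[OF fE, of c] sig_eval[OF f(1), of c] f(3) by simp
qed

text \<open>The bound e + 1 is attained at the uniformizer, because it is multiplied by a power of
  \<zeta> other than 1.\<close>

lemma sig_diff_y\<^sub>0:
  assumes c: "\<not> p dvd c"
  shows "wt (e + 1) (sig c y\<^sub>0 \<ominus> y\<^sub>0)"
proof -
  have "sig c y\<^sub>0 = d\<^sub>0 \<otimes> conj c [^] k\<^sub>0"
    using Gal_hom(2)[OF sig_Gal _ subring_pow[OF L_sub x_L], of d\<^sub>0 c k\<^sub>0] d\<^sub>0 E_L sig_E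
      Gal_pow[OF sig_Gal x_L] sig_x by (auto simp: y\<^sub>0_def)
  also have "conj c [^] k\<^sub>0 = \<zeta> [^] (c * k\<^sub>0) \<otimes> x [^] k\<^sub>0"
    using x_carrier zeta_carrier by (simp add: conj_def nat_pow_distrib nat_pow_pow)
  finally have 1: "sig c y\<^sub>0 = d\<^sub>0 \<otimes> (\<zeta> [^] (c * k\<^sub>0) \<otimes> x [^] k\<^sub>0)" .
  have cc: "d\<^sub>0 \<in> carrier R" "\<zeta> [^] (c * k\<^sub>0) \<in> carrier R" "x [^] k\<^sub>0 \<in> carrier R"
    using d\<^sub>0 E_carrier zeta_carrier x_carrier by auto
  have "sig c y\<^sub>0 \<ominus> y\<^sub>0 = (\<zeta> [^] (c * k\<^sub>0) \<ominus> \<one>) \<otimes> y\<^sub>0"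
    unfolding 1 unfolding y\<^sub>0_def using cc by algebra
  moreover have "\<not> p dvd c * k\<^sub>0" using c k\<^sub>0 p by (simp add: prime_dvd_mult_iff)
  ultimately show ?thesis using wt_mult[OF zeta_diff_wt y\<^sub>0(2)] by simp
qed

section \<open>Ramification groups in terms of weights\<close>

context
  fixes A
  assumes A: "\<And>y. y \<in> L \<Longrightarrow> integral_over R A y \<longleftrightarrow> y \<in> B"
begin

text \<open>The hypothesis on A is the link between integral closures, through which ramification
  groups are defined, and weights.\<close>

lemma integer_ring_eq: "integer_ring R A L = S"
proof -
  have "{y \<in> L. integral_over R A y} = pw 0" using A by (auto simp: pw_0)
  then show ?thesis by (simp add: integer_ring_def)
qed

lemma ramification_group_iff:
  assumes "t \<ge> -1"
  shows "s \<in> ramification_group R A L E t \<longleftrightarrow> 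
    s \<in> carrier Gal \<and> (\<forall>y\<in>pw 0. s y \<ominus> y \<in> pw (t + 1))"
  using assms by (simp add: ramification_group_def integer_ring_eq the_maximal_ideal_S ideal_power_pw)

lemma ramification_group_low:
  assumes "-1 \<le> t" "t \<le> e"
  shows "ramification_group R A L E t = carrier Gal"
proof -
  have "s y \<ominus> y \<in> pw (t + 1)" if s: "s \<in> carrier Gal" and y: "y \<in> pw 0" for s y
  proof -
    obtain c where "s = sig c" using Gal_eq_sig[OF s] by blast
    then have "s y \<ominus> y \<in> pw (e + 1)" using sig_diff_pw[OF y] by simp
    then show ?thesis using pw_mono[of "t + 1" "e + 1"] assms by auto
  qed
  then show ?thesis using ramification_group_iff[OF assms(1)] by blast
qed

lemma ramification_group_high:
  assumes "t > e"
  shows "ramification_group R A L E t = {\<one>\<^bsub>Gal\<^esub>}"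
proof -
  have t: "t \<ge> -1" using assms e_pos by simp
  have one: "\<one>\<^bsub>Gal\<^esub> \<in> carrier Gal" using sig_Gal by (simp add: Gal_one)
  have "\<one>\<^bsub>Gal\<^esub> y \<ominus> y = \<zero>" if "y \<in> pw 0" for y
    using pw_L[OF that] pw_carrier[OF that] by (simp add: Gal_group_def BijGroup_def a_minus_def r_neg)
  then have 1: "\<one>\<^bsub>Gal\<^esub> \<in> ramification_group R A L E t"
    using ramification_group_iff[OF t] one pw_zero by simp
  have "s = \<one>\<^bsub>Gal\<^esub>" if s: "s \<in> ramification_group R A L E t" for s
  proof (rule ccontr)
    assume ns: "s \<noteq> \<one>\<^bsub>Gal\<^esub>"
    have sG: "s \<in> carrier Gal" and sp: "\<forall>y\<in>pw 0. s y \<ominus> y \<in> pw (t + 1)"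
      using s ramification_group_iff[OF t] by auto
    obtain c where c: "s = sig c" using Gal_eq_sig[OF sG] by blast
    have w: "wt (e + 1) (s y\<^sub>0 \<ominus> y\<^sub>0)" using sig_diff_y\<^sub>0[of c] ns c sig_eq_one_iff by simp
    have "y\<^sub>0 \<in> pw 0" using pw_iff[OF y\<^sub>0] by simp
    then have "s y\<^sub>0 \<ominus> y\<^sub>0 \<in> pw (t + 1)" using sp by blast
    then have "e + 1 \<ge> t + 1" using pw_iff[OF pw_L w] by blast
    then show False using assms by simp
  qed
  then show ?thesis using 1 by blast
qed

lemma ramification_breaks_eq: "ramification_breaks R A L E = {e}"
proof -
  have "card (carrier Gal) = p" using order_Gal by (simp add: order_def)
  \<comment> \<open>The order p > 1 makes the drop at e a genuine one.\<close>
  then have ne: "carrier Gal \<noteq> {\<one>\<^bsub>Gal\<^esub>}" using p prime_gt_1_nat[OF p] by auto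
  have "t = e" if t: "t \<ge> -1" "ramification_group R A L E t \<noteq> ramification_group R A L E (t + 1)" for t
  proof -
    consider "t + 1 \<le> e" | "t > e" | "t = e" by linarith
    then show ?thesis
      by cases (use t ramification_group_low[of t] ramification_group_low[of "t + 1"]
          ramification_group_high[of t] ramification_group_high[of "t + 1"] in auto)
  qed
  moreover have "ramification_group R A L E e \<noteq> ramification_group R A L E (e + 1)"
    using ramification_group_low[of e] ramification_group_high[of "e + 1"] ne e_pos by simp
  ultimately show ?thesis using e_pos unfolding ramification_breaks_def by auto
qed

end

end

section \<open>The p-adic numbers\<close>

locale padic =
  fixes p :: nat
  assumes prime_p: "Factorial_Ring.prime p"
begin

section \<open>The p-adic absolute value on the rationals\<close>

abbreviation N :: "rat \<Rightarrow> real" where "N \<equiv> padic_abs p"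

lemma p_int: "prime_elem (int p)" using prime_p by simp

lemma p_gt: "real p > 1" using prime_gt_1_nat[OF prime_p] by simp

text \<open>\<open>padic_val\<close> reads the reduced fraction; comparing it with a / b by
  cross-multiplication makes every representation usable.\<close>

lemma val_frac:
  assumes "a \<noteq> 0" "b \<noteq> 0"
  shows "padic_val p (of_int a / of_int b) = int (multiplicity (int p) a) - int (multiplicity (int p) b)"
proof -
  obtain c d where cd: "quotient_of (of_int a / of_int b) = (c, d)" by (cases "quotient_of (of_int a / of_int b)")
  have d: "d > 0" using quotient_of_denom_pos[OF cd] .
  have "(of_int a / of_int b :: rat) = of_int c / of_int d" by (rule quotient_of_div[OF cd])
  then have eq: "a * d = c * b" using d assms by (simp add: field_simps flip: of_int_mult)
  then have c: "c \<noteq> 0" using d assms by auto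
  have "multiplicity (int p) (a * d) = multiplicity (int p) a + multiplicity (int p) d"
    "multiplicity (int p) (c * b) = multiplicity (int p) c + multiplicity (int p) b"
    using assms c d by (simp_all add: prime_elem_multiplicity_mult_distrib[OF p_int])
  then show ?thesis using eq cd by (simp add: padic_val_def)
qed

lemma rat_frac:
  fixes x :: rat
  obtains a b where "b \<noteq> 0" "x = of_int a / of_int b"
  by (metis quotient_of_div quotient_of_denom_pos less_irrefl surj_pair)

lemma val_mult: 
  assumes "x \<noteq> 0" "y \<noteq> 0"
  shows "padic_val p (x * y) = padic_val p x + padic_val p y"
proof -
  obtain a b c d where x: "b \<noteq> 0" "x = of_int a / of_int b" and y: "d \<noteq> 0" "y = of_int c / of_int d"
    by (metis rat_frac)
  then have nz: "a \<noteq> 0" "c \<noteq> 0" using assms by auto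
  have "x * y = of_int (a * c) / of_int (b * d)" using x y by simp
  then show ?thesis
    using x y nz val_frac[of "a * c" "b * d"] val_frac[of a b] val_frac[of c d]
    by (simp add: prime_elem_multiplicity_mult_distrib[OF p_int])
qed

lemma val_add:
  assumes "x \<noteq> 0" "y \<noteq> 0" "x + y \<noteq> 0"
  shows "padic_val p (x + y) \<ge> min (padic_val p x) (padic_val p y)"
proof -
  obtain a b c d where x: "b \<noteq> 0" "x = of_int a / of_int b" and y: "d \<noteq> 0" "y = of_int c / of_int d"
    by (metis rat_frac)
  define m where "m = b * d"
  have m: "m \<noteq> 0" using x y by (simp add: m_def)
  have x': "x = of_int (a * d) / of_int m" and y': "y = of_int (c * b) / of_int m"
    and s: "x + y = of_int (a * d + c * b) / of_int m"
    using x y by (simp_all add: m_def field_simps)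
  have nz: "a * d \<noteq> 0" "c * b \<noteq> 0" "a * d + c * b \<noteq> 0"
    using assms x' y' s by (metis div_0 of_int_0)+
  define k where "k = min (multiplicity (int p) (a * d)) (multiplicity (int p) (c * b))"
  have "int p ^ k dvd a * d" "int p ^ k dvd c * b" by (auto simp: k_def intro: multiplicity_dvd')
  then have "int p ^ k dvd a * d + c * b" by simp
  then have "k \<le> multiplicity (int p) (a * d + c * b)"
    using nz(3) prime_p by (intro multiplicity_geI) auto
  then show ?thesis
    unfolding s unfolding x' y' val_frac[OF nz(1) m] val_frac[OF nz(2) m] val_frac[OF nz(3) m] k_def
    by simp
qed

lemma N_0 [simp]: "N 0 = 0" by (simp add: padic_abs_def)

lemma N_pos: "x \<noteq> 0 \<Longrightarrow> N x > 0" using p_gt by (simp add: padic_abs_def)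

lemma N_nonneg: "N x \<ge> 0" using N_pos[of x] by (cases "x = 0") auto

lemma N_mult: "N (x * y) = N x * N y"
proof (cases "x = 0 \<or> y = 0")
  case False
  then show ?thesis using p_gt by (simp add: padic_abs_def val_mult power_int_add[symmetric])
qed auto

lemma N_ultra: "N (x + y) \<le> max (N x) (N y)"
proof (cases "x = 0 \<or> y = 0 \<or> x + y = 0")
  case True
  then show ?thesis using N_nonneg by (auto simp: le_max_iff_disj)
next
  case False
  then have "min (padic_val p x) (padic_val p y) \<le> padic_val p (x + y)" using val_add by simp
  then have "- padic_val p (x + y) \<le> - padic_val p x \<or> - padic_val p (x + y) \<le> - padic_val p y" by linarith
  then show ?thesis using False p_gt by (auto simp: padic_abs_def le_max_iff_disj intro: power_int_increasing)
qed

lemma N_int: "b \<noteq> 0 \<Longrightarrow> N (of_int b) = inverse (real p ^ multiplicity (int p) b)"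
  using val_frac[of b 1] by (simp add: padic_abs_def power_int_minus)

lemma N_1 [simp]: "N 1 = 1" using N_int[of 1] by simp

lemma N_minus [simp]: "N (- x) = N x"
  using N_mult[of "-1" x] N_int[of "-1"] multiplicity_unit_right[of "-1" "int p"] by simp

lemma N_diff: "N (x - y) \<le> max (N x) (N y)" using N_ultra[of x "- y"] by simp

lemma N_diff_commute: "N (x - y) = N (y - x)" using N_minus[of "x - y"] by simp

lemma N_p: "N (of_nat p) = inverse (real p)"
  using N_int[of "int p"] prime_p multiplicity_prime[OF p_int] prime_gt_0_nat[OF prime_p] by simp

lemma N_int_le: "N (of_int b) \<le> 1"
proof (cases "b = 0")
  case False
  have "1 \<le> real p ^ multiplicity (int p) b" using p_gt by simp
  then show ?thesis using N_int[OF False] by (simp add: inverse_le_1_iff)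
qed simp

lemma N_isosceles: "N (x - y) < N y \<Longrightarrow> N x = N y"
  using N_ultra[of "x - y" y] N_diff[of x "x - y"] by auto

lemma N_inverse: "N (inverse x) = inverse (N x)"
proof (cases "x = 0")
  case False
  then have "N x * N (inverse x) = 1" using N_mult[of x "inverse x"] by simp
  then show ?thesis by (metis inverse_unique)
qed simp

lemma N_power: "N (x ^ k) = N x ^ k" by (induction k) (auto simp: N_mult)

section \<open>Cauchy sequences and null sequences\<close>

abbreviation "cauchy \<equiv> padic_cauchy p"
abbreviation "C \<equiv> padic_cauchy_ring p"
abbreviation "I \<equiv> padic_null p"

lemma null_iff: "s \<in> I \<longleftrightarrow> (\<forall>e>0. \<exists>M. \<forall>n\<ge>M. N (s n) < e)"
  using N_nonneg by (simp add: padic_null_def LIMSEQ_iff)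

lemma null_cauchy: "s \<in> I \<Longrightarrow> cauchy s"
  unfolding padic_cauchy_def
proof (intro allI impI)
  fix e :: real assume "s \<in> I" "e > 0"
  then obtain M where M: "\<And>n. n \<ge> M \<Longrightarrow> N (s n) < e" by (auto simp: null_iff)
  have "N (s m - s n) < e" if "m \<ge> M" "n \<ge> M" for m n
    using N_diff[of "s m" "s n"] M[OF that(1)] M[OF that(2)] by linarith
  then show "\<exists>M. \<forall>m\<ge>M. \<forall>n\<ge>M. N (s m - s n) < e" by blast
qed

lemma cauchy_const: "cauchy (\<lambda>n. c)" by (auto simp: padic_cauchy_def)

lemma cauchy_add:
  assumes "cauchy s" "cauchy t"
  shows "cauchy (\<lambda>n. s n + t n)"
  unfolding padic_cauchy_def
proof (intro allI impI)
  fix e :: real assume "e > 0"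
  then obtain M M' where M: "\<And>m n. m \<ge> M \<Longrightarrow> n \<ge> M \<Longrightarrow> N (s m - s n) < e"
    "\<And>m n. m \<ge> M' \<Longrightarrow> n \<ge> M' \<Longrightarrow> N (t m - t n) < e"
    using assms unfolding padic_cauchy_def by meson
  have "N (s m + t m - (s n + t n)) < e" if "m \<ge> max M M'" "n \<ge> max M M'" for m n
    using N_ultra[of "s m - s n" "t m - t n"] M(1)[of m n] M(2)[of m n] that by (simp add: algebra_simps)
  then show "\<exists>M. \<forall>m\<ge>M. \<forall>n\<ge>M. N (s m + t m - (s n + t n)) < e" by blast
qed

lemma cauchy_minus: "cauchy s \<Longrightarrow> cauchy (\<lambda>n. - s n)"
  by (simp add: padic_cauchy_def N_diff_commute)

lemma cauchy_bounded:
  assumes "cauchy s"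
  shows "\<exists>K>0. \<forall>n. N (s n) \<le> K"
proof -
  obtain M where M: "\<And>m n. m \<ge> M \<Longrightarrow> n \<ge> M \<Longrightarrow> N (s m - s n) < 1"
    using assms unfolding padic_cauchy_def by (meson zero_less_one)
  define K where "K = 1 + (\<Sum>n\<le>M. N (s n))"
  have le: "N (s n) \<le> (\<Sum>n\<le>M. N (s n))" if "n \<le> M" for n
    using that N_nonneg by (intro member_le_sum) auto
  have "N (s n) \<le> K" for n
  proof (cases "n \<le> M")
    case True
    then show ?thesis using le[of n] by (simp add: K_def)
  next
    case False
    then show ?thesis using N_ultra[of "s n - s M" "s M"] M[of n M] le[of M] N_nonneg[of "s M"] by (simp add: K_def)
  qed
  moreover have "K > 0" using N_nonneg by (simp add: K_def add_pos_nonneg sum_nonneg)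
  ultimately show ?thesis by blast
qed

lemma null_mult:
  assumes "cauchy s" "t \<in> I"
  shows "(\<lambda>n. s n * t n) \<in> I"
  unfolding null_iff
proof (intro allI impI)
  fix e :: real assume e: "e > 0"
  obtain K where K: "K > 0" "\<And>n. N (s n) \<le> K" using cauchy_bounded[OF assms(1)] by blast
  obtain M where M: "\<And>n. n \<ge> M \<Longrightarrow> N (t n) < e / K"
    using assms(2) e K(1) unfolding null_iff by (meson divide_pos_pos)
  have "N (s n * t n) < e" if "n \<ge> M" for n
  proof -
    have "N (s n * t n) \<le> K * N (t n)" using K(2)[of n] N_nonneg by (simp add: N_mult mult_right_mono)
    also have "\<dots> < e" using M[OF that] K(1) by (simp add: field_simps)
    finally show ?thesis .
  qed
  then show "\<exists>M. \<forall>n\<ge>M. N (s n * t n) < e" by blast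
qed

lemma cauchy_mult:
  assumes "cauchy s" "cauchy t"
  shows "cauchy (\<lambda>n. s n * t n)"
  unfolding padic_cauchy_def
proof (intro allI impI)
  fix e :: real assume e: "e > 0"
  obtain K K' where K: "K > 0" "\<And>n. N (s n) \<le> K" and K': "K' > 0" "\<And>n. N (t n) \<le> K'"
    using cauchy_bounded[OF assms(1)] cauchy_bounded[OF assms(2)] by blast
  have "e / K' > 0" "e / K > 0" using e K K' by auto
  then obtain M M' where M: "\<And>m n. m \<ge> M \<Longrightarrow> n \<ge> M \<Longrightarrow> N (s m - s n) < e / K'"
    "\<And>m n. m \<ge> M' \<Longrightarrow> n \<ge> M' \<Longrightarrow> N (t m - t n) < e / K"
    using assms unfolding padic_cauchy_def by meson
  have "N (s m * t m - s n * t n) < e" if "m \<ge> max M M'" "n \<ge> max M M'" for m n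
  proof -
    have "N (s m * (t m - t n)) \<le> K * N (t m - t n)" "N ((s m - s n) * t n) \<le> N (s m - s n) * K'"
      using K(2) K'(2) N_nonneg by (simp_all add: N_mult mult_right_mono mult_left_mono)
    moreover have "K * N (t m - t n) < e" "N (s m - s n) * K' < e"
      using M(1)[of m n] M(2)[of m n] that K K' by (simp_all add: field_simps)
    moreover have "s m * t m - s n * t n = s m * (t m - t n) + (s m - s n) * t n" by (simp add: algebra_simps)
    ultimately show ?thesis using N_ultra[of "s m * (t m - t n)" "(s m - s n) * t n"] by simp
  qed
  then show "\<exists>M. \<forall>m\<ge>M. \<forall>n\<ge>M. N (s m * t m - s n * t n) < e" by blast
qed

lemma null_add:
  assumes "s \<in> I" "t \<in> I"
  shows "(\<lambda>n. s n + t n) \<in> I"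
  unfolding null_iff
proof (intro allI impI)
  fix e :: real assume "e > 0"
  then obtain M M' where M: "\<And>n. n \<ge> M \<Longrightarrow> N (s n) < e" "\<And>n. n \<ge> M' \<Longrightarrow> N (t n) < e"
    using assms unfolding null_iff by meson
  have "N (s n + t n) < e" if "n \<ge> max M M'" for n
    using N_ultra[of "s n" "t n"] M(1)[of n] M(2)[of n] that by simp
  then show "\<exists>M. \<forall>n\<ge>M. N (s n + t n) < e" by blast
qed

lemma null_minus: "s \<in> I \<Longrightarrow> (\<lambda>n. - s n) \<in> I" by (simp add: null_iff)

lemma null_0: "(\<lambda>n. 0) \<in> I" by (simp add: null_iff)

lemma C_simps [simp]: "carrier C = {s. cauchy s}" "s \<otimes>\<^bsub>C\<^esub> t = (\<lambda>n. s n * t n)" "\<one>\<^bsub>C\<^esub> = (\<lambda>n. 1)"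
  "\<zero>\<^bsub>C\<^esub> = (\<lambda>n. 0)" "s \<oplus>\<^bsub>C\<^esub> t = (\<lambda>n. s n + t n)"
  by (simp_all add: padic_cauchy_ring_def)

lemma C_cring: "cring C"
proof (rule cringI)
  show "abelian_group C"
  proof (rule abelian_groupI)
    fix s assume "s \<in> carrier C"
    then show "\<exists>t\<in>carrier C. t \<oplus>\<^bsub>C\<^esub> s = \<zero>\<^bsub>C\<^esub>"
      using cauchy_minus by (intro bexI[of _ "\<lambda>n. - s n"]) auto
  qed (auto simp: cauchy_add cauchy_const algebra_simps)
  show "comm_monoid C"
    by (rule comm_monoidI) (auto simp: cauchy_mult cauchy_const algebra_simps)
qed (auto simp: algebra_simps)

lemma I_ideal: "ideal I C"
proof (rule idealI)
  interpret C: cring C by (rule C_cring)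
  show "ring C" by unfold_locales
  show "subgroup I (add_monoid C)"
  proof (rule C.add.subgroupI)
    show "I \<subseteq> carrier C" using null_cauchy by auto
    show "I \<noteq> {}" using null_0 by blast
    fix s assume s: "s \<in> I"
    have "\<ominus>\<^bsub>C\<^esub> s = (\<lambda>n. - s n)"
      using C.minus_equality[of "\<lambda>n. - s n" s] null_cauchy[OF s] cauchy_minus by simp
    then show "\<ominus>\<^bsub>C\<^esub> s \<in> I" using null_minus[OF s] by simp
    fix t assume "t \<in> I"
    then show "s \<oplus>\<^bsub>C\<^esub> t \<in> I" using null_add[OF s] by simp
  qed
  show "x \<otimes>\<^bsub>C\<^esub> s \<in> I" "s \<otimes>\<^bsub>C\<^esub> x \<in> I" if "s \<in> I" "x \<in> carrier C" for s x
    using null_mult[of x s] that by (auto simp: mult.commute)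
qed

text \<open>Late terms differ by less than e while one of them has size at least e; the ultrametric
  inequality then forces all later ones to have that same size. The absolute values do not merely
  converge, they become constant.\<close>

lemma cauchy_cases:
  assumes s: "cauchy s" and nn: "s \<notin> I"
  shows "\<exists>M. s M \<noteq> 0 \<and> (\<forall>n\<ge>M. N (s n) = N (s M))"
proof -
  obtain e where e: "e > 0" "\<And>M. \<exists>n\<ge>M. N (s n) \<ge> e"
    using nn unfolding null_iff by (meson not_le)
  obtain M where M: "\<And>m n. m \<ge> M \<Longrightarrow> n \<ge> M \<Longrightarrow> N (s m - s n) < e"
    using s e(1) unfolding padic_cauchy_def by meson
  obtain k where k: "k \<ge> M" "N (s k) \<ge> e" using e(2) by blast
  have "N (s m) = N (s k)" if "m \<ge> k" for m
    using N_isosceles[of "s m" "s k"] M[of m k] that k by simp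
  moreover have "s k \<noteq> 0" using k(2) e(1) by auto
  ultimately show ?thesis by blast
qed

abbreviation cls where "cls s \<equiv> I +>\<^bsub>C\<^esub> s"

lemma cls_diff: "t \<in> cls s \<longleftrightarrow> (\<exists>r\<in>I. t = (\<lambda>n. r n + s n))"
  by (auto simp: a_r_coset_def')

text \<open>\<open>Qp_abs\<close> evaluates an arbitrary representative, which differs from s by a
  null sequence. If s is not null, the absolute values of both are eventually the same constant, so
  the bound can be tested on s itself.\<close>

lemma Zp_eq: "Zp p = cls ` {s. cauchy s \<and> (\<exists>M. \<forall>n\<ge>M. N (s n) \<le> 1)}"
proof -
  interpret I: ideal I C by (rule I_ideal)
  have "Qp_abs p (cls s) \<le> 1 \<longleftrightarrow> (\<exists>M. \<forall>n\<ge>M. N (s n) \<le> 1)" if s: "cauchy s" for s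
  proof -
    define t where "t = (SOME t. t \<in> cls s)"
    have "s \<in> cls s" using null_0 unfolding cls_diff by (intro bexI[of _ "\<lambda>n. 0"]) auto
    then have "t \<in> cls s" unfolding t_def by (rule someI[of "\<lambda>t. t \<in> cls s"])
    then obtain r where r: "r \<in> I" "t = (\<lambda>n. r n + s n)" unfolding cls_diff by blast
    have Q: "Qp_abs p (cls s) = lim (\<lambda>n. N (t n))" by (simp add: Qp_abs_def t_def)
    show ?thesis
    proof (cases "s \<in> I")
      case True
      then have "t \<in> I" using null_add[OF r(1)] r(2) by simp
      then have "(\<lambda>n. N (t n)) \<longlonglongrightarrow> 0" by (simp add: padic_null_def)
      then have "Qp_abs p (cls s) = 0" unfolding Q by (rule limI)
      moreover have "\<exists>M. \<forall>n\<ge>M. N (s n) \<le> 1" using True unfolding null_iff by (meson less_imp_le zero_less_one)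
      ultimately show ?thesis by simp
    next
      case False
      obtain M where M: "s M \<noteq> 0" "\<And>n. n \<ge> M \<Longrightarrow> N (s n) = N (s M)" using cauchy_cases[OF s False] by blast
      obtain M' where M': "\<And>n. n \<ge> M' \<Longrightarrow> N (r n) < N (s M)"
        using r(1) N_pos[OF M(1)] unfolding null_iff by meson
      have "N (t n) = N (s M)" if "n \<ge> max M M'" for n
        using N_isosceles[of "t n" "s n"] M(2)[of n] M'[of n] that r(2) by simp
      then have "eventually (\<lambda>n. N (t n) = N (s M)) sequentially"
        unfolding eventually_sequentially by blast
      then have "(\<lambda>n. N (t n)) \<longlonglongrightarrow> N (s M)" by (rule tendsto_eventually)
      then have "Qp_abs p (cls s) = N (s M)" unfolding Q by (rule limI)
      moreover have "(\<exists>M. \<forall>n\<ge>M. N (s n) \<le> 1) \<longleftrightarrow> N (s M) \<le> 1"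
      proof
        assume "\<exists>M. \<forall>n\<ge>M. N (s n) \<le> 1"
        then obtain M'' where "\<And>n. n \<ge> M'' \<Longrightarrow> N (s n) \<le> 1" by blast
        from this[of "max M M''"] M(2)[of "max M M''"] show "N (s M) \<le> 1" by simp
      next
        assume "N (s M) \<le> 1"
        then show "\<exists>M. \<forall>n\<ge>M. N (s n) \<le> 1" using M(2) by metis
      qed
      ultimately show ?thesis by simp
    qed
  qed
  moreover have "carrier (Qp p) = cls ` {s. cauchy s}"
    by (auto simp: Qp_def FactRing_def A_RCOSETS_def')
  ultimately show ?thesis by (auto simp: Zp_def)
qed

end

section \<open>The image of the p-adic numbers in the ambient field\<close>

locale padic_hom = padic + field R for R (structure) +
  fixes \<iota> :: "(nat \<Rightarrow> rat) set \<Rightarrow> 'a"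
  assumes \<iota>: "\<iota> \<in> ring_hom (Qp p) R"
begin

text \<open>Composing with the quotient map allows p-adic numbers to be handled as Cauchy sequences
  of rationals, with \<open>\<phi>_eqI\<close> in place of equality of cosets.\<close>

definition \<phi> where "\<phi> s = \<iota> (cls s)"

lemma \<phi>_hom: "\<phi> \<in> ring_hom C R"
proof -
  have "(\<lambda>s. cls s) \<in> ring_hom C (Qp p)" unfolding Qp_def by (rule ideal.rcos_ring_hom[OF I_ideal])
  from ring_hom_trans[OF this \<iota>] have "\<iota> \<circ> (\<lambda>s. cls s) \<in> ring_hom C R" .
  then show ?thesis by (simp add: \<phi>_def[abs_def] comp_def)
qed

sublocale \<phi>: ring_hom_cring C R \<phi>
  using C_cring \<phi>_hom cring_axioms by (simp add: ring_hom_cring_def ring_hom_cring_axioms_def)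

definition F where "F = \<iota> ` carrier (Qp p)"
definition A where "A = \<iota> ` Zp p"
definition q where "q = \<phi> (\<lambda>n. of_nat p)"

lemma F_eq: "F = \<phi> ` {s. cauchy s}"
  by (auto simp: F_def \<phi>_def Qp_def FactRing_def A_RCOSETS_def')

lemma A_eq: "A = \<phi> ` {s. cauchy s \<and> (\<exists>M. \<forall>n\<ge>M. N (s n) \<le> 1)}"
  by (auto simp: A_def \<phi>_def Zp_eq)

lemma \<phi>_null: "s \<in> I \<Longrightarrow> \<phi> s = \<zero>"
proof -
  interpret I: ideal I C by (rule I_ideal)
  assume s: "s \<in> I"
  have "cls s = cls (\<lambda>n. 0)"
    using I.a_rcos_const[OF s] I.a_rcos_const[OF null_0] by simp
  then show "\<phi> s = \<zero>" using \<phi>.hom_zero by (simp add: \<phi>_def)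
qed

lemma \<phi>_eqI:
  assumes "cauchy s" "cauchy t" "(\<lambda>n. s n - t n) \<in> I"
  shows "\<phi> s = \<phi> t"
proof -
  have "\<phi> ((\<lambda>n. s n - t n) \<oplus>\<^bsub>C\<^esub> t) = \<phi> (\<lambda>n. s n - t n) \<oplus> \<phi> t"
    by (rule \<phi>.hom_add) (use assms null_cauchy in auto)
  then show ?thesis using \<phi>_null[OF assms(3)] \<phi>.hom_closed[of t] assms(2) by simp
qed

lemma \<phi>_add: "cauchy s \<Longrightarrow> cauchy t \<Longrightarrow> \<phi> (\<lambda>n. s n + t n) = \<phi> s \<oplus> \<phi> t"
  and \<phi>_mult: "cauchy s \<Longrightarrow> cauchy t \<Longrightarrow> \<phi> (\<lambda>n. s n * t n) = \<phi> s \<otimes> \<phi> t"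
  and \<phi>_one: "\<phi> (\<lambda>n. 1) = \<one>" and \<phi>_zero: "\<phi> (\<lambda>n. 0) = \<zero>" and \<phi>_closed: "cauchy s \<Longrightarrow> \<phi> s \<in> carrier R"
  using \<phi>.hom_add[of s t] \<phi>.hom_mult[of s t] \<phi>.hom_one \<phi>.hom_zero \<phi>.hom_closed[of s] by auto

lemma \<phi>_minus: "cauchy s \<Longrightarrow> \<phi> (\<lambda>n. - s n) = \<ominus> \<phi> s"
  using \<phi>_add[of "\<lambda>n. - s n" s] cauchy_minus[of s] \<phi>_closed[of s] \<phi>_closed[of "\<lambda>n. - s n"] \<phi>_zero
    minus_equality[of "\<phi> (\<lambda>n. - s n)" "\<phi> s"] by simp

lemma A_subring: "subring A R"
proof (rule subringI)
  show "A \<subseteq> carrier R" using \<phi>_closed by (auto simp: A_eq)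
  show "\<one> \<in> A" unfolding A_eq using \<phi>_one cauchy_const by (intro image_eqI[of _ _ "\<lambda>n. 1"]) auto
  show "\<ominus> h \<in> A" if h: "h \<in> A" for h
  proof -
    obtain s M where s: "h = \<phi> s" "cauchy s" "\<forall>n\<ge>M. N (s n) \<le> 1" using h by (auto simp: A_eq)
    then show ?thesis unfolding A_eq using \<phi>_minus cauchy_minus
      by (intro image_eqI[of _ _ "\<lambda>n. - s n"]) auto
  qed
  fix g h assume "g \<in> A" "h \<in> A"
  then obtain s M t M' where s: "g = \<phi> s" "cauchy s" "\<forall>n\<ge>M. N (s n) \<le> 1"
    and t: "h = \<phi> t" "cauchy t" "\<forall>n\<ge>M'. N (t n) \<le> 1" by (auto simp: A_eq)
  have "N (s n + t n) \<le> 1" "N (s n * t n) \<le> 1" if "n \<ge> max M M'" for n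
    using N_ultra[of "s n" "t n"] s(3) t(3) that mult_le_one[of "N (s n)" "N (t n)"] N_nonneg
    by (auto simp: N_mult intro: order_trans)
  then have "\<exists>M. \<forall>n\<ge>M. N (s n + t n) \<le> 1" "\<exists>M. \<forall>n\<ge>M. N (s n * t n) \<le> 1" by blast+
  then show "g \<otimes> h \<in> A" "g \<oplus> h \<in> A"
    unfolding A_eq s(1) t(1) using \<phi>_mult[OF s(2) t(2)] \<phi>_add[OF s(2) t(2)] cauchy_mult[OF s(2) t(2)] cauchy_add[OF s(2) t(2)]
    by (auto simp: image_iff simp flip: \<phi>_mult[OF s(2) t(2)] \<phi>_add[OF s(2) t(2)])
qed

lemma A_F: "A \<subseteq> F" by (auto simp: A_eq F_eq)

lemma unit_A:
  assumes t: "cauchy t" and M: "\<And>n. n \<ge> M \<Longrightarrow> N (t n) = 1"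
  shows "\<phi> t \<in> A" "\<phi> t \<noteq> \<zero>" "inv (\<phi> t) \<in> A"
proof -
  show tA: "\<phi> t \<in> A" unfolding A_eq using t M by force
  have nz: "t n \<noteq> 0" if "n \<ge> M" for n using M[OF that] by auto
  have i: "cauchy (\<lambda>n. inverse (t n))"
    unfolding padic_cauchy_def
  proof (intro allI impI)
    fix e :: real assume "e > 0"
    then obtain M' where M': "\<And>m n. m \<ge> M' \<Longrightarrow> n \<ge> M' \<Longrightarrow> N (t m - t n) < e"
      using t unfolding padic_cauchy_def by meson
    have "N (inverse (t m) - inverse (t n)) < e" if "m \<ge> max M M'" "n \<ge> max M M'" for m n
    proof -
      have "inverse (t m) - inverse (t n) = (t n - t m) * (inverse (t m) * inverse (t n))"
        using nz[of m] nz[of n] that by (simp add: field_simps)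
      then show ?thesis using M[of m] M[of n] M'[of n m] that by (simp add: N_mult N_inverse)
    qed
    then show "\<exists>M. \<forall>m\<ge>M. \<forall>n\<ge>M. N (inverse (t m) - inverse (t n)) < e" by blast
  qed
  \<comment> \<open>Before M some t n may be 0, where \<open>inverse\<close> gives 0. The product is
    1 only from M on, which suffices modulo null sequences.\<close>
  have "N (t n * inverse (t n) - 1) = 0" if "n \<ge> M" for n using nz[OF that] by simp
  then have "(\<lambda>n. t n * inverse (t n) - 1) \<in> I" unfolding null_iff by (intro allI impI exI[of _ M]) simp
  then have 1: "\<phi> t \<otimes> \<phi> (\<lambda>n. inverse (t n)) = \<one>"
    using \<phi>_eqI[OF cauchy_mult[OF t i] cauchy_const] \<phi>_mult[OF t i] \<phi>_one by simp
  have c: "\<phi> t \<in> carrier R" "\<phi> (\<lambda>n. inverse (t n)) \<in> carrier R" using \<phi>_closed t i by auto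
  show "\<phi> t \<noteq> \<zero>" using 1 c by auto
  have "inv (\<phi> t) = \<phi> (\<lambda>n. inverse (t n))"
    using inv_char[of "\<phi> t" "\<phi> (\<lambda>n. inverse (t n))"] 1 c by (simp add: m_comm)
  moreover have "\<phi> (\<lambda>n. inverse (t n)) \<in> A" unfolding A_eq using i M by (force simp: N_inverse)
  ultimately show "inv (\<phi> t) \<in> A" by simp
qed

text \<open>If 1/p were represented by a sequence z of absolute values at most 1, then p z - 1 would
  eventually have absolute value exactly 1 and represent a unit, although its image is q (1/q) - 1 =
  0.\<close>

lemma q_nonzero: "q \<noteq> \<zero>" and inv_q_A: "inv q \<notin> A"
proof -
  have p0: "(of_nat p :: rat) \<noteq> 0" using prime_gt_0_nat[OF prime_p] by simp
  have 1: "q \<otimes> \<phi> (\<lambda>n. inverse (of_nat p)) = \<one>"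
    using \<phi>_mult[OF cauchy_const cauchy_const, of "of_nat p" "inverse (of_nat p)"] \<phi>_one p0 by (simp add: q_def)
  have c: "q \<in> carrier R" "\<phi> (\<lambda>n. inverse (of_nat p)) \<in> carrier R" using \<phi>_closed cauchy_const by (auto simp: q_def)
  show q0: "q \<noteq> \<zero>" using 1 c by auto
  show "inv q \<notin> A"
  proof
    assume "inv q \<in> A"
    then obtain z M where z: "inv q = \<phi> z" "cauchy z" "\<And>n. n \<ge> M \<Longrightarrow> N (z n) \<le> 1" by (auto simp: A_eq)
    define w where "w = (\<lambda>n. of_nat p * z n + - 1)"
    have "N (w n) = 1" if "n \<ge> M" for n
    proof -
      have "N (of_nat p * z n) \<le> inverse (real p)" using z(3)[OF that] p_gt by (simp add: N_mult N_p)
      also have "\<dots> < 1" using p_gt by (simp add: field_simps)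
      finally have "N (of_nat p * z n) < 1" .
      then show ?thesis using N_isosceles[of "w n" "- 1"] by (simp add: w_def)
    qed
    moreover have "cauchy w"
      unfolding w_def by (rule cauchy_add[OF cauchy_mult[OF cauchy_const z(2)] cauchy_const])
    ultimately have "\<phi> w \<noteq> \<zero>" using unit_A(2) by blast
    moreover have "\<phi> w = \<phi> (\<lambda>n. of_nat p) \<otimes> \<phi> z \<oplus> \<phi> (\<lambda>n. - 1)"
      unfolding w_def \<phi>_add[OF cauchy_mult[OF cauchy_const z(2)] cauchy_const]
        \<phi>_mult[OF cauchy_const z(2)] ..
    then have "\<phi> w = q \<otimes> inv q \<oplus> \<ominus> \<one>"
      using \<phi>_minus[OF cauchy_const, of 1] \<phi>_one z(1) by (simp add: q_def)
    moreover have "q \<otimes> inv q = \<one>" using inv_carrier(2) q0 c by simp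
    ultimately show False by (simp add: r_neg)
  qed
qed

lemma q_A: "q \<in> A"
proof -
  have "N (of_nat p) \<le> 1" using N_int_le[of "int p"] by simp
  then show ?thesis unfolding A_eq q_def using cauchy_const by auto
qed

lemma \<phi>_q_power: "\<phi> (\<lambda>n. of_nat p ^ k) = q [^] k"
proof (induction k)
  case 0
  then show ?case using \<phi>_one by simp
next
  case (Suc k)
  then show ?case using \<phi>_mult[OF cauchy_const cauchy_const, of "of_nat p ^ k" "of_nat p"]
    by (simp add: q_def mult.commute)
qed

text \<open>The absolute value of a representing sequence is eventually a constant power of p, and
  dividing by that power leaves a unit. Powers of q on both sides keep the exponents
  natural.\<close>

lemma F_decompose:
  assumes x: "x \<in> F" "x \<noteq> \<zero>"
  shows "\<exists>u k m. u \<in> A \<and> u \<noteq> \<zero> \<and> inv u \<in> A \<and> x \<otimes> q [^] (k::nat) = u \<otimes> q [^] (m::nat)"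
proof -
  obtain s where s: "cauchy s" "x = \<phi> s" using x(1) by (auto simp: F_eq)
  then have "s \<notin> I" using \<phi>_null x(2) by auto
  then obtain M where M: "s M \<noteq> 0" "\<And>n. n \<ge> M \<Longrightarrow> N (s n) = N (s M)" using cauchy_cases[OF s(1)] by blast
  define v where "v = padic_val p (s M)"
  \<comment> \<open>At most one of k and m is nonzero, and m - k = v; so r = p^(-v) has absolute
    value p^v and cancels that of s M.\<close>
  define k m where "k = nat (- v)" and "m = nat v"
  define r :: rat where "r = of_nat p ^ k * inverse (of_nat p ^ m)"
  have p0: "(of_nat p :: rat) \<noteq> 0" "real p > 0" using prime_gt_0_nat[OF prime_p] by auto
  have Nr: "N (s M) * N r = 1"
  proof -
    have "N (s M) = real p powi (- v)" using M(1) by (simp add: padic_abs_def v_def)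
    moreover have "N r = inverse (real p ^ k) * real p ^ m"
      by (simp add: r_def N_mult N_inverse N_power N_p power_inverse)
    moreover have "real p powi (- v) * (inverse (real p ^ k) * real p ^ m) = 1"
      using p0 by (cases "v \<ge> 0") (simp_all add: k_def m_def power_int_def power_inverse)
    ultimately show ?thesis by simp
  qed
  define t where "t = (\<lambda>n. s n * r)"
  have t: "cauchy t" unfolding t_def by (rule cauchy_mult[OF s(1) cauchy_const])
  have "N (t n) = 1" if "n \<ge> M" for n using M(2)[OF that] Nr by (simp add: t_def N_mult)
  note u = unit_A[OF t this]
  have "(\<lambda>n. s n * of_nat p ^ k) = (\<lambda>n. t n * of_nat p ^ m)"
    using p0 by (simp add: t_def r_def fun_eq_iff)
  then have "\<phi> s \<otimes> q [^] k = \<phi> t \<otimes> q [^] m"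
    using \<phi>_mult[OF s(1) cauchy_const, of "of_nat p ^ k"] \<phi>_mult[OF t cauchy_const, of "of_nat p ^ m"] \<phi>_q_power by simp
  then show ?thesis using u s by blast
qed

lemma \<phi>_int: "\<phi> (\<lambda>n. of_int b) = add_pow R b \<one>"
proof -
  have nat: "\<phi> (\<lambda>n. of_nat m) = add_pow R m \<one>" for m :: nat
  proof (induction m)
    case 0
    then show ?case using \<phi>_zero by simp
  next
    case (Suc m)
    then show ?case using \<phi>_add[OF cauchy_const cauchy_const, of "of_nat m" 1] \<phi>_one by (simp add: add.commute)
  qed
  show ?thesis
  proof (cases b rule: int_cases2)
    case (nonneg m)
    then show ?thesis using nat[of m] by (simp add: add_pow_int_ge)
  next
    case (nonpos m)
    have "add_pow R (- int m) \<one> = \<ominus> (add_pow R m \<one>)" using add.int_pow_neg_int[OF one_closed] by (simp add: add_pow_def)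
    then show ?thesis using nonpos nat[of m] \<phi>_minus[OF cauchy_const, of "of_nat m"] by simp
  qed
qed

lemma q_eq: "q = add_pow R p \<one>" using \<phi>_int[of "int p"] by (simp add: q_def add_pow_int_ge)

lemma int_A: "add_pow R b \<one> \<in> A" for b :: int
  unfolding \<phi>_int[symmetric] A_eq by (rule imageI) (simp add: N_int_le cauchy_const)

lemma int_unit:
  assumes "\<not> int p dvd b"
  shows "add_pow R b \<one> \<noteq> \<zero>" "inv (add_pow R b \<one>) \<in> A"
proof -
  have "b \<noteq> 0" using assms by auto
  then have "N (of_int b) = 1" using N_int[of b] not_dvd_imp_multiplicity_0[OF assms] by simp
  from unit_A[OF cauchy_const this] show "add_pow R b \<one> \<noteq> \<zero>" "inv (add_pow R b \<one>) \<in> A"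
    by (simp_all add: \<phi>_int)
qed

end

section \<open>The field generated by a root of unity and a radical\<close>

context field
begin

text \<open>If x is not in V then 1/x is, and x = x^m (1/x)^(m-1).\<close>

lemma valuation_ring_root:
  assumes V: "valuation_ring V" and x: "x \<in> carrier R" and m: "m > 0" and xm: "x [^] (m::nat) \<in> V"
  shows "x \<in> V"
proof (rule ccontr)
  assume nx: "x \<notin> V"
  have Vs: "subring V R" using V by (simp add: valuation_ring_def)
  have x0: "x \<noteq> \<zero>" using nx subringE(2)[OF Vs] by auto
  note ix = inv_carrier[OF x x0]
  have iV: "inv x \<in> V" using V nx x x0 by (auto simp: valuation_ring_def)
  obtain l where l: "m = Suc l" using m gr0_implies_Suc by blast
  have "x [^] m \<otimes> inv x [^] l = x \<otimes> (x \<otimes> inv x) [^] l"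
    using l x ix(1) by (simp add: nat_pow_distrib m_ac)
  then have "x = x [^] m \<otimes> inv x [^] l" using ix x by simp
  then show False using nx subringE(6)[OF Vs xm subring_pow[OF Vs iV]] by metis
qed

text \<open>With y = 1 + z, one of z/y and y/z lies in V. The second would put y/z - 1 = 1/z into V,
  so z/y is in V, and 1/y = 1 - z/y as well. The assumption on \<open>inv z\<close> is conditional
  in order to cover z = 0.\<close>

lemma valuation_ring_local:
  assumes V: "valuation_ring V" and z: "z \<in> V" and nz: "z \<noteq> \<zero> \<Longrightarrow> inv z \<notin> V"
  shows "\<one> \<oplus> z \<noteq> \<zero> \<and> inv (\<one> \<oplus> z) \<in> V"
proof -
  have Vs: "subring V R" using V by (simp add: valuation_ring_def)
  note VE = subringE[OF Vs]
  have zc: "z \<in> carrier R" using z VE(1) by auto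
  show ?thesis
  proof (cases "z = \<zero>")
    case True
    then show ?thesis using VE(3) by simp
  next
    case False
    note iz = inv_carrier[OF zc False]
    define y where "y = \<one> \<oplus> z"
    have yc: "y \<in> carrier R" using zc by (simp add: y_def)
    have y0: "y \<noteq> \<zero>"
    proof
      assume "y = \<zero>"
      then have "\<ominus> \<one> = z" unfolding y_def using zc minus_equality[of z \<one>] by (simp add: add.m_comm)
      moreover have "\<ominus> \<one> \<otimes> \<ominus> \<one> = \<one>" by algebra
      ultimately have "inv z = z" using zc inv_char[of z z] by simp
      then show False using z nz False by simp
    qed
    note iy = inv_carrier[OF yc y0]
    have "z \<otimes> inv y \<in> V"
    proof (rule ccontr)
      assume n: "z \<otimes> inv y \<notin> V"
      have nn: "z \<otimes> inv y \<noteq> \<zero>" using n VE(2) by auto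
      have "inv (z \<otimes> inv y) = y \<otimes> inv z"
      proof (rule comm_inv_char)
        have "(z \<otimes> inv y) \<otimes> (y \<otimes> inv z) = (z \<otimes> inv z) \<otimes> (inv y \<otimes> y)"
          using zc yc iz(1) iy(1) by (simp add: m_ac)
        then show "(z \<otimes> inv y) \<otimes> (y \<otimes> inv z) = \<one>" using iz iy by simp
      qed (use zc yc iz iy in auto)
      then have "y \<otimes> inv z \<in> V" using V n nn zc iy(1) by (auto simp: valuation_ring_def)
      moreover have "y \<otimes> inv z = inv z \<oplus> z \<otimes> inv z" unfolding y_def using zc iz(1) by algebra
      ultimately have "inv z \<oplus> \<one> \<in> V" using iz by simp
      then have "(inv z \<oplus> \<one>) \<oplus> \<ominus> \<one> \<in> V" using VE(3,5,7) by blast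
      moreover have "(inv z \<oplus> \<one>) \<oplus> \<ominus> \<one> = inv z" using iz(1) by algebra
      ultimately show False using nz False by simp
    qed
    then have "\<one> \<oplus> \<ominus> (z \<otimes> inv y) \<in> V" using VE(3,5,7) by blast
    moreover have "\<one> \<oplus> \<ominus> (z \<otimes> inv y) = inv y"
    proof -
      have "(\<one> \<oplus> z) \<otimes> inv y = inv y \<oplus> z \<otimes> inv y" using zc iy(1) by algebra
      then have "y \<otimes> inv y = inv y \<oplus> z \<otimes> inv y" unfolding y_def[symmetric] .
      then have "\<one> = inv y \<oplus> z \<otimes> inv y" using iy by simp
      then have "\<one> \<oplus> \<ominus> (z \<otimes> inv y) = (inv y \<oplus> z \<otimes> inv y) \<oplus> \<ominus> (z \<otimes> inv y)" by simp
      also have "\<dots> = inv y" using zc iy(1) by algebra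
      finally show ?thesis .
    qed
    ultimately show ?thesis using y0 by (simp add: y_def)
  qed
qed

lemma monic_from_pspan:
  assumes E: "subring E R" and x: "x \<in> carrier R" and N: "x [^] N \<in> pspan E x N"
  shows "\<exists>b\<in>carrier (E[X]). length b = Suc N \<and> eval b x = \<zero>"
proof -
  note EE = subringE[OF E]
  obtain g where g: "length g = N" "set g \<subseteq> E" "eval g x = x [^] N"
    using N pspan_eval[OF EE(1) x] by blast
  define f where "f = \<one> # map (\<lambda>c. \<ominus> c) g"
  have gc: "set g \<subseteq> carrier R" using g EE(1) by auto
  have "eval f x = x [^] N \<oplus> \<ominus> (x [^] N)"
    using g x eval_map_minus[OF gc x] by (simp add: f_def)
  then have "eval f x = \<zero>" using x by (simp add: r_neg)
  moreover have "f \<in> carrier (E[X])"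
    unfolding univ_poly_carrier[symmetric] polynomial_def f_def using g EE by auto
  moreover have "length f = Suc N" using g by (simp add: f_def)
  ultimately show ?thesis by blast
qed

end

section \<open>Binomial sums for the cyclotomic equation\<close>

context cring
begin

abbreviation emb :: "nat \<Rightarrow> 'a" where "emb k \<equiv> add_pow R k \<one>"

lemma emb_add: "emb (k + l) = emb k \<oplus> emb l"
  by (rule add.nat_pow_mult[symmetric, OF one_closed, folded add_pow_def])

lemma emb_mult: "emb (k * l) = emb k \<otimes> emb l"
proof (induction k)
  case (Suc k)
  have "emb (Suc k * l) = emb l \<oplus> emb k \<otimes> emb l" using Suc by (simp add: emb_add)
  then show ?case by (simp add: l_distr add.m_comm)
qed simp

text \<open>The polynomial \<open>((1 + T)\<^sup>m - 1) / T\<close>, truncated to its first \<open>k\<close> terms.\<close>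

fun binom_tail :: "'a \<Rightarrow> nat \<Rightarrow> nat \<Rightarrow> 'a" where
  "binom_tail T m 0 = \<zero>"
| "binom_tail T m (Suc k) = binom_tail T m k \<oplus> emb (m choose Suc k) \<otimes> T [^] k"

lemma binom_tail_carrier: "T \<in> carrier R \<Longrightarrow> binom_tail T m k \<in> carrier R"
  by (induction k) auto

text \<open>Truncated form of ((1 + T)^(m+1) - 1) / T = ((1 + T)^m - 1) / T + (1 + T)^m. In the last
  summand the constant 1 is written separately, so its tail is cut one step earlier. Coefficientwise
  this is Pascal's rule.\<close>

lemma binom_tail_Suc:
  assumes T: "T \<in> carrier R"
  shows "binom_tail T (Suc m) (Suc k) = binom_tail T m (Suc k) \<oplus> (\<one> \<oplus> T \<otimes> binom_tail T m k)"
proof (induction k)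
  case 0
  have "emb (Suc m) = emb m \<oplus> \<one>" using emb_add[of m 1] by simp
  then show ?case using T by simp
next
  case (Suc k)
  define c c' where "c = emb (m choose Suc (Suc k))" and "c' = emb (m choose Suc k)"
  have s: "emb (Suc m choose Suc (Suc k)) = c' \<oplus> c" using emb_add by (simp add: c_def c'_def)
  define u v P where "u = binom_tail T m (Suc k)" and "v = binom_tail T m k" and "P = T [^] k"
  have cc: "u \<in> carrier R" "v \<in> carrier R" "P \<in> carrier R" "c \<in> carrier R" "c' \<in> carrier R"
    using T binom_tail_carrier by (auto simp: u_def v_def P_def c_def c'_def)
  have u: "u = v \<oplus> c' \<otimes> P" by (simp add: u_def v_def P_def c'_def)
  have "binom_tail T (Suc m) (Suc (Suc k)) = binom_tail T (Suc m) (Suc k) \<oplus> (c' \<oplus> c) \<otimes> (P \<otimes> T)"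
    by (simp only: binom_tail.simps(2)[of T "Suc m" "Suc k"] s P_def nat_pow_Suc)
  also have "\<dots> = u \<oplus> (\<one> \<oplus> T \<otimes> v) \<oplus> (c' \<oplus> c) \<otimes> (P \<otimes> T)"
    using Suc by (simp only: u_def v_def)
  also have "\<dots> = (u \<oplus> c \<otimes> (P \<otimes> T)) \<oplus> (\<one> \<oplus> T \<otimes> (v \<oplus> c' \<otimes> P))"
    using cc T by algebra
  also have "u \<oplus> c \<otimes> (P \<otimes> T) = binom_tail T m (Suc (Suc k))"
    by (simp only: binom_tail.simps(2)[of T m "Suc k"] u_def c_def P_def nat_pow_Suc)
  finally show ?case using u by (simp only: u_def)
qed

lemma binomial_tail:
  assumes T: "T \<in> carrier R"
  shows "(\<one> \<oplus> T) [^] m = \<one> \<oplus> T \<otimes> binom_tail T m m"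
proof (induction m)
  case 0
  then show ?case using T by simp
next
  case (Suc m)
  define u where "u = binom_tail T m m"
  have uc: "u \<in> carrier R" using T binom_tail_carrier by (simp add: u_def)
  have "m choose Suc m = 0" by (simp add: binomial_eq_0)
  then have "binom_tail T m (Suc m) = u \<oplus> emb 0 \<otimes> T [^] m"
    by (simp only: binom_tail.simps(2) u_def)
  then have u': "binom_tail T m (Suc m) = u" using T uc by simp
  have "(\<one> \<oplus> T) [^] Suc m = (\<one> \<oplus> T \<otimes> u) \<otimes> (\<one> \<oplus> T)" using Suc by (simp add: u_def)
  also have "\<dots> = \<one> \<oplus> T \<otimes> (u \<oplus> (\<one> \<oplus> T \<otimes> u))" using T uc by algebra
  also have "u \<oplus> (\<one> \<oplus> T \<otimes> u) = binom_tail T (Suc m) (Suc m)"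
    using binom_tail_Suc[OF T, of m m] u' by (simp only: u_def)
  finally show ?case .
qed

text \<open>The binomial coefficients involved are divisible by p and the first one is p itself, so
  taking out p leaves 1 modulo T. The bound on k keeps out the last coefficient, which is 1.\<close>

lemma binom_tail_prime:
  assumes T: "T \<in> S" and S: "subring S R" and p: "Factorial_Ring.prime p" and k: "k < p - 1"
  shows "\<exists>s\<in>S. binom_tail T p (Suc k) = emb p \<otimes> (\<one> \<oplus> T \<otimes> s)"
  using k
proof (induction k)
  case 0
  have "binom_tail T p (Suc 0) = emb p \<otimes> (\<one> \<oplus> T \<otimes> \<zero>)"
    using T subringE(1)[OF S] by auto
  then show ?case using subringE(2)[OF S] by blast
next
  case (Suc k)
  then obtain s where s: "s \<in> S" "binom_tail T p (Suc k) = emb p \<otimes> (\<one> \<oplus> T \<otimes> s)" by auto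
  have "p dvd p choose Suc (Suc k)" by (rule dvd_choose_prime) (use Suc.prems p in auto)
  then obtain c where c: "p choose Suc (Suc k) = p * c" by (elim dvdE)
  have embS: "emb c \<in> S" for c
    by (induction c) (use subringE(2,3,7)[OF S] in auto)
  define P where "P = T [^] k"
  have PS: "P \<in> S" unfolding P_def using T subringE(3,6)[OF S] by (induction k) auto
  have cc: "emb c \<in> carrier R" "P \<in> carrier R" "T \<in> carrier R" "s \<in> carrier R" "emb p \<in> carrier R"
    using T PS s subringE(1)[OF S] by auto
  have "binom_tail T p (Suc (Suc k)) = emb p \<otimes> (\<one> \<oplus> T \<otimes> s) \<oplus> emb (p * c) \<otimes> (P \<otimes> T)"
    by (simp only: binom_tail.simps(2)[of T p "Suc k"] s c P_def nat_pow_Suc)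
  also have "\<dots> = emb p \<otimes> (\<one> \<oplus> T \<otimes> (s \<oplus> emb c \<otimes> P))"
    unfolding emb_mult using cc by algebra
  finally show ?case using subringE(6,7)[OF S] s(1) embS PS by blast
qed

end

context field
begin

lemma integral_over_subfield:
  assumes E: "subfield E R" and y: "y \<in> carrier R" and alg: "(algebraic over E) y"
  shows "integral_over R E y"
proof -
  note I = IrrE[OF E y alg]
  have "degree (Irr E y) \<ge> 1" using pirreducible_degree[OF E I(1,2)] .
  then have "Irr E y \<noteq> []" by auto
  then show ?thesis unfolding integral_over_def using I by blast
qed

end

context weights
begin

text \<open>Up to a unit x is an m-th root of q, of weight n / m; the condition n = m k makes this
  an integer.\<close>

lemma wt_root:
  assumes x: "x \<in> carrier R" "x \<noteq> \<zero>" and xm: "x [^] m = q \<otimes> w" and w: "w \<in> U" and n: "n = m * k"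
  shows "wt (int k) x"
proof (rule wtI[OF x U_pow[OF w, of k]])
  have "x [^] n = (x [^] m) [^] k" using x n by (simp add: nat_pow_pow)
  also have "\<dots> = q [^] k \<otimes> w [^] k" using xm q_carrier U_carrier[OF w] by (simp add: nat_pow_distrib)
  finally show "x [^] n = w [^] k \<otimes> q [^]\<^bsub>G\<^esub> int k"
    using qpow_nat[of "int k"] q_carrier U_carrier[OF w] by (simp add: m_comm)
qed

end

section \<open>The tower up to a fixed level i\<close>

locale kummer_tower = padic_hom +
  fixes a :: int and \<zeta> :: 'a and \<alpha> :: "nat \<Rightarrow> 'a" and i :: nat
  assumes F_field: "subfield F R"
    and F_algebraic: "y \<in> carrier R \<Longrightarrow> (algebraic over F) y"
    and a: "multiplicity (int p) a = 1"
    and zeta: "primitive_root_of_unity R p \<zeta>"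
    and \<alpha>_carrier: "\<alpha> j \<in> carrier R"
    and \<alpha>_0: "\<alpha> 0 = add_pow R a \<one>"
    and \<alpha>_Suc: "\<alpha> (Suc j) [^] p = \<alpha> j"
    and i: "i \<ge> 1"
begin

definition B where "B = \<Inter>{V. valuation_ring V \<and> A \<subseteq> V \<and> inv q \<notin> V}"
definition n where "n = (p - 1) * p ^ i"

lemma p1: "p > 1" using prime_p prime_gt_1_nat by blast

lemma q_carrier: "q \<in> carrier R" using q_A subringE(1)[OF A_subring] by auto

text \<open>Each property is checked in every member V of the family, which is nonempty by the
  extension theorem because 1/p is no p-adic integer. For \<open>B_local\<close>, the equation z^m =
  q b makes z a nonunit of V, since q is one.\<close>

lemma B_weights: "weights R B q n"
proof -
  let ?V = "{V. valuation_ring V \<and> A \<subseteq> V \<and> inv q \<notin> V}"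
  note iq = inv_carrier[OF q_carrier q_nonzero]
  have ne: "?V \<noteq> {}"
    using valuation_ring_extension[OF A_subring q_A iq(1) inv_q_A iq(2)] by blast
  have sub: "subring V R" if "V \<in> ?V" for V using that by (simp add: valuation_ring_def)
  have BV: "B \<subseteq> V" if "V \<in> ?V" for V using that by (auto simp: B_def)
  have BI: "x \<in> B" if "\<And>V. V \<in> ?V \<Longrightarrow> x \<in> V" for x using that by (auto simp: B_def)
  show ?thesis
  proof (intro weights.intro weights_axioms.intro field_axioms)
    show "subring B R" unfolding B_def by (rule subring_Inter) (use sub ne in auto)
    show "q \<in> B" by (rule BI) (use q_A in auto)
    show "q \<noteq> \<zero>" by (rule q_nonzero)
    show "inv q \<notin> B" using ne BV by blast
    show "n > 0" using p1 by (simp add: n_def)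
    show "x \<in> B" if x: "x \<in> carrier R" "x [^] m \<in> B" "m > 0" for x and m :: nat
    proof (rule BI)
      fix V assume V: "V \<in> ?V"
      then have "valuation_ring V" "x [^] m \<in> V" using x(2) BV[OF V] by auto
      then show "x \<in> V" using valuation_ring_root[OF _ x(1,3)] by blast
    qed
    show "\<one> \<oplus> z \<noteq> \<zero> \<and> inv (\<one> \<oplus> z) \<in> B"
      if z: "z \<in> carrier R" "z [^] m = q \<otimes> b" "b \<in> B" "m > 0" for z b and m :: nat
    proof -
      have main: "\<one> \<oplus> z \<noteq> \<zero> \<and> inv (\<one> \<oplus> z) \<in> V" if V: "V \<in> ?V" for V
      proof -
        have val: "valuation_ring V" and qV: "q \<in> V" "inv q \<notin> V" and bV: "b \<in> V"
          using V q_A BV[OF V] z(3) by auto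
        note VE = subringE[OF sub[OF V]]
        have bc: "b \<in> carrier R" using bV VE(1) by auto
        have "z [^] m \<in> V" using z(2) VE(6)[OF qV(1) bV] by simp
        then have zV: "z \<in> V" by (rule valuation_ring_root[OF val z(1,4)])
        have "inv z \<notin> V" if z0: "z \<noteq> \<zero>"
        proof
          assume iz: "inv z \<in> V"
          note izc = inv_carrier[OF z(1) z0]
          have "z [^] m \<otimes> inv z [^] m = (z \<otimes> inv z) [^] m"
            by (rule nat_pow_distrib[OF z(1) izc(1), symmetric])
          then have "q \<otimes> (b \<otimes> inv z [^] m) = \<one>" using izc z(2) bc q_carrier by (simp add: m_assoc)
          then have "inv q = b \<otimes> inv z [^] m"
            using inv_char[of q "b \<otimes> inv z [^] m"] q_carrier bc izc(1) by (simp add: m_comm)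
          then show False using VE(6)[OF bV subring_pow[OF sub[OF V] iz]] qV(2) by simp
        qed
        then show ?thesis by (rule valuation_ring_local[OF val zV])
      qed
      then show ?thesis using BI ne by blast
    qed
  qed
qed

sublocale W: weights R B q n by (rule B_weights)

lemma A_B: "A \<subseteq> B" by (auto simp: B_def)

lemma A_unit: "u \<in> A \<Longrightarrow> u \<noteq> \<zero> \<Longrightarrow> inv u \<in> A \<Longrightarrow> u \<in> W.U"
  using A_B subringE(1)[OF A_subring] by (auto simp: W.U_def)

lemma F_sub: "subring F R" and F_carrier: "F \<subseteq> carrier R"
  using subfieldE[OF F_field] by auto

lemma F_wt:
  assumes "x \<in> F" "x \<noteq> \<zero>"
  shows "\<exists>k. int n dvd k \<and> W.wt k x"
proof -
  obtain u k m where u: "u \<in> A" "u \<noteq> \<zero>" "inv u \<in> A" "x \<otimes> q [^] (k::nat) = u \<otimes> q [^] (m::nat)"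
    using F_decompose[OF assms] by blast
  have uU: "u \<in> W.U" using A_unit u by blast
  have xc: "x \<in> carrier R" using assms F_carrier by auto
  have qk: "q [^] k \<in> carrier R" "q [^] k \<noteq> \<zero>" using q_carrier q_nonzero nat_pow_nonzero by auto
  have "W.wt (0 + int n * int m) (u \<otimes> q [^] m)" by (rule W.wt_mult[OF W.wt_U[OF uU] W.wt_pow[OF W.wt_q]])
  then have "W.wt (int n * int m + - (int n * int k)) (x \<otimes> q [^] k \<otimes> inv (q [^] k))"
    unfolding u(4) using W.wt_mult[OF _ W.wt_inv[OF W.wt_pow[OF W.wt_q, of k]]] by force
  moreover have "x \<otimes> q [^] k \<otimes> inv (q [^] k) = x" using xc qk inv_carrier[OF qk] by (simp add: m_assoc)
  moreover have "int n dvd int n * int m + - (int n * int k)" by simp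
  ultimately show ?thesis by metis
qed

section \<open>Weights of \<zeta> - 1 and of the radicals\<close>

lemma zeta_carrier: "\<zeta> \<in> carrier R" and zeta_pow: "\<zeta> [^] p = \<one>" and zeta_neq: "\<zeta> \<noteq> \<one>"
proof -
  have z: "\<zeta> \<in> carrier R \<and> \<zeta> [^] p = \<one> \<and> (\<forall>k::nat. 0 < k \<and> k < p \<longrightarrow> \<zeta> [^] k \<noteq> \<one>)"
    using zeta unfolding primitive_root_of_unity_def .
  then show "\<zeta> \<in> carrier R" "\<zeta> [^] p = \<one>" by blast+
  then show "\<zeta> \<noteq> \<one>" using z[THEN conjunct2, THEN conjunct2, THEN spec, of 1] p1 by simp
qed

definition T where "T = \<zeta> \<ominus> \<one>"

lemma T_carrier: "T \<in> carrier R" and T_nonzero: "T \<noteq> \<zero>" and zeta_T: "\<zeta> = \<one> \<oplus> T"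
proof -
  show "T \<in> carrier R" "T \<noteq> \<zero>" using zeta_carrier zeta_neq by (auto simp: T_def)
  show "\<zeta> = \<one> \<oplus> T" unfolding T_def using zeta_carrier by algebra
qed

lemma T_B: "T \<in> B"
proof -
  have "\<zeta> \<in> B" using W.B_root[OF zeta_carrier, of p] zeta_pow p1 W.BE(3) by simp
  then show ?thesis using W.BE(3,5,7) by (simp add: T_def a_minus_def)
qed

text \<open>Since (1 + T)^p = 1 and T is not 0, the sum ((1 + T)^p - 1) / T vanishes; it is the p-th
  cyclotomic polynomial at 1 + T. Its top term T^(p-1) has coefficient 1, and the other terms form
  the truncation.\<close>

lemma T_pow: "T [^] (p - 1) = \<ominus> binom_tail T p (p - 1)"
proof -
  define S where "S = binom_tail T p (p - 1)"
  have Sc: "S \<in> carrier R" using T_carrier binom_tail_carrier by (simp add: S_def)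
  have pS: "p = Suc (p - 1)" using p1 by simp
  have "binom_tail T p p = S \<oplus> T [^] (p - 1)"
    using pS T_carrier by (metis S_def binom_tail.simps(2) binomial_n_n add.nat_pow_eone nat_pow_closed l_one add_pow_def one_closed)
  then have "\<one> = \<one> \<oplus> T \<otimes> (S \<oplus> T [^] (p - 1))"
    using binomial_tail[OF T_carrier, of p] zeta_pow zeta_T by simp
  then have "\<one> \<oplus> T \<otimes> (S \<oplus> T [^] (p - 1)) = \<one> \<oplus> \<zero>" by simp
  then have "T \<otimes> (S \<oplus> T [^] (p - 1)) = \<zero>"
    using T_carrier Sc by (metis add.l_cancel m_closed add.m_closed nat_pow_closed one_closed zero_closed)
  then have "S \<oplus> T [^] (p - 1) = \<zero>" using integral T_carrier T_nonzero Sc by (metis add.m_closed nat_pow_closed)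
  then have "T [^] (p - 1) \<oplus> S = \<zero>" using Sc T_carrier by (simp add: add.m_comm)
  then show ?thesis using minus_equality[of "T [^] (p - 1)" S] Sc T_carrier by (simp add: S_def)
qed

text \<open>The cyclotomic equation reads T^(p-1) = - p (1 + T s). Once 1 + T s is a unit of B, T is
  a (p - 1)-th root of p up to a unit and has weight n / (p - 1).\<close>

lemma T_wt: "W.wt (int p ^ i) T"
proof -
  obtain k where k: "p - 1 = Suc k" using p1 by (metis Suc_diff_1 diff_Suc_1 less_imp_Suc_add zero_less_diff plus_1_eq_Suc)
  obtain s where s: "s \<in> B" "binom_tail T p (Suc k) = emb p \<otimes> (\<one> \<oplus> T \<otimes> s)"
    using binom_tail_prime[OF T_B W.B_subring prime_p, of k] k by auto
  have sc: "s \<in> carrier R" using s(1) W.BE(1) by auto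
  define b where "b = \<ominus> (\<one> \<oplus> T \<otimes> s)"
  have bB: "b \<in> B" and bc: "b \<in> carrier R"
    using s(1) T_B W.BE(3,5,6,7) T_carrier sc by (auto simp: b_def)
  have "q \<otimes> b = \<ominus> (q \<otimes> (\<one> \<oplus> T \<otimes> s))"
    unfolding b_def using T_carrier sc q_carrier by (intro r_minus) auto
  then have Tb: "T [^] (p - 1) = q \<otimes> b"
    unfolding T_pow unfolding k s(2) q_eq by (rule sym)
  \<comment> \<open>\<open>B_local\<close> asks for a power of T s that is divisible by q; the
    equation \<open>Tb\<close> provides it before any weight of T is known.\<close>
  have "(T \<otimes> s) [^] (p - 1) = q \<otimes> (b \<otimes> s [^] (p - 1))"
    using Tb T_carrier sc bc q_carrier by (simp add: nat_pow_distrib m_assoc)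
  moreover have "b \<otimes> s [^] (p - 1) \<in> B" using W.BE(6)[OF bB subring_pow[OF W.B_subring s(1)]] .
  ultimately have u: "\<one> \<oplus> T \<otimes> s \<noteq> \<zero>" "inv (\<one> \<oplus> T \<otimes> s) \<in> B"
    using W.B_local[of "T \<otimes> s" "p - 1"] T_carrier sc p1 by auto
  then have "\<one> \<oplus> T \<otimes> s \<in> W.U" using s(1) T_B W.BE(3,6,7) T_carrier sc by (simp add: W.U_def)
  moreover have "\<ominus> \<one> \<in> W.U"
  proof -
    have "\<ominus> \<one> \<otimes> \<ominus> \<one> = \<one>" by algebra
    then have "inv (\<ominus> \<one>) = \<ominus> \<one>" using inv_char[of "\<ominus> \<one>" "\<ominus> \<one>"] by simp
    moreover have "\<ominus> \<one> \<noteq> \<zero>" using \<open>\<ominus> \<one> \<otimes> \<ominus> \<one> = \<one>\<close> by auto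
    ultimately show ?thesis using W.BE(3,5) by (simp add: W.U_def)
  qed
  ultimately have "\<ominus> \<one> \<otimes> (\<one> \<oplus> T \<otimes> s) \<in> W.U" by (rule W.U_mult[rotated])
  then have "b \<in> W.U" using T_carrier sc by (simp add: b_def l_minus)
  from W.wt_root[OF T_carrier T_nonzero Tb this, of "p ^ i"] show ?thesis by (simp add: n_def)
qed

lemma alpha_pow: "\<alpha> (j + k) [^] (p ^ k) = \<alpha> j"
proof (induction k)
  case (Suc k)
  have "\<alpha> (j + Suc k) [^] (p ^ Suc k) = (\<alpha> (Suc (j + k)) [^] p) [^] (p ^ k)"
    using \<alpha>_carrier by (simp add: nat_pow_pow)
  then show ?case using Suc \<alpha>_Suc by simp
qed (use \<alpha>_carrier in simp)

text \<open>Here v_p(a) = 1 enters: a = p b with b prime to p, and such integers b are units of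
  A.\<close>

lemma alpha_0: "\<exists>w\<in>W.U. \<alpha> 0 = q \<otimes> w" and alpha_0_F: "\<alpha> 0 \<in> F"
proof -
  have "int p dvd a" using a multiplicity_dvd[of "int p" a] by simp
  then obtain b where b: "a = int p * b" by (elim dvdE)
  have a0: "a \<noteq> 0" using a by auto
  have nb: "\<not> int p dvd b"
  proof
    assume "int p dvd b"
    then have "int p ^ 2 dvd a" using b by (auto simp: power2_eq_square)
    then have "2 \<le> multiplicity (int p) a"
      using a0 p1 by (intro multiplicity_geI) auto
    then show False using a by simp
  qed
  have "add_pow R a \<one> = q \<otimes> add_pow R b \<one>"
    unfolding \<phi>_int[symmetric] b q_def
    using \<phi>_mult[OF cauchy_const cauchy_const, of "of_nat p" "of_int b"] by simp
  moreover have "add_pow R b \<one> \<in> W.U" using A_unit[OF int_A int_unit[OF nb]] .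
  ultimately show "\<exists>w\<in>W.U. \<alpha> 0 = q \<otimes> w" unfolding \<alpha>_0 by blast
  show "\<alpha> 0 \<in> F" using int_A A_F \<alpha>_0 by auto
qed

lemma alpha_nonzero: "\<alpha> j \<noteq> \<zero>"
proof
  assume "\<alpha> j = \<zero>"
  then have "\<alpha> 0 = \<zero>" using alpha_pow[of 0 j] p1 by (simp add: nat_pow_zero)
  moreover obtain w where "w \<in> W.U" "\<alpha> 0 = q \<otimes> w" using alpha_0 by blast
  ultimately show False using integral[of q w] q_carrier q_nonzero W.U_carrier by auto
qed

lemma alpha_wt:
  assumes "j \<le> i"
  shows "W.wt (int (p - 1) * int p ^ (i - j)) (\<alpha> j)"
proof -
  obtain w where w: "w \<in> W.U" "\<alpha> 0 = q \<otimes> w" using alpha_0 by blast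
  have "n = p ^ j * ((p - 1) * p ^ (i - j))"
    using assms by (simp add: n_def power_add[symmetric])
  from W.wt_root[OF \<alpha>_carrier alpha_nonzero _ w(1) this] show ?thesis
    using alpha_pow[of 0 j] w(2) by simp
qed

text \<open>The generator is \<zeta> - 1 rather than \<zeta>: the latter is a unit, and its powers,
  all of weight 0, could not be told apart by weight.\<close>

definition E\<^sub>0 where "E\<^sub>0 = simple_extension F T"

lemma coprime_p1: "coprime (p - 1) p" 
  using coprime_diff_one_left_nat[of p] p1 by simp

lemma E\<^sub>0_dist:
  assumes "j < j'" "j' < p - 1"
  shows "\<not> int n dvd int p ^ i * (int j' - int j)"
proof
  assume "int n dvd int p ^ i * (int j' - int j)"
  then have "int p ^ i * int (p - 1) dvd int p ^ i * (int j' - int j)" by (simp add: n_def mult.commute)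
  then have "int (p - 1) dvd int j' - int j" using p1 by simp
  then have "int (p - 1) \<le> int j' - int j" using assms by (intro zdvd_imp_le) auto
  then show False using assms by simp
qed

lemma T_pspan: "T [^] (p - 1) \<in> pspan F T (p - 1)"
proof -
  interpret F: span_coeffs R F by (rule span_coeffs_subring[OF F_sub])
  have emb: "emb c \<in> F" for c
    by (induction c) (use subringE(2,3,7)[OF F_sub] in auto)
  have "binom_tail T p k \<in> pspan F T k" for k
  proof (induction k)
    case (Suc k)
    then show ?case by (intro pspan_SucI[OF _ emb]) auto
  qed simp
  then have "\<ominus> \<one> \<otimes> binom_tail T p (p - 1) \<in> pspan F T (p - 1)"
    by (intro F.pspan_scale[OF T_carrier]) (use subringE(3,5,6)[OF F_sub] in auto)
  moreover have "\<ominus> \<one> \<otimes> binom_tail T p (p - 1) = T [^] (p - 1)"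
    unfolding T_pow using binom_tail_carrier[OF T_carrier] by (simp add: l_minus)
  ultimately show ?thesis by simp
qed

lemma E\<^sub>0: "subfield E\<^sub>0 R" "y \<in> E\<^sub>0 \<Longrightarrow> y \<noteq> \<zero> \<Longrightarrow> \<exists>k. int (p ^ i) dvd k \<and> W.wt k y"
proof -
  obtain b where b: "b \<in> carrier (F[X])" "length b = Suc (p - 1)" "eval b T = \<zero>"
    using monic_from_pspan[OF F_sub T_carrier T_pspan] by blast
  note ext = W.simple_extension_weights[OF F_field F_wt T_wt E\<^sub>0_dist b, folded E\<^sub>0_def]
  show "subfield E\<^sub>0 R" by (rule ext(1))
  assume "y \<in> E\<^sub>0" "y \<noteq> \<zero>"
  then obtain k j where k: "W.wt k y" "int n dvd k - int p ^ i * int j" using ext(3) by blast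
  have "int (p ^ i) dvd k - int p ^ i * int j" using k(2) by (rule dvd_trans[rotated]) (simp add: n_def)
  then have "int (p ^ i) dvd (k - int p ^ i * int j) + int p ^ i * int j" by (rule dvd_add) simp
  then have "int (p ^ i) dvd k" by simp
  then show "\<exists>k. int (p ^ i) dvd k \<and> W.wt k y" using k(1) by blast
qed

definition K where "K j = simple_extension E\<^sub>0 (\<alpha> j)"

lemma E\<^sub>0_sub: "subring E\<^sub>0 R" and E\<^sub>0_carrier: "E\<^sub>0 \<subseteq> carrier R"
  using subfieldE[OF E\<^sub>0(1)] by auto

lemma F_E\<^sub>0: "F \<subseteq> E\<^sub>0" and T_E\<^sub>0: "T \<in> E\<^sub>0"
  using simple_extension_incl[OF F_carrier T_carrier] simple_extension_mem[OF F_sub T_carrier]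
  by (auto simp: E\<^sub>0_def)

text \<open>One extension by a root of X^(p^j) - \<open>\<alpha> 0\<close> is treated at once
  instead of j layers. Weights on \<open>E\<^sub>0\<close> are multiples of p^i, and \<alpha>_j has
  weight (p - 1) p^(i-j); as p - 1 is prime to p, its first p^j powers lie in distinct classes
  modulo p^i.\<close>

lemma K:
  assumes j: "j \<le> i"
  shows "subfield (K j) R" "y \<in> K j \<Longrightarrow> y \<noteq> \<zero> \<Longrightarrow> \<exists>k. int (p ^ (i - j)) dvd k \<and> W.wt k y"
proof -
  let ?h = "int (p - 1) * int p ^ (i - j)"
  have dist: "\<not> int (p ^ i) dvd ?h * (int l' - int l)" if l: "l < l'" "l' < p ^ j" for l l'
  proof
    assume dvd: "int (p ^ i) dvd ?h * (int l' - int l)"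
    have "int (p ^ i) = int p ^ (i - j) * int p ^ j" using j by (simp add: power_add[symmetric])
    then have "int p ^ (i - j) * int p ^ j dvd int p ^ (i - j) * (int (p - 1) * (int l' - int l))"
      using dvd by (simp add: ac_simps)
    then have "int p ^ j dvd int (p - 1) * (int l' - int l)" using p1 by simp
    moreover have "coprime (int p ^ j) (int (p - 1))"
      using coprime_p1 by (simp add: coprime_commute flip: of_nat_power)
    ultimately have "int p ^ j dvd int l' - int l" by (simp add: coprime_dvd_mult_right_iff)
    then have "int p ^ j \<le> int l' - int l" using l by (intro zdvd_imp_le) auto
    moreover have "int l' < int p ^ j" using l(2) by (simp flip: of_nat_power)
    ultimately show False using l by simp
  qed
  have pj: "p ^ j > 0" using p1 by simp
  have aE: "\<alpha> 0 \<in> E\<^sub>0" using alpha_0_F F_E\<^sub>0 by auto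
  note X = X_pow_minus[OF E\<^sub>0_sub aE pj]
  have root: "eval (X_pow_minus (p ^ j) (\<alpha> 0)) (\<alpha> j) = \<zero>"
    using X(3)[OF \<alpha>_carrier] alpha_pow[of 0 j] \<alpha>_carrier by (simp add: a_minus_def r_neg)
  note ext = W.simple_extension_weights[OF E\<^sub>0(1) E\<^sub>0(2) alpha_wt[OF j] dist X(1,2) root, folded K_def]
  show "subfield (K j) R" by (rule ext(1))
  assume "y \<in> K j" "y \<noteq> \<zero>"
  then obtain k l where k: "W.wt k y" "int (p ^ i) dvd k - ?h * int l" using ext(3) by blast
  have "int (p ^ (i - j)) dvd int (p ^ i)" using j by (simp add: le_imp_power_dvd)
  then have "int (p ^ (i - j)) dvd k - ?h * int l" using k(2) by (rule dvd_trans)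
  then have "int (p ^ (i - j)) dvd (k - ?h * int l) + ?h * int l" by (rule dvd_add) simp
  then have "int (p ^ (i - j)) dvd k" by simp
  then show "\<exists>k. int (p ^ (i - j)) dvd k \<and> W.wt k y" using k(1) by blast
qed

lemma K_incl: "E\<^sub>0 \<subseteq> K j" "\<alpha> j \<in> K j"
  unfolding K_def
  by (rule simple_extension_incl[OF E\<^sub>0_carrier \<alpha>_carrier], rule simple_extension_mem[OF E\<^sub>0_sub \<alpha>_carrier])

lemma zeta_K: "\<zeta> \<in> E\<^sub>0"
  using subringE(7)[OF E\<^sub>0_sub subringE(3)[OF E\<^sub>0_sub] T_E\<^sub>0]
  by (rule ssubst[OF zeta_T])

lemma K_least:
  assumes S: "subring S R" and "F \<subseteq> S" "\<zeta> \<in> S" "\<alpha> j \<in> S"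
  shows "K j \<subseteq> S"
proof -
  have "T \<in> S" using assms(3) subringE(3,5,7)[OF S] by (simp add: T_def a_minus_def)
  then have "E\<^sub>0 \<subseteq> S" unfolding E\<^sub>0_def by (rule simple_extension_subring_incl[OF S assms(2)])
  then show ?thesis unfolding K_def by (rule simple_extension_subring_incl[OF S _ assms(4)])
qed

text \<open>At j = 0 the tower omits the radical, but \<open>\<alpha> 0\<close> is an integer and
  lies in F, so both generating sets give the same field.\<close>

lemma radical_tower_eq:
  assumes j: "j \<le> i"
  shows "radical_tower R F \<zeta> \<alpha> j = K j"
proof -
  define H where "H = (if j = 0 then F \<union> {\<zeta>} else F \<union> {\<zeta>, \<alpha> j})"
  have rt: "radical_tower R F \<zeta> \<alpha> j = generate_field R H" by (simp add: radical_tower_def H_def)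
  have Hc: "H \<subseteq> carrier R" using F_carrier zeta_carrier \<alpha>_carrier by (auto simp: H_def)
  have HK: "H \<subseteq> K j" using F_E\<^sub>0 K_incl[of j] zeta_K by (auto simp: H_def)
  have gen: "subfield (generate_field R H) R" "H \<subseteq> generate_field R H"
    using generate_field_is_subfield[OF Hc] by (auto intro: generate_field.incl)
  have "generate_field R H \<subseteq> K j" by (rule generate_field_min_subfield1[OF Hc K(1)[OF j] HK])
  moreover have "K j \<subseteq> generate_field R H"
  proof (rule K_least[OF subfieldE(1)[OF gen(1)]])
    show "\<alpha> j \<in> generate_field R H" using gen(2) alpha_0_F by (auto simp: H_def split: if_splits)
  qed (use gen(2) in \<open>auto simp: H_def split: if_splits\<close>)
  ultimately show ?thesis using rt by simp
qed

lemma K_top: "K i = simple_extension (K (i - 1)) (\<alpha> i)"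
proof
  have i1: "i - 1 \<le> i" by simp
  have s1: "subring (K (i - 1)) R" "K (i - 1) \<subseteq> carrier R" using subfieldE[OF K(1)[OF i1]] by auto
  have si: "subring (K i) R" using subfieldE(1)[OF K(1)[of i]] by simp
  have S: "subring (simple_extension (K (i - 1)) (\<alpha> i)) R"
    by (rule simple_extension_is_subring[OF s1(1) \<alpha>_carrier])
  have incl: "K (i - 1) \<subseteq> simple_extension (K (i - 1)) (\<alpha> i)" "\<alpha> i \<in> simple_extension (K (i - 1)) (\<alpha> i)"
    using simple_extension_incl[OF s1(2) \<alpha>_carrier] simple_extension_mem[OF s1(1) \<alpha>_carrier] by auto
  show "K i \<subseteq> simple_extension (K (i - 1)) (\<alpha> i)"
    by (rule K_least[OF S]) (use incl F_E\<^sub>0 K_incl(1)[of "i - 1"] zeta_K in auto)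
  have "\<alpha> (i - 1) = \<alpha> i [^] p" using \<alpha>_Suc[of "i - 1"] i by simp
  then have "\<alpha> (i - 1) \<in> K i" using subring_pow[OF si K_incl(2)] by simp
  then have "K (i - 1) \<subseteq> K i"
    by (intro K_least[OF si]) (use F_E\<^sub>0 K_incl(1)[of i] zeta_K in auto)
  then show "simple_extension (K (i - 1)) (\<alpha> i) \<subseteq> K i"
    by (rule simple_extension_subring_incl[OF si _ K_incl(2)])
qed

text \<open>The quotient m = (p^i - 1) / (p - 1) is sought because T / \<alpha>_i^m has weight p^i -
  (p - 1) m = 1. Since \<alpha>_{i-1} = \<alpha>_i^p, this element is T / \<alpha>_{i-1}^m times
  \<alpha>_i^(p^i - 1), a coefficient from K_{i-1} times a natural power of \<alpha>_i.\<close>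

lemma geometric: "\<exists>m. p ^ j = (p - 1) * m + 1" for j
proof (induction j)
  case (Suc j)
  then obtain m where m: "p ^ j = (p - 1) * m + 1" by blast
  obtain r where r: "p = Suc r" using p1 by (cases p) auto
  have "p ^ Suc j = (p - 1) * (p * m + 1) + 1" unfolding power_Suc m unfolding r by (simp add: algebra_simps)
  then show ?case by blast
qed (intro exI[of _ 0], simp)

definition m where "m = (SOME m. p ^ i = (p - 1) * m + 1)"

lemma m: "p ^ i = (p - 1) * m + 1"
  unfolding m_def by (rule someI_ex[OF geometric])

text \<open>
  With this \<open>d\<close> the element \<open>d \<alpha>\<^sub>i ^ (p ^ i - 1)\<close> has weight
  \<open>p ^ i - p (p ^ i - 1) + (p - 1) (p ^ i - 1) = 1\<close>.
\<close>

definition d where "d = T \<otimes> inv (\<alpha> (i - 1) [^] m)"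

lemma d: "d \<in> K (i - 1)" "W.wt 1 (d \<otimes> \<alpha> i [^] (p ^ i - 1))"
proof -
  have i1: "i - 1 \<le> i" by simp
  note KE = subringE[OF subfieldE(1)[OF K(1)[OF i1]]]
  have am: "\<alpha> (i - 1) [^] m \<in> K (i - 1)" "\<alpha> (i - 1) [^] m \<noteq> \<zero>"
    using subring_pow[OF subfieldE(1)[OF K(1)[OF i1]] K_incl(2)] nat_pow_nonzero[OF \<alpha>_carrier alpha_nonzero] by auto
  then have "inv (\<alpha> (i - 1) [^] m) \<in> K (i - 1)" using subfield_m_inv(1)[OF K(1)[OF i1]] by blast
  then show "d \<in> K (i - 1)" using KE(6) T_E\<^sub>0 K_incl(1)[of "i - 1"] unfolding d_def by blast
  have w1: "W.wt (int (p - 1) * int p) (\<alpha> (i - 1))" using alpha_wt[OF i1] i by simp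
  have wi: "W.wt (int (p - 1)) (\<alpha> i)" using alpha_wt[of i] by simp
  have "W.wt (int p ^ i + - (int (p - 1) * int p * int m) + int (p - 1) * int (p ^ i - 1)) (d \<otimes> \<alpha> i [^] (p ^ i - 1))"
    unfolding d_def by (intro W.wt_mult T_wt W.wt_inv W.wt_pow w1 wi)
  moreover have "int p ^ i + - (int (p - 1) * int p * int m) + int (p - 1) * int (p ^ i - 1) = 1"
  proof -
    define P where "P = int p ^ i"
    have 1: "int (p - 1) * int m = P - 1" using arg_cong[OF m, of int] by (simp add: P_def)
    have 2: "int (p ^ i - 1) = P - 1" using p1 by (simp add: P_def of_nat_diff)
    have 3: "int (p - 1) = int p - 1" using p1 by simp
    have "int (p - 1) * int p * int m = int p * (P - 1)" using 1 by (simp add: ac_simps flip: 1)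
    then show ?thesis unfolding 2 3 P_def[symmetric] by (simp add: algebra_simps 3)
  qed
  ultimately show "W.wt 1 (d \<otimes> \<alpha> i [^] (p ^ i - 1))" by simp
qed

sublocale S: kummer_step R B q n "K (i - 1)" p \<zeta> "\<alpha> i" "int (p - 1)" "int p ^ i" d "p ^ i - 1"
proof (intro kummer_step.intro kummer_step_axioms.intro B_weights)
  have i1: "i - 1 \<le> i" by simp
  show "subfield (K (i - 1)) R" by (rule K(1)[OF i1])
  show "Factorial_Ring.prime p" by (rule prime_p)
  show "primitive_root_of_unity R p \<zeta>" by (rule zeta)
  show "\<zeta> \<in> K (i - 1)" using zeta_K K_incl(1) by auto
  show "\<alpha> i [^] p \<in> K (i - 1)" using \<alpha>_Suc[of "i - 1"] i K_incl(2)[of "i - 1"] by simp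
  show "\<exists>k. int p dvd k \<and> W.wt k y" if "y \<in> K (i - 1)" "y \<noteq> \<zero>" for y
    using K(2)[OF i1 that] i by simp
  show "W.wt (int (p - 1)) (\<alpha> i)" using alpha_wt[of i] by simp
  show "\<not> int p dvd int (p - 1)"
    unfolding int_dvd_int_iff using p1 by (auto dest: dvd_imp_le)
  show "W.wt (int p ^ i) (\<zeta> \<ominus> \<one>)" using T_wt by (simp add: T_def)
  show "0 < int p ^ i" using p1 by simp
  show "d \<in> K (i - 1)" "W.wt 1 (d \<otimes> \<alpha> i [^] (p ^ i - 1))" by (rule d)+
  show "\<not> p dvd p ^ i - 1"
  proof
    assume "p dvd p ^ i - 1"
    moreover have "p dvd p ^ i" using i by (cases i) auto
    ultimately have "p dvd p ^ i - (p ^ i - 1)" by (rule dvd_diff_nat[rotated])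
    moreover have "p ^ i > 0" using p1 by simp
    then have "p ^ i - (p ^ i - 1) = 1" by (intro diff_diff_cancel) linarith
    ultimately show False using p1 by simp
  qed
qed

section \<open>The valuation ring of K_i as an integral closure\<close>

lemma L_eq: "S.L = K i" unfolding S.L_def by (rule K_top[symmetric])

lemma integral_iff_B:
  assumes y: "y \<in> S.L"
  shows "integral_over R A y \<longleftrightarrow> y \<in> B"
proof
  have yc: "y \<in> carrier R" using y S.LE(1) by auto
  show "y \<in> B" if "integral_over R A y"
    using that integral_over_iff_valuation_rings[OF A_subring yc] by (auto simp: B_def)
  assume yB: "y \<in> B"
  have "y \<in> V" if V: "valuation_ring V" "A \<subseteq> V" for V
  proof (cases "inv q \<in> V")
    case False
    then show ?thesis using yB V by (auto simp: B_def)
  next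
    case True
    have Vs: "subring V R" using V by (simp add: valuation_ring_def)
    note VE = subringE[OF Vs]
    \<comment> \<open>By \<open>F_decompose\<close> every p-adic number is u q^l / q^k, hence in V
      together with 1/q. Elements algebraic over the field F are integral over it, so y is in V
      without recourse to \<open>yB\<close>.\<close>
    have "F \<subseteq> V"
    proof
      fix x assume x: "x \<in> F"
      show "x \<in> V"
      proof (cases "x = \<zero>")
        case False
        obtain u k l where u: "u \<in> A" "x \<otimes> q [^] (k::nat) = u \<otimes> q [^] (l::nat)"
          using F_decompose[OF x False] by blast
        have xc: "x \<in> carrier R" using x F_carrier by auto
        note iq = inv_carrier[OF q_carrier q_nonzero]
        have "q [^] k \<otimes> inv q [^] k = (q \<otimes> inv q) [^] k"
          by (rule nat_pow_distrib[OF q_carrier iq(1), symmetric])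
        then have "x \<otimes> q [^] k \<otimes> inv q [^] k = x" using iq xc q_carrier by (simp add: m_assoc)
        then have "x = u \<otimes> q [^] l \<otimes> inv q [^] k" using u(2) by simp
        then show ?thesis
          using VE(6) subring_pow[OF Vs True, of k] subring_pow[OF Vs, of q l] u(1) q_A V(2) by (metis subsetD)
      qed (use VE(2) in simp)
    qed
    then show ?thesis
      using valuation_ring_integral[OF V(1) _ F_sub yc integral_over_subfield[OF F_field yc F_algebraic[OF yc]]] by blast
  qed
  then show "integral_over R A y" using integral_over_iff_valuation_rings[OF A_subring yc] by blast
qed

lemma kummer_tower_step:
  "galois_extension R (K i) (K (i - 1)) \<and> cyclic_group (Gal_group R (K i) (K (i - 1))) \<and>
   order (Gal_group R (K i) (K (i - 1))) = p \<and>
   ramification_breaks R A (K i) (K (i - 1)) = {int p ^ i} \<and>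
   ramification_group R A (K i) (K (i - 1)) (int p ^ i) = carrier (Gal_group R (K i) (K (i - 1))) \<and>
   ramification_group R A (K i) (K (i - 1)) (int p ^ i + 1) = {\<one>\<^bsub>Gal_group R (K i) (K (i - 1))\<^esub>}"
  using S.galois S.cyclic_Gal S.order_Gal S.ramification_breaks_eq[OF integral_iff_B]
    S.ramification_group_low[OF integral_iff_B, of "int p ^ i"]
    S.ramification_group_high[OF integral_iff_B, of "int p ^ i + 1"] S.e_pos
  unfolding L_eq by simp

end

section \<open>The statement for a given algebraic closure\<close>

theorem theorem6p3:
  fixes p :: nat and a :: int
    and \<Omega> :: "('a, 'b) ring_scheme"
    and \<iota> :: "(nat \<Rightarrow> rat) set \<Rightarrow> 'a"
    and \<zeta> :: 'a and \<alpha> :: "nat \<Rightarrow> 'a"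
    and K :: "nat \<Rightarrow> 'a set" and Z :: "'a set"
    and i :: nat
  assumes "Factorial_Ring.prime p" and "odd p"
    and "multiplicity (int p) a = 1"
    and "\<iota> \<in> ring_hom (Qp p) \<Omega>"
    and "algebraic_closure \<Omega> (\<iota> ` carrier (Qp p))"
    and "primitive_root_of_unity \<Omega> p \<zeta>"
    and "\<And>j. \<alpha> j \<in> carrier \<Omega>"
    and "\<alpha> 0 = [a] \<cdot>\<^bsub>\<Omega>\<^esub> \<one>\<^bsub>\<Omega>\<^esub>"
    and "\<And>j. j \<ge> 1 \<Longrightarrow> \<alpha> j [^]\<^bsub>\<Omega>\<^esub> p = \<alpha> (j - 1)"
    and "K = radical_tower \<Omega> (\<iota> ` carrier (Qp p)) \<zeta> \<alpha>"
    and "Z = \<iota> ` Zp p"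
    and "i \<ge> 1"
  shows "galois_extension \<Omega> (K i) (K (i - 1)) \<and>
         cyclic_group (Gal_group \<Omega> (K i) (K (i - 1))) \<and>
         order (Gal_group \<Omega> (K i) (K (i - 1))) = p \<and>
         ramification_breaks \<Omega> Z (K i) (K (i - 1)) = {int p ^ i} \<and>
         ramification_group \<Omega> Z (K i) (K (i - 1)) (int p ^ i) =
           carrier (Gal_group \<Omega> (K i) (K (i - 1))) \<and>
         ramification_group \<Omega> Z (K i) (K (i - 1)) (int p ^ i + 1) =
           {\<one>\<^bsub>Gal_group \<Omega> (K i) (K (i - 1))\<^esub>}"
proof -
  interpret closure: algebraic_closure \<Omega> "\<iota> ` carrier (Qp p)" by (rule assms(5))
  interpret P: padic_hom p \<Omega> \<iota>
    using assms(1,4) closure.field_axioms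
    by (simp add: padic_hom_def padic_hom_axioms_def padic_def)
  interpret tower: kummer_tower p \<Omega> \<iota> a \<zeta> \<alpha> i
  proof (intro kummer_tower.intro kummer_tower_axioms.intro P.padic_hom_axioms)
    show "subfield P.F \<Omega>" unfolding P.F_def by (rule closure.subfield_axioms)
    show "(closure.algebraic over P.F) y" if "y \<in> carrier \<Omega>" for y
      unfolding P.F_def by (rule closure.algebraic_extension[OF that])
    show "\<alpha> (Suc j) [^]\<^bsub>\<Omega>\<^esub> p = \<alpha> j" for j using assms(9)[of "Suc j"] by simp
  qed (use assms in auto)
  \<comment> \<open>The normalization by n is adapted to the levels up to i, of which i - 1 and i
    are used.\<close>
  have "K j = tower.K j" if "j \<le> i" for j
    unfolding assms(10) tower.radical_tower_eq[OF that, symmetric] P.F_def ..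
  then have "K i = tower.K i" "K (i - 1) = tower.K (i - 1)" by simp_all
  moreover have "Z = P.A" by (simp add: assms(11) P.A_def)
  ultimately show ?thesis using tower.kummer_tower_step by (simp only:)
qed

end
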